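(* Let $C>0$, $\sigma>0$. Consider estimating $f\in\mathrm{RBV}^2(\mathbb{B}_1^d)$ with $\mathrm{RTV}^2_{\mathbb{B}_1^d}(f)\le C$ from $y_n=f(\mathbf{x}_n)+\varepsilon_n$, $n=1,\dots,N$, where $\varepsilon_n$ are i.i.d. $\mathcal{N}(0,\sigma^2)$ and $\mathbf{x}_n$ are i.i.d. uniform on $\mathbb{B}_1^d$. Then, for $N$ sufficiently large, \[ \inf_{\hat f\ \text{linear}}\sup_{\substack{f\in\mathrm{RBV}^2(\mathbb{B}_1^d)\\ \mathrm{RTV}^2_{\mathbb{B}_1^d}(f)\le C}}\mathbb{E}\|f-\hat f\|^2_{L^2(\mathbb{B}_1^d;\mathbb{P}_X)}\gtrsim_d\Big(\frac N{\sigma^2}\Big)^{-\frac3{d+3}}, \] where the infimum is over all linear estimators, i.e. estimators of the form $\hat f=T(y_1,\dots,y_N)$ for a linear map $T$ from $\mathbb{R}^N$ into a space of functions on $\mathbb{B}_1^d$ (which may depend arbitrarily on the design points), and $\mathbb{P}_X$ is the uniform probability measure on $\mathbb{B}_1^d$.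
   Context: $\mathbb{B}_1^d$ is the closed Euclidean unit ball in $\mathbb{R}^d$. Radon transform: $\mathscr{R}f(\boldsymbol{\gamma},t)=\int_{\{\boldsymbol{\gamma}^\top\mathbf{x}=t\}}f\,\mathrm{d}s$, $(\boldsymbol\gamma,t)\in\mathbb{S}^{d-1}\times\mathbb{R}$; $\Lambda^{d-1}=(-\partial_t^2)^{(d-1)/2}$ (Riesz potentials); $\mathrm{RTV}^2(g)=c_d\|\partial_t^2\Lambda^{d-1}\mathscr{R}g\|_{\mathcal{M}(\mathbb{S}^{d-1}\times\mathbb{R})}$, $c_d^{-1}=2(2\pi)^{d-1}$, $\mathcal{M}$ the finite Radon measures with total variation norm (distributional sense). $\mathrm{RBV}^2(\mathbb{R}^d)$: functions of at most linear growth with finite $\mathrm{RTV}^2$. $\mathrm{RBV}^2(\mathbb{B}_1^d)=\{g|_{\mathbb{B}_1^d}:g\in\mathrm{RBV}^2(\mathbb{R}^d)\}$ and $\mathrm{RTV}^2_{\mathbb{B}_1^d}(f)=\inf\{\mathrm{RTV}^2(g): g|_{\mathbb{B}_1^d}=f\}$.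
   Formalization: The implied constant may depend on C as well as d (not on σ or N); by scaling the risk behaves like C^{2d/(d+3)}(N/σ²)^{-3/(d+3)}, so a constant depending on d alone fails as C→0. Linear estimators are taken jointly measurable in design and evaluation point. *)

theory Defs
  imports "HOL-Analysis.Analysis" "HOL-Probability.Probability"
begin

fun iter_dd :: "'a::euclidean_space list \<Rightarrow> ('a \<Rightarrow> real) \<Rightarrow> 'a \<Rightarrow> real" where
  "iter_dd [] f = f"
| "iter_dd (v # vs) f = (\<lambda>x. frechet_derivative (iter_dd vs f) (at x) v)"

definition smooth_fun :: "('a::euclidean_space \<Rightarrow> real) \<Rightarrow> bool" where
  "smooth_fun f \<longleftrightarrow> (\<forall>vs x. iter_dd vs f differentiable (at x))"

text \<open>Cone construction: sigma(A) = d * Lebesgue measure of the cone {r g : g in A, 0 < r <= 1}.\<close>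
definition sphere_measure :: "'a::euclidean_space measure" where
  "sphere_measure = scale_measure (of_nat DIM('a))
      (distr (restrict_space lborel (ball 0 1 - {0})) borel (\<lambda>x. x /\<^sub>R norm x))"

text \<open>Restrictions to S^(d-1) x R of compactly supported smooth functions on R^d x R.\<close>
definition test_fun :: "('a::euclidean_space \<times> real \<Rightarrow> real) \<Rightarrow> bool" where
  "test_fun \<phi> \<longleftrightarrow> smooth_fun \<phi> \<and> bounded {z. \<phi> z \<noteq> 0}"

definition dtt :: "('a::euclidean_space \<times> real \<Rightarrow> real) \<Rightarrow> 'a \<times> real \<Rightarrow> real" where
  "dtt \<phi> = iter_dd [(0, 1), (0, 1)] \<phi>"

section \<open>Riesz potential Lambda^s = (-d_t^2)^(s/2) as a Fourier multiplier in t\<close>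

definition fourier1 :: "(real \<Rightarrow> real) \<Rightarrow> real \<Rightarrow> complex" where
  "fourier1 u \<omega> = (\<integral>t. complex_of_real (u t) * cis (- (\<omega> * t)) \<partial>lborel)"

definition riesz :: "nat \<Rightarrow> (real \<Rightarrow> real) \<Rightarrow> real \<Rightarrow> real" where
  "riesz s u t = Re ((1 / (2 * pi)) *
      (\<integral>\<omega>. complex_of_real (\<bar>\<omega>\<bar> ^ s) * fourier1 u \<omega> * cis (\<omega> * t) \<partial>lborel))"

definition ramp_filter :: "('a::euclidean_space \<times> real \<Rightarrow> real) \<Rightarrow> 'a \<times> real \<Rightarrow> real" where
  "ramp_filter \<phi> = (\<lambda>(\<gamma>, t). riesz (DIM('a) - 1) (\<lambda>s. dtt \<phi> (\<gamma>, s)) t)"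

definition backproj :: "('a::euclidean_space \<times> real \<Rightarrow> real) \<Rightarrow> 'a \<Rightarrow> real" where
  "backproj \<psi> x = (\<integral>\<gamma>. \<psi> (\<gamma>, \<gamma> \<bullet> x) \<partial>sphere_measure)"

text \<open>Distributional pairing of d_t^2 Lambda^(d-1) R g with a test function phi:
  < d_t^2 Lambda^(d-1) R g, phi > = < g, R^* Lambda^(d-1) d_t^2 phi >.\<close>
definition radon_pairing :: "('a::euclidean_space \<Rightarrow> real) \<Rightarrow> ('a \<times> real \<Rightarrow> real) \<Rightarrow> real" where
  "radon_pairing g \<phi> = (\<integral>x. g x * backproj (ramp_filter \<phi>) x \<partial>lborel)"

text \<open>c_d * total variation norm (sup over test functions bounded by 1 on S^(d-1) x R).\<close>
definition RTV2 :: "('a::euclidean_space \<Rightarrow> real) \<Rightarrow> ereal" where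
  "RTV2 g = ereal (1 / (2 * (2 * pi) ^ (DIM('a) - 1))) *
     (SUP \<phi> \<in> {\<phi>. test_fun \<phi> \<and> (\<forall>\<gamma> t. norm \<gamma> = 1 \<longrightarrow> \<bar>\<phi> (\<gamma>, t)\<bar> \<le> 1)}.
        ereal (radon_pairing g \<phi>))"

definition RBV2 :: "('a::euclidean_space \<Rightarrow> real) set" where
  "RBV2 = {g. g \<in> borel_measurable borel \<and> (\<exists>K. \<forall>x. \<bar>g x\<bar> \<le> K * (1 + norm x)) \<and> RTV2 g < \<infinity>}"

definition RBV2_ball :: "('a::euclidean_space \<Rightarrow> real) set" where
  "RBV2_ball = {f. \<exists>g \<in> RBV2. \<forall>x \<in> cball 0 1. g x = f x}"

definition RTV2_ball :: "('a::euclidean_space \<Rightarrow> real) \<Rightarrow> ereal" where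
  "RTV2_ball f = (INF g \<in> {g \<in> RBV2. \<forall>x \<in> cball 0 1. g x = f x}. RTV2 g)"

definition unif_ball :: "'a::euclidean_space measure" where
  "unif_ball = uniform_measure lborel (cball 0 1)"

definition gauss :: "real \<Rightarrow> real measure" where
  "gauss \<sigma> = density lborel (normal_density 0 \<sigma>)"

text \<open>A linear estimator: for every design X = (x_0..x_(N-1)), a linear map
  y \<mapsto> (\<lambda>x. \<Sum>n<N. y n * w X n x) from R^N into functions on the ball
  (every linear map R^N \<rightarrow> functions has this form, w X n = image of the n-th unit vector);
  we require (joint) measurability so that the risk is a genuine expectation.\<close>
definition linear_estimators :: "nat \<Rightarrow> ((nat \<Rightarrow> 'a::euclidean_space) \<Rightarrow> nat \<Rightarrow> 'a \<Rightarrow> real) set" where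
  "linear_estimators N = {w. \<forall>n < N.
     (\<lambda>(X, x). w X n x) \<in> borel_measurable (PiM {..<N} (\<lambda>_. unif_ball) \<Otimes>\<^sub>M unif_ball)}"

definition lin_risk :: "nat \<Rightarrow> real \<Rightarrow> ('a::euclidean_space \<Rightarrow> real) \<Rightarrow> ((nat \<Rightarrow> 'a) \<Rightarrow> nat \<Rightarrow> 'a \<Rightarrow> real) \<Rightarrow> ennreal" where
  "lin_risk N \<sigma> f w =
     (\<integral>\<^sup>+ X. \<integral>\<^sup>+ e. \<integral>\<^sup>+ x. ennreal ((f x - (\<Sum>n<N. (f (X n) + e n) * w X n x))\<^sup>2) \<partial>unif_ball
        \<partial>PiM {..<N} (\<lambda>_. gauss \<sigma>) \<partial>PiM {..<N} (\<lambda>_. unif_ball))"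

definition lin_minimax :: "'a::euclidean_space itself \<Rightarrow> real \<Rightarrow> real \<Rightarrow> nat \<Rightarrow> ennreal" where
  "lin_minimax _ C \<sigma> N =
     (INF w \<in> (linear_estimators N :: ((nat \<Rightarrow> 'a) \<Rightarrow> nat \<Rightarrow> 'a \<Rightarrow> real) set).
        SUP f \<in> {f :: 'a \<Rightarrow> real. f \<in> RBV2_ball \<and> RTV2_ball f \<le> ereal C}. lin_risk N \<sigma> f w)"

end

theory Submission
  imports Defs
begin

text \<open>
  For fixed design the squared bias of a linear estimator is quadratic in \<open>f\<close>, so the maximal risk is
  bounded below by its average over any (unnormalised) prior on the class, and only second moments of
  the prior matter. The prior is a family of Gaussian ridge functions of width \<open>h\<close> and height of order
  \<open>h\<close>, with Gaussian direction \<open>\<xi>\<close> and Cauchy offset \<open>s\<close>; these have bounded \<open>RTV2\<close>. A bump of width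
  \<open>h\<close> around a point \<open>x\<close> with value 1 at \<open>x\<close> is a superposition of these ridges whose coefficient
  function has squared norm of order \<open>h\<^sup>-\<^sup>3\<close>. Testing the error at \<open>x\<close> against this coefficient
  function bounds the mean risk below by a multiple of
  \<open>2 \<mu> - \<mu>\<^sup>2 (K h\<^sup>-\<^sup>3 + K' N h\<^sup>d / \<sigma>\<^sup>2)\<close> for every \<open>\<mu>\<close>, and \<open>h = (N / \<sigma>\<^sup>2)\<^sup>-\<^sup>1\<^sup>/\<^sup>(\<^sup>d\<^sup>+\<^sup>3\<^sup>)\<close> with \<open>\<mu>\<close> of order
  \<open>h\<^sup>3\<close> gives the rate.

  The bound on \<open>RTV2\<close> of a Gaussian ridge comes from polar coordinates: the filtered backprojection of a
  test function is an inverse Fourier transform of an integrable function. Damping the ridge by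
  \<open>exp (- \<epsilon>\<^sup>2 |x|\<^sup>2 / 2)\<close> makes every interchange of integrals legitimate, and \<open>\<epsilon> \<rightarrow> 0\<close> localises the
  frequency integral to the line spanned by the ridge direction.
\<close>

section \<open>Gaussian Fourier transforms\<close>

lemma borel_measurable_cis [measurable]: "cis \<in> borel_measurable borel"
  by (intro borel_measurable_continuous_onI continuous_intros)

lemma integrable_exp_square: "integrable lborel (\<lambda>t::real. exp (- t\<^sup>2 / 2))"
proof -
  have "integrable lborel (\<lambda>t. sqrt (2 * pi) * std_normal_density t)"
    by (intro integrable_mult_right integrable_normal_density) simp
  then show ?thesis
    by (simp add: std_normal_density_def)
qed

lemma fourier_exp_square:
  "(\<integral>t. of_real (exp (- t\<^sup>2 / 2)) * cis (w * t) \<partial>lborel) = complex_of_real (sqrt (2 * pi) * exp (- w\<^sup>2 / 2))"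
proof -
  have "complex_of_real (exp (- w\<^sup>2 / 2)) = char std_normal_distribution w"
    by (simp add: char_std_normal_distribution)
  also have "\<dots> = (\<integral>t. std_normal_density t *\<^sub>R cis (w * t) \<partial>lborel)"
    unfolding char_def by (subst integral_density) (auto simp: cis_conv_exp)
  also have "\<dots> = (\<integral>t. of_real (1 / sqrt (2 * pi)) * (of_real (exp (- t\<^sup>2 / 2)) * cis (w * t)) \<partial>lborel)"
    by (simp add: std_normal_density_def scaleR_conv_of_real algebra_simps)
  also have "\<dots> = of_real (1 / sqrt (2 * pi)) * (\<integral>t. (of_real (exp (- t\<^sup>2 / 2)) * cis (w * t)) \<partial>lborel)"
    by (rule integral_mult_right_zero)
  finally show ?thesis
    by (simp add: field_simps)
qed

lemma exp_norm_square_prod: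
  fixes x :: "'a::euclidean_space"
  shows "exp (- (norm x)\<^sup>2 / 2) = (\<Prod>b\<in>Basis. exp (- (x \<bullet> b)\<^sup>2 / 2))"
proof -
  have "(norm x)\<^sup>2 = (\<Sum>b\<in>Basis. (x \<bullet> b)\<^sup>2)"
    unfolding power2_norm_eq_inner by (subst euclidean_inner) (simp add: power2_eq_square)
  then show ?thesis
    by (simp add: exp_sum[symmetric] sum_negf sum_divide_distrib)
qed

lemma cis_sum: "finite A \<Longrightarrow> cis (sum f A) = (\<Prod>a\<in>A. cis (f a))"
  by (induction A rule: finite_induct) (auto simp: cis_mult[symmetric])

lemma
  fixes \<xi> :: "'a::euclidean_space"
  shows integrable_exp_norm_square: "integrable lborel (\<lambda>x::'a. exp (- (norm x)\<^sup>2 / 2))"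
    and fourier_exp_norm_square: "(\<integral>x. of_real (exp (- (norm x)\<^sup>2 / 2)) * cis (\<xi> \<bullet> x) \<partial>lborel) =
       complex_of_real (sqrt (2 * pi) ^ DIM('a) * exp (- (norm \<xi>)\<^sup>2 / 2))"
proof -
  interpret product_sigma_finite "\<lambda>_::'a. lborel :: real measure" by standard
  let ?T = "\<lambda>f. \<Sum>b\<in>Basis. f b *\<^sub>R b :: 'a"
  let ?g = "\<lambda>b t. of_real (exp (- t\<^sup>2 / 2)) * cis ((\<xi> \<bullet> b) * t)"
  have eq: "of_real (exp (- (norm (?T f))\<^sup>2 / 2)) * cis (\<xi> \<bullet> ?T f) = (\<Prod>b\<in>Basis. ?g b (f b))" for f
    unfolding exp_norm_square_prod
    by (simp add: inner_sum_left inner_sum_right inner_Basis if_distrib cis_sum prod.distrib mult.commute cong: if_cong)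
  have int: "integrable lborel (?g b)" for b
    by (rule Bochner_Integration.integrable_bound[OF integrable_exp_square]) (auto simp: norm_mult)
  have [measurable]: "(\<lambda>f. ?T f) \<in> (\<Pi>\<^sub>M b\<in>Basis. lborel) \<rightarrow>\<^sub>M borel"
    by measurable
  have "integrable (lborel::'a measure) (\<lambda>x. of_real (exp (- (norm x)\<^sup>2 / 2)) * cis (\<xi> \<bullet> x))"
    apply (subst lborel_eq)
    apply (subst integrable_distr_eq)
      apply (simp, simp)
    apply (subst eq)
    apply (rule product_integrable_prod)
    using int by auto
  from integrable_norm[OF this] show "integrable lborel (\<lambda>x::'a. exp (- (norm x)\<^sup>2 / 2))"
    by (simp add: norm_mult)
  have "(\<integral>x. of_real (exp (- (norm x)\<^sup>2 / 2)) * cis (\<xi> \<bullet> x) \<partial>lborel) = (\<Prod>b\<in>Basis. (\<integral>t. ?g b t \<partial>lborel))"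
    apply (subst lborel_eq)
    apply (subst integral_distr)
      apply (simp, simp)
    apply (subst eq)
    apply (rule product_integral_prod)
    using int by auto
  also have "\<dots> = complex_of_real (sqrt (2 * pi) ^ DIM('a) * exp (- (norm \<xi>)\<^sup>2 / 2))"
    unfolding fourier_exp_square exp_norm_square_prod by (simp add: prod.distrib)
  finally show "(\<integral>x. of_real (exp (- (norm x)\<^sup>2 / 2)) * cis (\<xi> \<bullet> x) \<partial>lborel) =
       complex_of_real (sqrt (2 * pi) ^ DIM('a) * exp (- (norm \<xi>)\<^sup>2 / 2))" .
qed

lemma integral_exp_norm_square:
  "(\<integral>z. exp (- (norm (z::'a::euclidean_space))\<^sup>2 / 2) \<partial>lborel) = sqrt (2 * pi) ^ DIM('a)"
proof -
  have "complex_of_real (\<integral>z. exp (- (norm (z::'a))\<^sup>2 / 2) \<partial>lborel) = of_real (sqrt (2 * pi) ^ DIM('a))"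
    using fourier_exp_norm_square[of "0::'a"] by simp
  then show ?thesis by (simp only: of_real_eq_iff)
qed

lemma lborel_integral_affine:
  fixes f :: "'a::euclidean_space \<Rightarrow> 'b::{banach, second_countable_topology}"
  assumes [measurable]: "f \<in> borel_measurable borel" and "c \<noteq> 0"
  shows "(\<integral>x. f x \<partial>lborel) = \<bar>c\<bar> ^ DIM('a) *\<^sub>R (\<integral>x. f (t + c *\<^sub>R x) \<partial>lborel)"
  apply (subst lborel_affine[OF \<open>c \<noteq> 0\<close>, of t])
  apply (subst integral_density)
     apply (auto simp: integral_distr)
  done

lemma integrable_lborel_affine:
  fixes f :: "'a::euclidean_space \<Rightarrow> 'b::{banach, second_countable_topology}"
  assumes "integrable lborel f" and "c \<noteq> 0"
  shows "integrable lborel (\<lambda>x. f (t + c *\<^sub>R x))"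
proof -
  have [measurable]: "f \<in> borel_measurable borel" using assms(1) by auto
  have "integrable (density (distr lborel borel (\<lambda>x. t + c *\<^sub>R x)) (\<lambda>_. ennreal (\<bar>c\<bar>^DIM('a)))) f"
    using assms lborel_affine[OF \<open>c \<noteq> 0\<close>, of t] by (simp add: ennreal_power)
  then have "integrable lborel (\<lambda>x. \<bar>c\<bar> ^ DIM('a) *\<^sub>R f (t + c *\<^sub>R x))"
    by (subst (asm) integrable_density) (auto simp: integrable_distr_eq)
  from integrable_scaleR_right[OF this, of "inverse (\<bar>c\<bar> ^ DIM('a))"] show ?thesis
    using \<open>c \<noteq> 0\<close> by simp
qed

section \<open>Fourier decay of test functions in the offset variable\<close>

definition dt :: "nat \<Rightarrow> ('a::euclidean_space \<times> real \<Rightarrow> real) \<Rightarrow> 'a \<times> real \<Rightarrow> real" where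
  "dt n \<phi> = iter_dd (replicate n (0, 1)) \<phi>"

lemma dt_0 [simp]: "dt 0 \<phi> = \<phi>"
  by (simp add: dt_def)

lemma dtt_eq_dt: "dtt \<phi> = dt 2 \<phi>"
  by (simp add: dt_def dtt_def numeral_2_eq_2)

lemma dt_Suc: "dt (Suc n) \<phi> z = frechet_derivative (dt n \<phi>) (at z) (0, 1)"
  by (simp add: dt_def)

lemma smooth_fun_continuous_dt:
  assumes "smooth_fun \<phi>"
  shows "continuous_on UNIV (dt n \<phi>)"
  using assms unfolding smooth_fun_def dt_def
  by (intro continuous_at_imp_continuous_on ballI differentiable_imp_continuous_within) auto

lemma dt_has_real_derivative:
  assumes "smooth_fun \<phi>"
  shows "((\<lambda>t. dt n \<phi> (\<gamma>, t)) has_real_derivative dt (Suc n) \<phi> (\<gamma>, t)) (at t)"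
proof -
  let ?D = "frechet_derivative (dt n \<phi>) (at (\<gamma>, t))"
  have d: "(dt n \<phi> has_derivative ?D) (at (\<gamma>, t))"
    using assms unfolding smooth_fun_def dt_def by (simp add: frechet_derivative_works)
  have "((\<lambda>t. (\<gamma>, t)) has_derivative (\<lambda>h. (0, h))) (at t)"
    by (intro derivative_eq_intros) auto
  from has_derivative_compose[OF this, of "dt n \<phi>" ?D] d
  have *: "((\<lambda>t. dt n \<phi> (\<gamma>, t)) has_derivative (\<lambda>h. ?D (0, h))) (at t)"
    by simp
  have "?D (0, h) = ?D (0, 1) * h" for h
  proof -
    have "?D (h *\<^sub>R (0, 1)) = h *\<^sub>R ?D (0, 1)"
      using d has_derivative_linear linear_scale by blast
    then show ?thesis by simp
  qed
  then have "(\<lambda>h. ?D (0, h)) = (*) (?D (0, 1))" by (rule ext)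
  from *[unfolded this] show ?thesis
    unfolding has_field_derivative_def dt_Suc .
qed

lemma iter_dd_eq_0_of_open:
  assumes "open S" "\<And>z. z \<in> S \<Longrightarrow> f z = 0" "z \<in> S"
  shows "iter_dd vs f z = 0"
  using assms(3)
proof (induction vs arbitrary: z)
  case (Cons v vs)
  have "(iter_dd vs f has_derivative (\<lambda>_. 0)) (at z)"
    by (rule has_derivative_transform_within_open[of "\<lambda>_. 0" _ _ _ S])
      (use assms(1) Cons in auto)
  from frechet_derivative_at[OF this] show ?case
    by (metis iter_dd.simps(2))
qed (use assms in auto)

lemma test_fun_support:
  assumes "test_fun \<phi>"
  obtains B where "B > 0" "\<And>n \<gamma> t. B < \<bar>t\<bar> \<Longrightarrow> dt n \<phi> (\<gamma>, t) = 0" "\<And>n z. B < norm z \<Longrightarrow> dt n \<phi> z = 0"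
proof -
  from assms obtain B where B: "B > 0" "\<And>z. \<phi> z \<noteq> 0 \<Longrightarrow> norm z \<le> B"
    unfolding test_fun_def bounded_pos by auto
  have o: "open {z::'a \<times> real. B < norm z}"
    by (intro open_Collect_less continuous_intros)
  have 1: "dt n \<phi> z = 0" if "B < norm z" for n z
    unfolding dt_def
    by (rule iter_dd_eq_0_of_open[OF o]) (use B that in force)+
  have 2: "dt n \<phi> (\<gamma>, t) = 0" if "B < \<bar>t\<bar>" for n \<gamma> t
    using 1[of "(\<gamma>, t)"] norm_snd_le[of t \<gamma>] that by simp
  show ?thesis using that B(1) 1 2 by blast
qed

lemma test_fun_bounded:
  assumes "test_fun \<phi>"
  obtains K where "K \<ge> 0" "\<And>z. \<bar>dt n \<phi> z\<bar> \<le> K"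
proof -
  obtain B where B: "B > 0" "\<And>z. B < norm z \<Longrightarrow> dt n \<phi> z = 0"
    using test_fun_support[OF assms] by metis
  have "compact (dt n \<phi> ` cball 0 B)"
    using smooth_fun_continuous_dt[of \<phi> n] assms
    by (intro compact_continuous_image) (auto simp: test_fun_def intro: continuous_on_subset)
  then obtain K where K: "K > 0" "\<And>z. z \<in> cball 0 B \<Longrightarrow> \<bar>dt n \<phi> z\<bar> \<le> K"
    using compact_imp_bounded[of "dt n \<phi> ` cball 0 B"] unfolding bounded_pos by auto
  have "\<bar>dt n \<phi> z\<bar> \<le> K" for z
    using K B(2)[of z] by (cases "B < norm z") auto
  with K(1) show ?thesis using that[of K] by auto
qed

lemma continuous_on_dt_slice:
  assumes "test_fun \<phi>" shows "continuous_on A (\<lambda>t. dt n \<phi> (\<gamma>, t))"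
proof -
  have "smooth_fun \<phi>" using assms by (simp add: test_fun_def)
  from smooth_fun_continuous_dt[OF this, of n] show ?thesis
    by (rule continuous_on_compose2) (intro continuous_intros, simp)
qed

lemma integrable_compact_support_mult:
  fixes g :: "real \<Rightarrow> 'b::euclidean_space" and f :: "real \<Rightarrow> real"
  assumes "\<And>t. B < \<bar>t\<bar> \<Longrightarrow> f t = 0" "continuous_on UNIV f" "continuous_on UNIV g"
  shows "integrable lborel (\<lambda>t. f t *\<^sub>R g t)"
proof -
  have "integrable lborel (\<lambda>t. indicator {-B..B} t *\<^sub>R (f t *\<^sub>R g t))"
    by (intro borel_integrable_compact continuous_on_subset[OF continuous_on_scaleR[OF assms(2,3)]]) auto
  also have "(\<lambda>t. indicator {-B..B} t *\<^sub>R (f t *\<^sub>R g t)) = (\<lambda>t. f t *\<^sub>R g t)"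
  proof
    fix t show "indicator {-B..B} t *\<^sub>R (f t *\<^sub>R g t) = f t *\<^sub>R g t"
      using assms(1)[of t] by (cases "t \<in> {-B..B}") auto
  qed
  finally show ?thesis .
qed

lemma integral_by_parts_compact_support:
  fixes g g' :: "real \<Rightarrow> 'b::euclidean_space" and f f' :: "real \<Rightarrow> real"
  assumes f: "\<And>t. (f has_real_derivative f' t) (at t)" "continuous_on UNIV f'"
    and g: "\<And>t. (g has_vector_derivative g' t) (at t)" "continuous_on UNIV g'"
    and B: "\<And>t. B < \<bar>t\<bar> \<Longrightarrow> f t = 0" "\<And>t. B < \<bar>t\<bar> \<Longrightarrow> f' t = 0"
  shows "(\<integral>t. f' t *\<^sub>R g t \<partial>lborel) = - (\<integral>t. f t *\<^sub>R g' t \<partial>lborel)"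
proof -
  define b where "b = \<bar>B\<bar> + 1"
  have cf: "continuous_on UNIV f"
    using f(1) by (intro continuous_at_imp_continuous_on ballI DERIV_isCont) auto
  have cg: "continuous_on UNIV g"
    using g(1) has_vector_derivative_continuous by (intro continuous_at_imp_continuous_on ballI) blast
  have i1: "integrable lborel (\<lambda>t. f' t *\<^sub>R g t)"
    by (rule integrable_compact_support_mult) (use B f cg in auto)
  have i2: "integrable lborel (\<lambda>t. f t *\<^sub>R g' t)"
    by (rule integrable_compact_support_mult) (use B cf g in auto)
  have "(\<integral>t. indicator {-b..b} t *\<^sub>R (f' t *\<^sub>R g t + f t *\<^sub>R g' t) \<partial>lborel) = f b *\<^sub>R g b - f (-b) *\<^sub>R g (-b)"
  proof (rule integral_FTC_Icc)
    show "-b \<le> b" by (simp add: b_def)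
    show "continuous_on {- b..b} (\<lambda>t. f' t *\<^sub>R g t + f t *\<^sub>R g' t)"
      using f(2) g(2) cf cg by (intro continuous_intros) (auto intro: continuous_on_subset)
    fix t
    have "((\<lambda>t. f t *\<^sub>R g t) has_vector_derivative (f t *\<^sub>R g' t + f' t *\<^sub>R g t)) (at t within {-b..b})"
      using f(1)[of t] g(1)[of t]
      by (intro has_vector_derivative_scaleR) (auto intro: has_field_derivative_at_within has_vector_derivative_at_within)
    then show "((\<lambda>t. f t *\<^sub>R g t) has_vector_derivative (f' t *\<^sub>R g t + f t *\<^sub>R g' t)) (at t within {-b..b})"
      by (simp add: add.commute)
  qed
  also have "\<dots> = 0" using B(1)[of b] B(1)[of "-b"] by (simp add: b_def)
  also have "(\<lambda>t. indicator {-b..b} t *\<^sub>R (f' t *\<^sub>R g t + f t *\<^sub>R g' t)) = (\<lambda>t. f' t *\<^sub>R g t + f t *\<^sub>R g' t)"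
  proof
    fix t
    show "indicator {-b..b} t *\<^sub>R (f' t *\<^sub>R g t + f t *\<^sub>R g' t) = f' t *\<^sub>R g t + f t *\<^sub>R g' t"
      using B[of t] by (cases "t \<in> {-b..b}") (auto simp: b_def)
  qed
  finally show ?thesis using i1 i2 by (simp add: eq_neg_iff_add_eq_0)
qed

abbreviation Fdt :: "nat \<Rightarrow> ('a::euclidean_space \<times> real \<Rightarrow> real) \<Rightarrow> 'a \<Rightarrow> real \<Rightarrow> complex" where
  "Fdt n \<phi> \<gamma> \<equiv> fourier1 (\<lambda>s. dt n \<phi> (\<gamma>, s))"

lemma Fdt_Suc:
  assumes "test_fun \<phi>"
  shows "Fdt (Suc n) \<phi> \<gamma> \<omega> = \<i> * \<omega> * Fdt n \<phi> \<gamma> \<omega>"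
proof -
  obtain B where B: "\<And>n \<gamma> t. B < \<bar>t\<bar> \<Longrightarrow> dt n \<phi> (\<gamma>, t) = 0"
    using test_fun_support[OF assms] by metis
  have "(\<integral>t. dt (Suc n) \<phi> (\<gamma>, t) *\<^sub>R cis (- (\<omega> * t)) \<partial>lborel)
     = - (\<integral>t. dt n \<phi> (\<gamma>, t) *\<^sub>R (- \<omega> *\<^sub>R (\<i> * cis (- (\<omega> * t)))) \<partial>lborel)"
  proof (rule integral_by_parts_compact_support)
    show "((\<lambda>t. dt n \<phi> (\<gamma>, t)) has_real_derivative dt (Suc n) \<phi> (\<gamma>, t)) (at t)" for t
      using assms dt_has_real_derivative by (auto simp: test_fun_def)
    show "((\<lambda>t. cis (- (\<omega> * t))) has_vector_derivative - \<omega> *\<^sub>R (\<i> * cis (- (\<omega> * t)))) (at t)" for t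
      unfolding has_vector_derivative_def
      by (auto intro!: derivative_eq_intros simp: fun_eq_iff scaleR_conv_of_real)
    show "continuous_on UNIV (\<lambda>t. - \<omega> *\<^sub>R (\<i> * cis (- (\<omega> * t))))"
      by (intro continuous_intros)
  qed (fact B continuous_on_dt_slice[OF assms])+
  also have "\<dots> = (\<integral>t. \<i> * \<omega> * (dt n \<phi> (\<gamma>, t) * cis (- (\<omega> * t))) \<partial>lborel)"
    by (subst Bochner_Integration.integral_minus[symmetric]) (simp add: scaleR_conv_of_real mult_ac)
  also have "\<dots> = \<i> * \<omega> * (\<integral>t. (dt n \<phi> (\<gamma>, t) * cis (- (\<omega> * t))) \<partial>lborel)"
    by (rule integral_mult_right_zero)
  finally show ?thesis by (simp add: fourier1_def scaleR_conv_of_real)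
qed

lemma norm_Fdt_le:
  assumes "\<And>t. B < \<bar>t\<bar> \<Longrightarrow> dt n \<phi> (\<gamma>, t) = 0" "\<And>z. \<bar>dt n \<phi> z\<bar> \<le> K" "B > 0"
  shows "norm (Fdt n \<phi> \<gamma> \<omega>) \<le> 2 * B * K"
proof -
  have "norm (Fdt n \<phi> \<gamma> \<omega>) \<le> (\<integral>t. norm (complex_of_real (dt n \<phi> (\<gamma>, t)) * cis (- (\<omega> * t))) \<partial>lborel)"
    unfolding fourier1_def by (rule integral_norm_bound)
  also have "\<dots> \<le> (\<integral>t. K * indicator {-B..B} t \<partial>lborel)"
    using assms order.trans[OF abs_ge_zero assms(2)]
    by (intro integral_mono') (auto simp: norm_mult split: split_indicator)
  also have "\<dots> = 2 * B * K" using assms(3) by simp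
  finally show ?thesis .
qed

lemma norm_Fdt_bounded:
  assumes "test_fun \<phi>"
  obtains K where "K \<ge> 0" "\<And>\<gamma> \<omega>. norm (Fdt n \<phi> \<gamma> \<omega>) \<le> K"
proof -
  obtain B where B: "B > 0" "\<And>n \<gamma> t. B < \<bar>t\<bar> \<Longrightarrow> dt n \<phi> (\<gamma>, t) = 0"
    using test_fun_support[OF assms] by metis
  obtain K where K: "K \<ge> 0" "\<And>z. \<bar>dt n \<phi> z\<bar> \<le> K"
    using test_fun_bounded[OF assms] by metis
  show ?thesis
    by (rule that[of "2 * B * K"]) (use norm_Fdt_le[of B n \<phi> _ K] B K in auto)
qed

lemma norm_Fdt_add:
  assumes "test_fun \<phi>"
  shows "norm (Fdt (k + n) \<phi> \<gamma> \<omega>) = \<bar>\<omega>\<bar> ^ k * norm (Fdt n \<phi> \<gamma> \<omega>)"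
  by (induction k) (auto simp: Fdt_Suc[OF assms] norm_mult)

lemma Fdt_decay:
  assumes "test_fun \<phi>"
  obtains K where "K \<ge> 0" "\<And>\<gamma> \<omega>. \<bar>\<omega>\<bar> ^ k * norm (Fdt n \<phi> \<gamma> \<omega>) \<le> K / (1 + \<omega>\<^sup>2)"
proof -
  obtain K1 where K1: "K1 \<ge> 0" "\<And>\<gamma> \<omega>. norm (Fdt (k + n) \<phi> \<gamma> \<omega>) \<le> K1"
    using norm_Fdt_bounded[OF assms] by metis
  obtain K2 where K2: "K2 \<ge> 0" "\<And>\<gamma> \<omega>. norm (Fdt (k + 2 + n) \<phi> \<gamma> \<omega>) \<le> K2"
    using norm_Fdt_bounded[OF assms] by metis
  have "\<bar>\<omega>\<bar> ^ k * norm (Fdt n \<phi> \<gamma> \<omega>) * (1 + \<omega>\<^sup>2) \<le> K1 + K2" for \<gamma> \<omega>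
  proof -
    have "\<bar>\<omega>\<bar> ^ k * norm (Fdt n \<phi> \<gamma> \<omega>) * (1 + \<omega>\<^sup>2) = norm (Fdt (k + n) \<phi> \<gamma> \<omega>) + norm (Fdt (k + 2 + n) \<phi> \<gamma> \<omega>)"
      unfolding norm_Fdt_add[OF assms] by (simp add: algebra_simps power2_eq_square)
    then show ?thesis using K1(2)[of \<gamma> \<omega>] K2(2)[of \<gamma> \<omega>] by linarith
  qed
  then have "\<bar>\<omega>\<bar> ^ k * norm (Fdt n \<phi> \<gamma> \<omega>) \<le> (K1 + K2) / (1 + \<omega>\<^sup>2)" for \<gamma> \<omega>
    by (subst pos_le_divide_eq) (auto simp: add_pos_nonneg)
  then show ?thesis using that[of "K1 + K2"] K1 K2 by auto
qed

lemma Fdt_uminus: "Fdt n \<phi> \<gamma> (- \<omega>) = cnj (Fdt n \<phi> \<gamma> \<omega>)"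
proof -
  have "Fdt n \<phi> \<gamma> (- \<omega>) = (\<integral>t. cnj (complex_of_real (dt n \<phi> (\<gamma>, t)) * cis (- (\<omega> * t))) \<partial>lborel)"
    unfolding fourier1_def by (simp add: cis_cnj del: Bochner_Integration.integral_cnj)
  also have "\<dots> = cnj (Fdt n \<phi> \<gamma> \<omega>)"
    unfolding fourier1_def by (rule Bochner_Integration.integral_cnj)
  finally show ?thesis .
qed

lemma Fdt_tendsto:
  assumes "test_fun \<phi>" "\<gamma>s \<longlonglongrightarrow> \<gamma>" "\<omega>s \<longlonglongrightarrow> \<omega>"
  shows "(\<lambda>i. Fdt n \<phi> (\<gamma>s i) (\<omega>s i)) \<longlonglongrightarrow> Fdt n \<phi> \<gamma> \<omega>"
proof -
  obtain B where B: "B > 0" "\<And>n \<gamma> t. B < \<bar>t\<bar> \<Longrightarrow> dt n \<phi> (\<gamma>, t) = 0"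
    using test_fun_support[OF assms(1)] by metis
  obtain K where K: "K \<ge> 0" "\<And>z. \<bar>dt n \<phi> z\<bar> \<le> K"
    using test_fun_bounded[OF assms(1)] by metis
  have m: "(\<lambda>t. complex_of_real (dt n \<phi> (\<gamma>, t)) * cis (- (\<omega> * t))) \<in> borel_measurable lborel" for \<gamma> \<omega>
  proof -
    have "continuous_on UNIV (\<lambda>t. complex_of_real (dt n \<phi> (\<gamma>, t)) * cis (- (\<omega> * t)))"
      by (intro continuous_intros continuous_on_dt_slice[OF assms(1)])
    then show ?thesis
      by (simp add: borel_measurable_continuous_onI)
  qed
  show ?thesis
    unfolding fourier1_def
  proof (rule integral_dominated_convergence[where w = "\<lambda>t. K * indicator {-B..B} t"])
    show "AE t in lborel. (\<lambda>i. complex_of_real (dt n \<phi> (\<gamma>s i, t)) * cis (- (\<omega>s i * t))) \<longlonglongrightarrow> complex_of_real (dt n \<phi> (\<gamma>, t)) * cis (- (\<omega> * t))"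
    proof (intro AE_I2 tendsto_intros assms)
      fix t
      have "isCont (dt n \<phi>) (\<gamma>, t)"
        using smooth_fun_continuous_dt[of \<phi> n] assms(1) by (simp add: test_fun_def continuous_on_eq_continuous_at)
      then show "(\<lambda>i. dt n \<phi> (\<gamma>s i, t)) \<longlonglongrightarrow> dt n \<phi> (\<gamma>, t)"
        by (rule isCont_tendsto_compose) (intro tendsto_intros assms)
    qed
    show "AE t in lborel. norm (complex_of_real (dt n \<phi> (\<gamma>s i, t)) * cis (- (\<omega>s i * t))) \<le> K * indicator {- B..B} t" for i
      using B K by (intro AE_I2) (auto simp: norm_mult indicator_def)
    show "integrable lborel (\<lambda>t. K * indicator {-B..B} t)"
      by (intro integrable_mult_right integrable_real_indicator) (simp_all add: emeasure_lborel_Icc_eq)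
  qed (rule m)+
qed

lemma continuous_on_Fdt:
  assumes "test_fun \<phi>"
  shows "continuous_on UNIV (\<lambda>z. Fdt n \<phi> (fst z) (snd z))"
  unfolding continuous_on_sequentially o_def
proof (intro allI ballI impI)
  fix x :: "nat \<Rightarrow> 'a \<times> real" and z assume "(\<forall>i. x i \<in> UNIV) \<and> x \<longlonglongrightarrow> z"
  then have "x \<longlonglongrightarrow> z" by blast
  from Fdt_tendsto[OF assms tendsto_fst[OF this] tendsto_snd[OF this]]
  show "(\<lambda>i. Fdt n \<phi> (fst (x i)) (snd (x i))) \<longlonglongrightarrow> Fdt n \<phi> (fst z) (snd z)" .
qed

lemma borel_measurable_Fdt:
  assumes "test_fun \<phi>"
  shows "(\<lambda>z. Fdt n \<phi> (fst z) (snd z)) \<in> borel_measurable borel"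
  by (intro borel_measurable_continuous_onI continuous_on_Fdt assms)

section \<open>Polar coordinates\<close>

lemma sets_sphere_measure [measurable_cong, simp]: "sets sphere_measure = sets borel"
  by (simp add: sphere_measure_def)

lemma space_sphere_measure [simp]: "space sphere_measure = UNIV"
  by (simp add: sphere_measure_def space_scale_measure)

lemma nn_integral_sphere_measure:
  fixes f :: "'a::euclidean_space \<Rightarrow> ennreal"
  assumes [measurable]: "f \<in> borel_measurable borel"
  shows "(\<integral>\<^sup>+\<gamma>. f \<gamma> \<partial>sphere_measure) =
    of_nat DIM('a) * (\<integral>\<^sup>+x. f (x /\<^sub>R norm x) * indicator (ball 0 1 - {0}) x \<partial>lborel)"
proof -
  have [measurable]: "(\<lambda>x::'a. x /\<^sub>R norm x) \<in> restrict_space lborel (ball 0 1 - {0}) \<rightarrow>\<^sub>M borel"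
    by (intro measurable_restrict_space1) simp
  show ?thesis
    unfolding sphere_measure_def
    by (subst nn_integral_scale_measure, simp, subst nn_integral_distr)
       (simp_all add: nn_integral_restrict_space)
qed

lemma emeasure_sphere_measure_finite: "emeasure (sphere_measure :: 'a::euclidean_space measure) UNIV < \<infinity>"
proof -
  have "emeasure (sphere_measure :: 'a measure) UNIV = (\<integral>\<^sup>+\<gamma>. 1 \<partial>(sphere_measure :: 'a measure))"
    by simp
  also have "\<dots> = of_nat DIM('a) * emeasure lborel (ball (0::'a) 1 - {0})"
    by (subst nn_integral_sphere_measure) auto
  also have "\<dots> \<le> of_nat DIM('a) * emeasure lborel (ball (0::'a) 1)"
    by (intro mult_left_mono emeasure_mono) auto
  also have "\<dots> < \<infinity>"
    using emeasure_lborel_ball_finite[of "0::'a" 1] by (simp add: ennreal_mult_less_top of_nat_less_top)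
  finally show ?thesis .
qed

lemma finite_measure_sphere: "finite_measure (sphere_measure :: 'a::euclidean_space measure)"
  using emeasure_sphere_measure_finite by (intro finite_measureI) (simp add: less_top)

lemma AE_sphere_measure: "AE \<gamma> in (sphere_measure :: 'a::euclidean_space measure). norm \<gamma> = 1"
proof -
  have "(\<integral>\<^sup>+\<gamma>. indicator {\<gamma>::'a. norm \<gamma> \<noteq> 1} \<gamma> \<partial>sphere_measure) = 0"
    by (subst nn_integral_sphere_measure) (auto simp: nn_integral_0_iff_AE indicator_def)
  then show ?thesis
    by (auto intro!: AE_I[of _ _ "{\<gamma>. norm \<gamma> \<noteq> 1}"])
qed

lemma nn_integral_lborel_scale:
  fixes f :: "'a::euclidean_space \<Rightarrow> ennreal"
  assumes [measurable]: "f \<in> borel_measurable borel" and "c > 0"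
  shows "(\<integral>\<^sup>+x. f x \<partial>lborel) = ennreal (c ^ DIM('a)) * (\<integral>\<^sup>+x. f (c *\<^sub>R x) \<partial>lborel)"
  using \<open>c > 0\<close>
  by (subst lborel_affine[of c 0]) (auto simp: nn_integral_density nn_integral_distr nn_integral_cmult ennreal_power)

lemma nn_integral_inverse_power_tail:
  fixes r :: real assumes "r > 0" "d > 0"
  shows "(\<integral>\<^sup>+s. ennreal (inverse (s ^ Suc d)) * indicator {0<..} (s - r) \<partial>lborel) = ennreal (inverse (r ^ d) / d)"
proof -
  have "(\<integral>\<^sup>+s. ennreal (inverse (s ^ Suc d)) * indicator {0<..} (s - r) \<partial>lborel)
      = (\<integral>\<^sup>+s. ennreal (inverse (s ^ Suc d)) * indicator {r..} s \<partial>lborel)"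
    by (rule nn_integral_cong_AE, rule AE_mp[OF AE_lborel_singleton[of r]], rule AE_I2) (auto simp: indicator_def)
  also have "\<dots> = 0 - (- (inverse (r ^ d) / d))"
  proof (rule nn_integral_FTC_atLeast)
    fix s assume "r \<le> s"
    then have "s \<noteq> 0" using assms by auto
    obtain e where d: "d = Suc e" using assms by (cases d) auto
    show "((\<lambda>s. - (inverse (s ^ d) / real d)) has_real_derivative inverse (s ^ Suc d)) (at s)"
      unfolding power_inverse[symmetric]
      by (rule DERIV_cong[OF DERIV_minus[OF DERIV_cdivide[OF DERIV_power[OF DERIV_inverse[OF \<open>s \<noteq> 0\<close>]]]]])
         (use assms in \<open>simp add: d\<close>)
    show "0 \<le> inverse (s ^ Suc d)" using assms \<open>r \<le> s\<close> by simp
  next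
    have "((\<lambda>s::real. inverse (s ^ d)) \<longlongrightarrow> 0) at_top"
      by (intro tendsto_inverse_0_at_top filterlim_pow_at_top filterlim_ident) (use assms in auto)
    then have "((\<lambda>s. - (inverse (s ^ d) / real d)) \<longlongrightarrow> - (0 / real d)) at_top"
      by (intro tendsto_intros) (use assms in auto)
    then show "((\<lambda>s. - (inverse (s ^ d) / real d)) \<longlongrightarrow> 0) at_top" by simp
  qed simp
  finally show ?thesis by simp
qed

lemma nn_integral_polar:
  fixes f :: "'a::euclidean_space \<Rightarrow> ennreal"
  assumes [measurable]: "f \<in> borel_measurable borel"
  shows "(\<integral>\<^sup>+\<gamma>. \<integral>\<^sup>+r. ennreal (r ^ (DIM('a) - 1)) * indicator {0<..} r * f (r *\<^sub>R \<gamma>) \<partial>lborel \<partial>sphere_measure) = (\<integral>\<^sup>+x. f x \<partial>lborel)"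
proof -
  let ?d = "DIM('a)"
  let ?B = "ball (0::'a) 1 - {0}"
  have [measurable]: "?B \<in> sets borel" by simp
  obtain e where d: "?d = Suc e" using DIM_positive[where 'a='a] by (cases "DIM('a)") auto
  have "(\<integral>\<^sup>+\<gamma>. \<integral>\<^sup>+r. ennreal (r ^ (?d - 1)) * indicator {0<..} r * f (r *\<^sub>R \<gamma>) \<partial>lborel \<partial>sphere_measure)
    = of_nat ?d * (\<integral>\<^sup>+x. (\<integral>\<^sup>+r. ennreal (r ^ (?d - 1)) * indicator {0<..} r * f (r *\<^sub>R (x /\<^sub>R norm x)) \<partial>lborel) * indicator ?B x \<partial>lborel)"
    by (rule nn_integral_sphere_measure) measurable
  also have "(\<integral>\<^sup>+x. (\<integral>\<^sup>+r. ennreal (r ^ (?d - 1)) * indicator {0<..} r * f (r *\<^sub>R (x /\<^sub>R norm x)) \<partial>lborel) * indicator ?B x \<partial>lborel)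
    = (\<integral>\<^sup>+x. (\<integral>\<^sup>+s. indicator {0<..} s * ennreal (s ^ (?d - 1)) * (indicator ?B x * ennreal (norm x ^ ?d) * f (s *\<^sub>R x)) \<partial>lborel) \<partial>lborel)"
  proof (rule nn_integral_cong)
    fix x :: 'a
    show "(\<integral>\<^sup>+r. ennreal (r ^ (?d - 1)) * indicator {0<..} r * f (r *\<^sub>R (x /\<^sub>R norm x)) \<partial>lborel) * indicator ?B x
      = (\<integral>\<^sup>+s. indicator {0<..} s * ennreal (s ^ (?d - 1)) * (indicator ?B x * ennreal (norm x ^ ?d) * f (s *\<^sub>R x)) \<partial>lborel)"
    proof (cases "x \<in> ?B")
      case True
      then have x: "norm x > 0" by auto
      have "(\<integral>\<^sup>+r. ennreal (r ^ (?d - 1)) * indicator {0<..} r * f (r *\<^sub>R (x /\<^sub>R norm x)) \<partial>lborel)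
        = ennreal (norm x) * (\<integral>\<^sup>+s. ennreal ((norm x * s) ^ (?d - 1)) * indicator {0<..} (norm x * s) * f ((norm x * s) *\<^sub>R (x /\<^sub>R norm x)) \<partial>lborel)"
        using x by (subst nn_integral_real_affine[where c = "norm x" and t = 0]) auto
      also have "\<dots> = (\<integral>\<^sup>+s. ennreal (norm x) * (ennreal ((norm x * s) ^ (?d - 1)) * indicator {0<..} (norm x * s) * f ((norm x * s) *\<^sub>R (x /\<^sub>R norm x))) \<partial>lborel)"
        by (subst nn_integral_cmult) auto
      also have "\<dots> = (\<integral>\<^sup>+s. indicator {0<..} s * ennreal (s ^ (?d - 1)) * (indicator ?B x * ennreal (norm x ^ ?d) * f (s *\<^sub>R x)) \<partial>lborel)"
      proof (rule nn_integral_cong)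
        fix s :: real
        show "ennreal (norm x) * (ennreal ((norm x * s) ^ (?d - 1)) * indicator {0<..} (norm x * s) * f ((norm x * s) *\<^sub>R (x /\<^sub>R norm x)))
          = indicator {0<..} s * ennreal (s ^ (?d - 1)) * (indicator ?B x * ennreal (norm x ^ ?d) * f (s *\<^sub>R x))"
          using x True unfolding d
          by (cases "s > 0") (auto simp: indicator_def zero_less_mult_iff power_mult_distrib ennreal_mult' mult_ac)
      qed
      finally show ?thesis using True by simp
    qed simp
  qed
  also have "\<dots> = (\<integral>\<^sup>+s. (\<integral>\<^sup>+x. indicator {0<..} s * ennreal (s ^ (?d - 1)) * (indicator ?B x * ennreal (norm x ^ ?d) * f (s *\<^sub>R x)) \<partial>lborel) \<partial>lborel)"
    by (rule lborel_pair.Fubini') measurable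
  also have "\<dots> = (\<integral>\<^sup>+s. (\<integral>\<^sup>+y. ennreal (inverse (s ^ Suc ?d)) * indicator {0<..} (s - norm y) * (indicator (- {0}) y * ennreal (norm y ^ ?d) * f y) \<partial>lborel) \<partial>lborel)"
  proof (rule nn_integral_cong)
    fix s :: real
    show "(\<integral>\<^sup>+x. indicator {0<..} s * ennreal (s ^ (?d - 1)) * (indicator ?B x * ennreal (norm x ^ ?d) * f (s *\<^sub>R x)) \<partial>lborel)
      = (\<integral>\<^sup>+y. ennreal (inverse (s ^ Suc ?d)) * indicator {0<..} (s - norm y) * (indicator (- {0}) y * ennreal (norm y ^ ?d) * f y) \<partial>lborel)"
    proof (cases "s > 0")
      case True
      have "(\<integral>\<^sup>+y. ennreal (inverse (s ^ Suc ?d)) * indicator {0<..} (s - norm y) * (indicator (- {0}) y * ennreal (norm y ^ ?d) * f y) \<partial>lborel)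
        = ennreal (s ^ ?d) * (\<integral>\<^sup>+x. ennreal (inverse (s ^ Suc ?d)) * indicator {0<..} (s - norm (s *\<^sub>R x)) * (indicator (- {0}) (s *\<^sub>R x) * ennreal (norm (s *\<^sub>R x) ^ ?d) * f (s *\<^sub>R x)) \<partial>lborel)"
        by (rule nn_integral_lborel_scale[OF _ True]) measurable
      also have "\<dots> = (\<integral>\<^sup>+x. ennreal (s ^ ?d) * (ennreal (inverse (s ^ Suc ?d)) * indicator {0<..} (s - norm (s *\<^sub>R x)) * (indicator (- {0}) (s *\<^sub>R x) * ennreal (norm (s *\<^sub>R x) ^ ?d) * f (s *\<^sub>R x))) \<partial>lborel)"
        by (subst nn_integral_cmult) auto
      also have "\<dots> = (\<integral>\<^sup>+x. indicator {0<..} s * ennreal (s ^ (?d - 1)) * (indicator ?B x * ennreal (norm x ^ ?d) * f (s *\<^sub>R x)) \<partial>lborel)"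
      proof (rule nn_integral_cong)
        fix x :: 'a
        have e: "ennreal (s ^ ?d) * (ennreal (inverse (s ^ Suc ?d)) * ennreal (norm (s *\<^sub>R x) ^ ?d)) = ennreal (s ^ (?d - 1)) * ennreal (norm x ^ ?d)"
          using True unfolding d by (simp add: ennreal_mult'[symmetric] power_mult_distrib field_simps)
        show "ennreal (s ^ ?d) * (ennreal (inverse (s ^ Suc ?d)) * indicator {0<..} (s - norm (s *\<^sub>R x)) * (indicator (- {0}) (s *\<^sub>R x) * ennreal (norm (s *\<^sub>R x) ^ ?d) * f (s *\<^sub>R x)))
          = indicator {0<..} s * ennreal (s ^ (?d - 1)) * (indicator ?B x * ennreal (norm x ^ ?d) * f (s *\<^sub>R x))"
        proof (cases "x \<in> ?B")
          case B: True
          then have "s * norm x < s" using True by simp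
          with B have "ennreal (s ^ ?d) * (ennreal (inverse (s ^ Suc ?d)) * indicator {0<..} (s - norm (s *\<^sub>R x)) * (indicator (- {0}) (s *\<^sub>R x) * ennreal (norm (s *\<^sub>R x) ^ ?d) * f (s *\<^sub>R x)))
             = (ennreal (s ^ ?d) * (ennreal (inverse (s ^ Suc ?d)) * ennreal (norm (s *\<^sub>R x) ^ ?d))) * f (s *\<^sub>R x)"
            using True by (simp add: mult_ac)
          then show ?thesis unfolding e using True B by (simp add: mult_ac)
        qed (use True in \<open>auto simp: indicator_def\<close>)
      qed
      finally show ?thesis by simp
    next
      case False
      have "\<not> norm y < s" for y :: 'a using False norm_ge_zero[of y] by linarith
      then show ?thesis using False by simp
    qed
  qed
  also have "\<dots> = (\<integral>\<^sup>+y. (\<integral>\<^sup>+s. ennreal (inverse (s ^ Suc ?d)) * indicator {0<..} (s - norm y) * (indicator (- {0}) y * ennreal (norm y ^ ?d) * f y) \<partial>lborel) \<partial>lborel)"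
    by (rule lborel_pair.Fubini') measurable
  also have "\<dots> = (\<integral>\<^sup>+y. ennreal (1 / ?d) * f y \<partial>lborel)"
  proof (rule nn_integral_cong_AE, rule AE_mp[OF AE_lborel_singleton[of 0]], rule AE_I2, rule impI)
    fix y :: 'a assume y: "y \<noteq> 0"
    have "(\<integral>\<^sup>+s. ennreal (inverse (s ^ Suc ?d)) * indicator {0<..} (s - norm y) * (indicator (- {0}) y * ennreal (norm y ^ ?d) * f y) \<partial>lborel)
      = ennreal (inverse (norm y ^ ?d) / ?d) * (indicator (- {0}) y * ennreal (norm y ^ ?d) * f y)"
      using y by (subst nn_integral_multc, measurable, subst nn_integral_inverse_power_tail) auto
    also have "\<dots> = (ennreal (inverse (norm y ^ ?d) / ?d) * ennreal (norm y ^ ?d)) * f y"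
      using y by (simp add: mult_ac)
    also have "ennreal (inverse (norm y ^ ?d) / ?d) * ennreal (norm y ^ ?d) = ennreal (1 / ?d)"
      using y by (simp add: ennreal_mult'[symmetric])
    finally show "(\<integral>\<^sup>+s. ennreal (inverse (s ^ Suc ?d)) * indicator {0<..} (s - norm y) * (indicator (- {0}) y * ennreal (norm y ^ ?d) * f y) \<partial>lborel) = ennreal (1 / ?d) * f y" .
  qed
  also have "of_nat ?d * \<dots> = (ennreal (real ?d) * ennreal (1 / ?d)) * (\<integral>\<^sup>+y. f y \<partial>lborel)"
    by (subst nn_integral_cmult) (auto simp: mult.assoc ennreal_of_nat_eq_real_of_nat)
  also have "ennreal (real ?d) * ennreal (1 / ?d) = 1"
    by (subst ennreal_mult'[symmetric]) auto
  finally show ?thesis by simp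
qed

definition radial_measure :: "nat \<Rightarrow> real measure" where
  "radial_measure d = density lborel (\<lambda>r. ennreal (r ^ (d - 1) * indicator {0<..} r))"

lemma sets_radial_measure [measurable_cong, simp]: "sets (radial_measure d) = sets borel"
  by (simp add: radial_measure_def)

lemma sigma_finite_radial_measure: "sigma_finite_measure (radial_measure d)"
  unfolding radial_measure_def
  by (subst sigma_finite_measure.sigma_finite_iff_density_finite[OF sigma_finite_lborel]) auto

lemma lborel_eq_polar:
  "(lborel :: 'a::euclidean_space measure) =
     distr (sphere_measure \<Otimes>\<^sub>M radial_measure DIM('a)) borel (\<lambda>(\<gamma>, r). r *\<^sub>R \<gamma>)"
proof (rule measure_eqI)
  interpret R: sigma_finite_measure "radial_measure DIM('a)" by (rule sigma_finite_radial_measure)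
  fix A :: "'a set" assume "A \<in> sets lborel"
  then have [measurable]: "A \<in> sets borel" by simp
  have "emeasure (distr (sphere_measure \<Otimes>\<^sub>M radial_measure DIM('a)) borel (\<lambda>(\<gamma>::'a, r). r *\<^sub>R \<gamma>)) A
    = (\<integral>\<^sup>+x. indicator A x \<partial>distr (sphere_measure \<Otimes>\<^sub>M radial_measure DIM('a)) borel (\<lambda>(\<gamma>::'a, r). r *\<^sub>R \<gamma>))"
    by simp
  also have "\<dots> = (\<integral>\<^sup>+z. indicator A ((\<lambda>(\<gamma>, r). r *\<^sub>R \<gamma>) z) \<partial>(sphere_measure \<Otimes>\<^sub>M radial_measure DIM('a)))"
    by (subst nn_integral_distr) auto
  also have "\<dots> = (\<integral>\<^sup>+\<gamma>. \<integral>\<^sup>+r. indicator A (r *\<^sub>R \<gamma>) \<partial>radial_measure DIM('a) \<partial>sphere_measure)"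
    by (subst R.nn_integral_fst[symmetric]) auto
  also have "\<dots> = (\<integral>\<^sup>+\<gamma>. \<integral>\<^sup>+r. ennreal (r ^ (DIM('a) - 1)) * indicator {0<..} r * indicator A (r *\<^sub>R \<gamma>) \<partial>lborel \<partial>sphere_measure)"
    unfolding radial_measure_def
    by (rule nn_integral_cong, subst nn_integral_density) (auto intro!: nn_integral_cong split: split_indicator)
  also have "\<dots> = emeasure lborel A"
    by (subst nn_integral_polar) auto
  finally show "emeasure lborel A = emeasure (distr (sphere_measure \<Otimes>\<^sub>M radial_measure DIM('a)) borel (\<lambda>(\<gamma>, r). r *\<^sub>R \<gamma>)) A" ..
qed simp

section \<open>Filtered backprojection\<close>

lemma integrable_inverse_1_plus_square_lborel: "integrable lborel (\<lambda>x::real. 1 / (1 + x\<^sup>2))"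
  using integrable_inverse_1_plus_square
  by (simp add: set_integrable_def inverse_eq_divide)

lemma integrable_times_bounded_kernel:
  fixes f :: "'a::euclidean_space \<Rightarrow> 'c::{real_normed_field, banach, second_countable_topology}"
    and h :: "'b::euclidean_space \<Rightarrow> 'c" and k :: "'a \<Rightarrow> 'b \<Rightarrow> 'c"
  assumes f: "integrable lborel f" and h: "integrable lborel h"
    and k: "(\<lambda>z. k (fst z) (snd z)) \<in> borel_measurable (lborel \<Otimes>\<^sub>M lborel)" "\<And>x y. norm (k x y) \<le> 1"
  shows "integrable (lborel \<Otimes>\<^sub>M lborel) (\<lambda>(x, y). f x * (h y * k x y))"
proof (rule Bochner_Integration.integrable_bound)
  have [measurable]: "f \<in> borel_measurable borel" "h \<in> borel_measurable borel"
    using f h by auto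
  note [measurable] = k(1)
  show "integrable (lborel \<Otimes>\<^sub>M lborel) (\<lambda>(x, y). f x * h y)"
  proof (rule lborel_pair.Fubini_integrable)
    show "integrable lborel (\<lambda>x. \<integral>y. norm (case (x, y) of (x, y) \<Rightarrow> f x * h y) \<partial>lborel)"
      using f by (simp add: norm_mult)
    show "AE x in lborel. integrable lborel (\<lambda>y. case (x, y) of (x, y) \<Rightarrow> f x * h y)"
      using h by simp
  qed measurable
  show "(\<lambda>(x, y). f x * (h y * k x y)) \<in> borel_measurable (lborel \<Otimes>\<^sub>M lborel)"
    unfolding case_prod_beta by measurable
  show "AE z in lborel \<Otimes>\<^sub>M lborel. norm (case z of (x, y) \<Rightarrow> f x * (h y * k x y)) \<le> norm (case z of (x, y) \<Rightarrow> f x * h y)"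
    using k(2) by (intro AE_I2) (auto simp: norm_mult mult_left_le mult_left_mono split: prod.splits)
qed

lemma Fubini_bounded_kernel:
  fixes f :: "'a::euclidean_space \<Rightarrow> 'c::{real_normed_field, banach, second_countable_topology}"
    and h :: "'b::euclidean_space \<Rightarrow> 'c" and k :: "'a \<Rightarrow> 'b \<Rightarrow> 'c"
  assumes "integrable lborel f" "integrable lborel h"
    "(\<lambda>z. k (fst z) (snd z)) \<in> borel_measurable (lborel \<Otimes>\<^sub>M lborel)" "\<And>x y. norm (k x y) \<le> 1"
  shows "(\<integral>x. f x * (\<integral>y. h y * k x y \<partial>lborel) \<partial>lborel) = (\<integral>y. h y * (\<integral>x. f x * k x y \<partial>lborel) \<partial>lborel)"
proof -
  have "(\<integral>x. f x * (\<integral>y. h y * k x y \<partial>lborel) \<partial>lborel) = (\<integral>x. (\<integral>y. f x * (h y * k x y) \<partial>lborel) \<partial>lborel)"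
    by simp
  also have "\<dots> = (\<integral>y. (\<integral>x. f x * (h y * k x y) \<partial>lborel) \<partial>lborel)"
    by (rule lborel_pair.Fubini_integral[symmetric, OF integrable_times_bounded_kernel[OF assms]])
  also have "\<dots> = (\<integral>y. (\<integral>x. h y * (f x * k x y) \<partial>lborel) \<partial>lborel)"
    by (simp add: mult_ac)
  finally show ?thesis by simp
qed

lemma
  fixes g :: "real \<Rightarrow> complex"
  assumes g: "integrable lborel g" and h: "\<And>\<omega>. g (- \<omega>) = cnj (g \<omega>)"
  shows Re_integral_hermitian_pos: "2 * Re (\<integral>\<omega>. indicator {0<..} \<omega> *\<^sub>R g \<omega> \<partial>lborel) = Re (\<integral>\<omega>. g \<omega> \<partial>lborel)"
    and Re_integral_hermitian_neg: "2 * Re (\<integral>\<omega>. indicator {..<0} \<omega> *\<^sub>R g \<omega> \<partial>lborel) = Re (\<integral>\<omega>. g \<omega> \<partial>lborel)"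
proof -
  let ?p = "\<lambda>\<omega>. indicator {0<..} \<omega> *\<^sub>R g \<omega>" and ?n = "\<lambda>\<omega>. indicator {..<0} \<omega> *\<^sub>R g \<omega>"
  have [measurable]: "g \<in> borel_measurable borel" using g by auto
  have i: "integrable lborel ?p" "integrable lborel ?n"
    by (auto intro!: integrable_mult_indicator g)
  have "(\<integral>\<omega>. ?n \<omega> \<partial>lborel) = (\<integral>\<omega>. ?n (- \<omega>) \<partial>lborel)"
    by (subst lborel_integral_real_affine[where c = "-1" and t = 0]) auto
  also have "\<dots> = (\<integral>\<omega>. cnj (?p \<omega>) \<partial>lborel)"
    by (intro Bochner_Integration.integral_cong) (auto simp: h indicator_def)
  also have "\<dots> = cnj (\<integral>\<omega>. ?p \<omega> \<partial>lborel)"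
    by (rule Bochner_Integration.integral_cnj)
  finally have n: "(\<integral>\<omega>. ?n \<omega> \<partial>lborel) = cnj (\<integral>\<omega>. ?p \<omega> \<partial>lborel)" .
  have "(\<integral>\<omega>. g \<omega> \<partial>lborel) = (\<integral>\<omega>. ?p \<omega> + ?n \<omega> \<partial>lborel)"
    by (rule integral_cong_AE, simp, simp, rule AE_mp[OF AE_lborel_singleton[of 0]], rule AE_I2)
       (auto simp: indicator_def)
  also have "\<dots> = (\<integral>\<omega>. ?p \<omega> \<partial>lborel) + (\<integral>\<omega>. ?n \<omega> \<partial>lborel)"
    using i by (rule Bochner_Integration.integral_add)
  finally show "2 * Re (\<integral>\<omega>. ?p \<omega> \<partial>lborel) = Re (\<integral>\<omega>. g \<omega> \<partial>lborel)"
    "2 * Re (\<integral>\<omega>. ?n \<omega> \<partial>lborel) = Re (\<integral>\<omega>. g \<omega> \<partial>lborel)"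
    unfolding n by auto
qed

definition polar_symbol :: "('a::euclidean_space \<times> real \<Rightarrow> real) \<Rightarrow> 'a \<Rightarrow> complex" where
  "polar_symbol \<phi> \<xi> = Fdt 2 \<phi> (\<xi> /\<^sub>R norm \<xi>) (norm \<xi>)"

lemma polar_symbol_scaleR: "norm \<gamma> = 1 \<Longrightarrow> r > 0 \<Longrightarrow> polar_symbol \<phi> (r *\<^sub>R \<gamma>) = Fdt 2 \<phi> \<gamma> r"
  by (simp add: polar_symbol_def)

lemma borel_measurable_polar_symbol:
  assumes "test_fun \<phi>"
  shows "polar_symbol \<phi> \<in> borel_measurable borel"
proof -
  have "(\<lambda>\<xi>::'a. (\<xi> /\<^sub>R norm \<xi>, norm \<xi>)) \<in> borel \<rightarrow>\<^sub>M borel"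
    by (subst borel_prod[symmetric]) measurable
  from measurable_compose[OF this borel_measurable_Fdt[OF assms, of 2]]
  show ?thesis by (simp add: polar_symbol_def[abs_def])
qed

lemma polar_symbol_tendsto:
  assumes "test_fun \<phi>" "\<xi>s \<longlonglongrightarrow> \<xi>" "\<xi> \<noteq> 0"
  shows "(\<lambda>i. polar_symbol \<phi> (\<xi>s i)) \<longlonglongrightarrow> polar_symbol \<phi> \<xi>"
  unfolding polar_symbol_def by (intro Fdt_tendsto assms tendsto_intros) (use assms in auto)

lemma integrable_polar_symbol:
  fixes \<phi> :: "'a::euclidean_space \<times> real \<Rightarrow> real"
  assumes "test_fun \<phi>"
  shows "integrable lborel (polar_symbol \<phi>)"
proof (rule integrableI_bounded)
  note [measurable] = borel_measurable_polar_symbol[OF assms]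
  show "polar_symbol \<phi> \<in> borel_measurable lborel" by simp
  obtain K where K: "K \<ge> 0" "\<And>\<gamma> \<omega>. \<bar>\<omega>\<bar> ^ (DIM('a) - 1) * norm (Fdt 2 \<phi> \<gamma> \<omega>) \<le> K / (1 + \<omega>\<^sup>2)"
    using Fdt_decay[OF assms] by metis
  have iK: "integrable lborel (\<lambda>r. K / (1 + r\<^sup>2))"
    using integrable_mult_right[OF integrable_inverse_1_plus_square_lborel, of K] by simp
  have "(\<integral>\<^sup>+\<xi>. norm (polar_symbol \<phi> \<xi>) \<partial>lborel) =
    (\<integral>\<^sup>+\<gamma>. \<integral>\<^sup>+r. ennreal (r ^ (DIM('a) - 1)) * indicator {0<..} r * norm (polar_symbol \<phi> (r *\<^sub>R \<gamma>)) \<partial>lborel \<partial>sphere_measure)"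
    by (rule nn_integral_polar[symmetric]) measurable
  also have "\<dots> \<le> (\<integral>\<^sup>+\<gamma>. \<integral>\<^sup>+r. ennreal (K / (1 + r\<^sup>2)) \<partial>lborel \<partial>(sphere_measure :: 'a measure))"
  proof (rule nn_integral_mono_AE, rule AE_mp[OF AE_sphere_measure], rule AE_I2, rule impI, rule nn_integral_mono)
    fix \<gamma> :: 'a and r :: real assume g: "norm \<gamma> = 1"
    show "ennreal (r ^ (DIM('a) - 1)) * indicator {0<..} r * norm (polar_symbol \<phi> (r *\<^sub>R \<gamma>)) \<le> ennreal (K / (1 + r\<^sup>2))"
      using K(2)[of r \<gamma>]
      by (cases "r > 0") (auto simp: polar_symbol_scaleR g ennreal_mult'[symmetric] intro!: ennreal_leI)
  qed
  also have "\<dots> = ennreal (\<integral>r. K / (1 + r\<^sup>2) \<partial>lborel) * emeasure (sphere_measure :: 'a measure) UNIV"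
    using K(1) by (subst nn_integral_eq_integral[OF iK]) auto
  also have "\<dots> < \<infinity>"
    using emeasure_sphere_measure_finite[where 'a='a] by (simp add: ennreal_mult_less_top)
  finally show "(\<integral>\<^sup>+\<xi>. norm (polar_symbol \<phi> \<xi>) \<partial>lborel) < \<infinity>" .
qed

lemma integrable_mult_cis:
  fixes f :: "'a::euclidean_space \<Rightarrow> complex"
  assumes "integrable lborel f" and [measurable]: "g \<in> borel_measurable borel"
  shows "integrable lborel (\<lambda>x. f x * cis (g x))"
proof -
  have [measurable]: "f \<in> borel_measurable borel" using assms by auto
  show ?thesis
    by (rule Bochner_Integration.integrable_bound[OF assms(1)]) (auto simp: norm_mult)
qed

lemma backproj_ramp_filter:
  fixes \<phi> :: "'a::euclidean_space \<times> real \<Rightarrow> real"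
  assumes "test_fun \<phi>"
  shows "backproj (ramp_filter \<phi>) x = Re (\<integral>\<xi>. polar_symbol \<phi> \<xi> * cis (\<xi> \<bullet> x) \<partial>lborel) / pi"
proof -
  interpret S: finite_measure "sphere_measure :: 'a measure" by (rule finite_measure_sphere)
  interpret R: sigma_finite_measure "radial_measure DIM('a)" by (rule sigma_finite_radial_measure)
  interpret pair_sigma_finite "sphere_measure :: 'a measure" "radial_measure DIM('a)" ..
  note [measurable] = borel_measurable_polar_symbol[OF assms]
  let ?P = "sphere_measure \<Otimes>\<^sub>M radial_measure DIM('a) :: ('a \<times> real) measure"
  let ?h = "\<lambda>\<xi>. polar_symbol \<phi> \<xi> * cis (\<xi> \<bullet> x)"
  let ?I = "\<lambda>\<gamma>. \<integral>r. ?h (r *\<^sub>R \<gamma>) \<partial>radial_measure DIM('a)"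
  have int: "integrable lborel ?h"
    by (intro integrable_mult_cis integrable_polar_symbol assms) simp
  have [measurable]: "(\<lambda>(\<gamma>::'a, r). r *\<^sub>R \<gamma>) \<in> ?P \<rightarrow>\<^sub>M borel" by measurable
  from int have "integrable (distr ?P borel (\<lambda>(\<gamma>, r). r *\<^sub>R \<gamma>)) ?h"
    by (subst lborel_eq_polar[symmetric])
  then have "integrable ?P (\<lambda>z. ?h ((\<lambda>(\<gamma>, r). r *\<^sub>R \<gamma>) z))"
    by (subst (asm) integrable_distr_eq) auto
  then have intP: "integrable ?P (\<lambda>(\<gamma>, r). ?h (r *\<^sub>R \<gamma>))"
    by (simp add: case_prod_beta')
  have "(\<integral>\<xi>. ?h \<xi> \<partial>lborel) = (\<integral>z. ?h ((\<lambda>(\<gamma>, r). r *\<^sub>R \<gamma>) z) \<partial>?P)"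
    by (subst lborel_eq_polar, subst integral_distr) auto
  also have "\<dots> = (\<integral>\<gamma>. ?I \<gamma> \<partial>sphere_measure)"
    using integral_fst[OF intP] by (simp add: case_prod_beta')
  finally have eq: "(\<integral>\<xi>. ?h \<xi> \<partial>lborel) = (\<integral>\<gamma>. ?I \<gamma> \<partial>sphere_measure)" .
  have intI: "integrable sphere_measure ?I"
    using integrable_fst[OF intP] .
  obtain K where K: "K \<ge> 0" "\<And>\<gamma> \<omega>. \<bar>\<omega>\<bar> ^ (DIM('a) - 1) * norm (Fdt 2 \<phi> \<gamma> \<omega>) \<le> K / (1 + \<omega>\<^sup>2)"
    using Fdt_decay[OF assms] by metis
  have iK: "integrable lborel (\<lambda>r. K / (1 + r\<^sup>2))"
    using integrable_mult_right[OF integrable_inverse_1_plus_square_lborel, of K] by simp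
  have "ramp_filter \<phi> (\<gamma>, \<gamma> \<bullet> x) = Re (?I \<gamma>) / pi" if g: "norm \<gamma> = 1" for \<gamma> :: 'a
  proof -
    let ?g = "\<lambda>\<omega>. complex_of_real (\<bar>\<omega>\<bar> ^ (DIM('a) - 1)) * Fdt 2 \<phi> \<gamma> \<omega> * cis (\<omega> * (\<gamma> \<bullet> x))"
    have "continuous_on UNIV (\<lambda>\<omega>. Fdt 2 \<phi> \<gamma> \<omega>)"
      by (rule continuous_on_compose2[OF continuous_on_Fdt[OF assms, of 2], of UNIV "\<lambda>\<omega>. (\<gamma>, \<omega>)", simplified])
         (intro continuous_intros)
    then have [measurable]: "(\<lambda>\<omega>. Fdt 2 \<phi> \<gamma> \<omega>) \<in> borel_measurable borel"
      by (rule borel_measurable_continuous_onI)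
    have ig: "integrable lborel ?g"
      by (rule Bochner_Integration.integrable_bound[OF iK])
         (use K in \<open>auto simp: norm_mult norm_power intro: order_trans[OF _ abs_ge_self]\<close>)
    have "?I \<gamma> = (\<integral>r. (r ^ (DIM('a) - 1) * indicator {0<..} r) *\<^sub>R ?h (r *\<^sub>R \<gamma>) \<partial>lborel)"
      unfolding radial_measure_def by (rule integral_density) (auto split: split_indicator)
    also have "\<dots> = (\<integral>r. indicator {0<..} r *\<^sub>R ?g r \<partial>lborel)"
      by (intro Bochner_Integration.integral_cong)
         (auto simp: polar_symbol_scaleR g scaleR_conv_of_real split: split_indicator)
    finally have "2 * Re (?I \<gamma>) = Re (\<integral>\<omega>. ?g \<omega> \<partial>lborel)"
      using Re_integral_hermitian_pos[OF ig] by (simp add: Fdt_uminus cis_cnj)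
    moreover have "ramp_filter \<phi> (\<gamma>, \<gamma> \<bullet> x) = Re (\<integral>\<omega>. ?g \<omega> \<partial>lborel) / (2 * pi)"
      unfolding ramp_filter_def riesz_def dtt_eq_dt
      by simp
    ultimately show ?thesis by (simp add: field_simps)
  qed
  note ramp = this
  have "backproj (ramp_filter \<phi>) x = (\<integral>\<gamma>. Re (?I \<gamma>) / pi \<partial>sphere_measure)"
    unfolding backproj_def
  proof (rule integral_cong_AE)
    have F [measurable]: "(\<lambda>z. Fdt 2 \<phi> (fst z) (snd z)) \<in> borel_measurable (borel \<Otimes>\<^sub>M borel)"
      using borel_measurable_Fdt[OF assms] by (simp add: borel_prod)
    have "(\<lambda>\<gamma>. \<integral>\<omega>. complex_of_real (\<bar>\<omega>\<bar> ^ (DIM('a) - 1)) * Fdt 2 \<phi> \<gamma> \<omega> * cis (\<omega> * (\<gamma> \<bullet> x)) \<partial>lborel) \<in> borel_measurable borel"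
    proof (rule lborel.borel_measurable_lebesgue_integral)
      show "(\<lambda>(\<gamma>, \<omega>). complex_of_real (\<bar>\<omega>\<bar> ^ (DIM('a) - 1)) * Fdt 2 \<phi> \<gamma> \<omega> * cis (\<omega> * (\<gamma> \<bullet> x))) \<in> borel_measurable (borel \<Otimes>\<^sub>M lborel)"
        unfolding case_prod_beta by measurable
    qed
    then show "(\<lambda>\<gamma>. ramp_filter \<phi> (\<gamma>, \<gamma> \<bullet> x)) \<in> borel_measurable sphere_measure"
      unfolding ramp_filter_def riesz_def dtt_eq_dt by simp
    show "(\<lambda>\<gamma>. Re (?I \<gamma>) / pi) \<in> borel_measurable sphere_measure"
      using borel_measurable_integrable[OF intI] by measurable
    show "AE \<gamma> in sphere_measure. ramp_filter \<phi> (\<gamma>, \<gamma> \<bullet> x) = Re (?I \<gamma>) / pi"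
      using AE_sphere_measure by eventually_elim (rule ramp)
  qed
  also have "\<dots> = Re (\<integral>\<gamma>. ?I \<gamma> \<partial>sphere_measure) / pi"
    using intI by simp
  finally show ?thesis unfolding eq .
qed

section \<open>Gaussian ridge functions\<close>

lemma fourier_scaled_exp_norm_square:
  fixes \<zeta> :: "'a::euclidean_space"
  assumes "\<epsilon> > 0"
  shows "integrable lborel (\<lambda>x::'a. exp (- (norm (\<epsilon> *\<^sub>R x))\<^sup>2 / 2))"
    and "(\<integral>x. complex_of_real (exp (- (norm (\<epsilon> *\<^sub>R x))\<^sup>2 / 2)) * cis (\<zeta> \<bullet> x) \<partial>lborel)
      = of_real (sqrt (2 * pi) ^ DIM('a) / \<epsilon> ^ DIM('a)) * of_real (exp (- (norm (\<zeta> /\<^sub>R \<epsilon>))\<^sup>2 / 2))"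
proof -
  show "integrable lborel (\<lambda>x::'a. exp (- (norm (\<epsilon> *\<^sub>R x))\<^sup>2 / 2))"
    using integrable_lborel_affine[OF integrable_exp_norm_square, of \<epsilon> 0] assms by simp
  have "(\<integral>x. complex_of_real (exp (- (norm x)\<^sup>2 / 2)) * cis ((\<zeta> /\<^sub>R \<epsilon>) \<bullet> x) \<partial>lborel)
    = \<epsilon> ^ DIM('a) *\<^sub>R (\<integral>x. complex_of_real (exp (- (norm (\<epsilon> *\<^sub>R x))\<^sup>2 / 2)) * cis (\<zeta> \<bullet> x) \<partial>lborel)"
    using assms by (subst lborel_integral_affine[of _ \<epsilon> 0]) (auto simp: mult.assoc[symmetric])
  then show "(\<integral>x. complex_of_real (exp (- (norm (\<epsilon> *\<^sub>R x))\<^sup>2 / 2)) * cis (\<zeta> \<bullet> x) \<partial>lborel)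
      = of_real (sqrt (2 * pi) ^ DIM('a) / \<epsilon> ^ DIM('a)) * of_real (exp (- (norm (\<zeta> /\<^sub>R \<epsilon>))\<^sup>2 / 2))"
    unfolding fourier_exp_norm_square using assms
    by (simp add: scaleR_conv_of_real field_simps)
qed

lemma damped_ridge_pairing:
  fixes H :: "'a::euclidean_space \<Rightarrow> complex"
  assumes "\<epsilon> > 0" and H: "integrable lborel H"
  shows "(\<integral>x. complex_of_real (exp (- (\<eta> \<bullet> x - b)\<^sup>2 / 2) * exp (- (norm (\<epsilon> *\<^sub>R x))\<^sup>2 / 2)) * (\<integral>\<xi>. H \<xi> * cis (\<xi> \<bullet> x) \<partial>lborel) \<partial>lborel)
    = of_real (sqrt (2 * pi) ^ DIM('a) / sqrt (2 * pi)) *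
      (\<integral>\<omega>. complex_of_real (exp (- \<omega>\<^sup>2 / 2)) * cis (- (\<omega> * b)) *
         (\<integral>z. complex_of_real (exp (- (norm z)\<^sup>2 / 2)) * H (- (\<omega> *\<^sub>R \<eta>) + \<epsilon> *\<^sub>R z) \<partial>lborel) \<partial>lborel)"
    (is "?L = ?R")
proof -
  let ?e = "\<lambda>x::'a. exp (- (norm (\<epsilon> *\<^sub>R x))\<^sup>2 / 2)"
  let ?g = "\<lambda>x::'a. exp (- (\<eta> \<bullet> x - b)\<^sup>2 / 2)"
  let ?G = "\<lambda>\<omega>. complex_of_real (exp (- \<omega>\<^sup>2 / 2)) * cis (- (\<omega> * b))"
  let ?c = "sqrt (2 * pi) ^ DIM('a) / \<epsilon> ^ DIM('a)"
  let ?k = "\<lambda>\<omega> \<xi>. complex_of_real (exp (- (norm ((\<omega> *\<^sub>R \<eta> + \<xi>) /\<^sub>R \<epsilon>))\<^sup>2 / 2))"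
  have [measurable]: "H \<in> borel_measurable borel" using H by auto
  note ie = fourier_scaled_exp_norm_square(1)[OF \<open>\<epsilon> > 0\<close>, where 'a='a]
  have ie': "integrable lborel (\<lambda>x. complex_of_real (?e x))" using ie by simp
  have ige: "integrable lborel (\<lambda>x. complex_of_real (?g x * ?e x))"
    by (rule Bochner_Integration.integrable_bound[OF ie]) (auto simp: norm_mult intro!: AE_I2 mult_left_le_one_le)
  have iG: "integrable lborel ?G"
    by (rule Bochner_Integration.integrable_bound[OF integrable_exp_square]) (auto simp: norm_mult)
  have ft: "(\<integral>x. complex_of_real (?g x * ?e x) * cis (\<xi> \<bullet> x) \<partial>lborel)
    = of_real (?c / sqrt (2 * pi)) * (\<integral>\<omega>. ?G \<omega> * ?k \<omega> \<xi> \<partial>lborel)" for \<xi>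
  proof -
    have g: "complex_of_real (?g x) = of_real (1 / sqrt (2 * pi)) * (\<integral>\<omega>. ?G \<omega> * cis (\<omega> * (\<eta> \<bullet> x)) \<partial>lborel)" for x
    proof -
      have "(\<integral>\<omega>. ?G \<omega> * cis (\<omega> * (\<eta> \<bullet> x)) \<partial>lborel) = (\<integral>\<omega>. of_real (exp (- \<omega>\<^sup>2 / 2)) * cis ((\<eta> \<bullet> x - b) * \<omega>) \<partial>lborel)"
        unfolding mult.assoc[where 'a=complex] cis_mult by (simp add: algebra_simps)
      also have "\<dots> = complex_of_real (sqrt (2 * pi) * ?g x)" by (rule fourier_exp_square)
      finally show ?thesis by simp
    qed
    have "(\<integral>x. complex_of_real (?g x * ?e x) * cis (\<xi> \<bullet> x) \<partial>lborel)
      = (\<integral>x. of_real (1 / sqrt (2 * pi)) * ((complex_of_real (?e x) * cis (\<xi> \<bullet> x)) * (\<integral>\<omega>. ?G \<omega> * cis (\<omega> * (\<eta> \<bullet> x)) \<partial>lborel)) \<partial>lborel)"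
      unfolding of_real_mult g by (simp only: mult_ac)
    also have "\<dots> = of_real (1 / sqrt (2 * pi)) * (\<integral>x. (complex_of_real (?e x) * cis (\<xi> \<bullet> x)) * (\<integral>\<omega>. ?G \<omega> * cis (\<omega> * (\<eta> \<bullet> x)) \<partial>lborel) \<partial>lborel)"
      by (rule integral_mult_right_zero)
    also have "(\<integral>x. (complex_of_real (?e x) * cis (\<xi> \<bullet> x)) * (\<integral>\<omega>. ?G \<omega> * cis (\<omega> * (\<eta> \<bullet> x)) \<partial>lborel) \<partial>lborel)
      = (\<integral>\<omega>. ?G \<omega> * (\<integral>x. (complex_of_real (?e x) * cis (\<xi> \<bullet> x)) * cis (\<omega> * (\<eta> \<bullet> x)) \<partial>lborel) \<partial>lborel)"
      by (rule Fubini_bounded_kernel[OF integrable_mult_cis[OF ie'] iG]) simp_all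
    also have "\<dots> = (\<integral>\<omega>. ?G \<omega> * (\<integral>x. complex_of_real (?e x) * cis ((\<omega> *\<^sub>R \<eta> + \<xi>) \<bullet> x) \<partial>lborel) \<partial>lborel)"
      by (simp add: mult.assoc cis_mult inner_add_left add.commute)
    also have "\<dots> = (\<integral>\<omega>. of_real ?c * (?G \<omega> * ?k \<omega> \<xi>) \<partial>lborel)"
      unfolding fourier_scaled_exp_norm_square(2)[OF \<open>\<epsilon> > 0\<close>] by (simp only: mult_ac)
    also have "\<dots> = of_real ?c * (\<integral>\<omega>. ?G \<omega> * ?k \<omega> \<xi> \<partial>lborel)"
      by (rule integral_mult_right_zero)
    finally show ?thesis by (simp add: mult_ac)
  qed
  have "?L = (\<integral>\<xi>. H \<xi> * (\<integral>x. complex_of_real (?g x * ?e x) * cis (\<xi> \<bullet> x) \<partial>lborel) \<partial>lborel)"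
    by (rule Fubini_bounded_kernel[OF ige H]) simp_all
  also have "\<dots> = (\<integral>\<xi>. of_real (?c / sqrt (2 * pi)) * (H \<xi> * (\<integral>\<omega>. ?G \<omega> * ?k \<omega> \<xi> \<partial>lborel)) \<partial>lborel)"
    unfolding ft by (simp only: mult_ac)
  also have "\<dots> = of_real (?c / sqrt (2 * pi)) * (\<integral>\<xi>. H \<xi> * (\<integral>\<omega>. ?G \<omega> * ?k \<omega> \<xi> \<partial>lborel) \<partial>lborel)"
    by (rule integral_mult_right_zero)
  also have "(\<integral>\<xi>. H \<xi> * (\<integral>\<omega>. ?G \<omega> * ?k \<omega> \<xi> \<partial>lborel) \<partial>lborel) = (\<integral>\<omega>. ?G \<omega> * (\<integral>\<xi>. H \<xi> * ?k \<omega> \<xi> \<partial>lborel) \<partial>lborel)"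
    by (rule Fubini_bounded_kernel[OF H iG]) simp_all
  also have "\<dots> = (\<integral>\<omega>. of_real (\<epsilon> ^ DIM('a)) * (?G \<omega> * (\<integral>z. complex_of_real (exp (- (norm z)\<^sup>2 / 2)) * H (- (\<omega> *\<^sub>R \<eta>) + \<epsilon> *\<^sub>R z) \<partial>lborel)) \<partial>lborel)"
  proof (rule Bochner_Integration.integral_cong[OF refl])
    fix \<omega>
    have "(\<integral>\<xi>. H \<xi> * ?k \<omega> \<xi> \<partial>lborel) = \<epsilon> ^ DIM('a) *\<^sub>R (\<integral>z. H (- (\<omega> *\<^sub>R \<eta>) + \<epsilon> *\<^sub>R z) * complex_of_real (exp (- (norm z)\<^sup>2 / 2)) \<partial>lborel)"
      using \<open>\<epsilon> > 0\<close> by (subst lborel_integral_affine[of _ \<epsilon> "- (\<omega> *\<^sub>R \<eta>)"]) auto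
    then show "?G \<omega> * (\<integral>\<xi>. H \<xi> * ?k \<omega> \<xi> \<partial>lborel) = of_real (\<epsilon> ^ DIM('a)) * (?G \<omega> * (\<integral>z. complex_of_real (exp (- (norm z)\<^sup>2 / 2)) * H (- (\<omega> *\<^sub>R \<eta>) + \<epsilon> *\<^sub>R z) \<partial>lborel))"
      by (simp add: scaleR_conv_of_real mult_ac)
  qed
  also have "\<dots> = of_real (\<epsilon> ^ DIM('a)) * (\<integral>\<omega>. (?G \<omega> * (\<integral>z. complex_of_real (exp (- (norm z)\<^sup>2 / 2)) * H (- (\<omega> *\<^sub>R \<eta>) + \<epsilon> *\<^sub>R z) \<partial>lborel)) \<partial>lborel)"
    by (rule integral_mult_right_zero)
  finally show ?thesis
    using \<open>\<epsilon> > 0\<close> by (simp add: field_simps)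
qed

lemma damped_ridge_pairing_limit:
  fixes H :: "'a::euclidean_space \<Rightarrow> complex" and \<epsilon> :: "nat \<Rightarrow> real"
  assumes [measurable]: "H \<in> borel_measurable borel" and K: "\<And>\<xi>. norm (H \<xi>) \<le> K"
    and lim: "\<And>\<xi> \<xi>s. \<xi> \<noteq> 0 \<Longrightarrow> \<xi>s \<longlonglongrightarrow> \<xi> \<Longrightarrow> (\<lambda>i. H (\<xi>s i)) \<longlonglongrightarrow> H \<xi>"
    and "\<eta> \<noteq> 0" and \<epsilon>: "\<epsilon> \<longlonglongrightarrow> 0"
  shows "(\<lambda>i. \<integral>\<omega>. complex_of_real (exp (- \<omega>\<^sup>2 / 2)) * cis (- (\<omega> * b)) *
         (\<integral>z. complex_of_real (exp (- (norm z)\<^sup>2 / 2)) * H (- (\<omega> *\<^sub>R \<eta>) + \<epsilon> i *\<^sub>R z) \<partial>lborel) \<partial>lborel)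
    \<longlonglongrightarrow> (\<integral>\<omega>. complex_of_real (exp (- \<omega>\<^sup>2 / 2)) * cis (- (\<omega> * b)) *
         (of_real (sqrt (2 * pi) ^ DIM('a)) * H (- (\<omega> *\<^sub>R \<eta>))) \<partial>lborel)"
proof -
  let ?e = "\<lambda>z::'a. exp (- (norm z)\<^sup>2 / 2)"
  let ?J = "\<lambda>i \<omega>. \<integral>z. complex_of_real (?e z) * H (- (\<omega> *\<^sub>R \<eta>) + \<epsilon> i *\<^sub>R z) \<partial>lborel"
  have "K \<ge> 0" using order_trans[OF norm_ge_zero K] .
  have iKe: "integrable lborel (\<lambda>z::'a. K * ?e z)"
    by (intro integrable_mult_right integrable_exp_norm_square)
  have J: "norm (?J i \<omega>) \<le> K * sqrt (2 * pi) ^ DIM('a)" for i \<omega>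
  proof -
    have "norm (?J i \<omega>) \<le> (\<integral>z. norm (complex_of_real (?e z) * H (- (\<omega> *\<^sub>R \<eta>) + \<epsilon> i *\<^sub>R z)) \<partial>lborel)"
      by (rule integral_norm_bound)
    also have "\<dots> \<le> (\<integral>z. K * ?e z \<partial>lborel)"
      using K \<open>K \<ge> 0\<close> by (intro integral_mono'[OF iKe]) (auto simp: norm_mult mult.commute[of K] intro!: mult_left_mono)
    also have "\<dots> = K * sqrt (2 * pi) ^ DIM('a)"
      by (subst integral_mult_right_zero) (simp only: integral_exp_norm_square)
    finally show ?thesis .
  qed
  have Jm [measurable]: "(\<lambda>\<omega>. ?J i \<omega>) \<in> borel_measurable borel" for i
    by (rule lborel.borel_measurable_lebesgue_integral) measurable
  show ?thesis
  proof (rule integral_dominated_convergence[where w = "\<lambda>\<omega>. exp (- \<omega>\<^sup>2 / 2) * (K * sqrt (2 * pi) ^ DIM('a))"])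
    show "integrable lborel (\<lambda>\<omega>. exp (- \<omega>\<^sup>2 / 2) * (K * sqrt (2 * pi) ^ DIM('a)))"
      by (intro integrable_mult_left integrable_exp_square)
    show "AE \<omega> in lborel. norm (complex_of_real (exp (- \<omega>\<^sup>2 / 2)) * cis (- (\<omega> * b)) * ?J i \<omega>) \<le> exp (- \<omega>\<^sup>2 / 2) * (K * sqrt (2 * pi) ^ DIM('a))" for i
      using J by (intro AE_I2) (auto simp: norm_mult intro!: mult_left_mono)
    show "AE \<omega> in lborel. (\<lambda>i. complex_of_real (exp (- \<omega>\<^sup>2 / 2)) * cis (- (\<omega> * b)) * ?J i \<omega>)
       \<longlonglongrightarrow> complex_of_real (exp (- \<omega>\<^sup>2 / 2)) * cis (- (\<omega> * b)) * (of_real (sqrt (2 * pi) ^ DIM('a)) * H (- (\<omega> *\<^sub>R \<eta>)))"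
      using AE_lborel_singleton[of 0]
    proof eventually_elim
      fix \<omega> :: real assume "\<omega> \<noteq> 0"
      have "(\<lambda>i. ?J i \<omega>) \<longlonglongrightarrow> (\<integral>z. complex_of_real (?e z) * H (- (\<omega> *\<^sub>R \<eta>)) \<partial>lborel)"
      proof (rule integral_dominated_convergence[where w = "\<lambda>z. K * ?e z"])
        show "AE z in lborel. (\<lambda>i. complex_of_real (?e z) * H (- (\<omega> *\<^sub>R \<eta>) + \<epsilon> i *\<^sub>R z)) \<longlonglongrightarrow> complex_of_real (?e z) * H (- (\<omega> *\<^sub>R \<eta>))"
        proof (intro AE_I2 tendsto_mult tendsto_const lim)
          fix z
          have "(\<lambda>i. - (\<omega> *\<^sub>R \<eta>) + \<epsilon> i *\<^sub>R z) \<longlonglongrightarrow> - (\<omega> *\<^sub>R \<eta>) + 0 *\<^sub>R z"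
            by (intro tendsto_intros \<epsilon>)
          then show "(\<lambda>i. - (\<omega> *\<^sub>R \<eta>) + \<epsilon> i *\<^sub>R z) \<longlonglongrightarrow> - (\<omega> *\<^sub>R \<eta>)" by simp
        qed (use \<open>\<omega> \<noteq> 0\<close> \<open>\<eta> \<noteq> 0\<close> in auto)
        show "AE z in lborel. norm (complex_of_real (?e z) * H (- (\<omega> *\<^sub>R \<eta>) + \<epsilon> i *\<^sub>R z)) \<le> K * ?e z" for i
          using K by (intro AE_I2) (auto simp: norm_mult mult.commute[of K] intro!: mult_left_mono)
      qed (use iKe in auto)
      also have "(\<integral>z. complex_of_real (?e z) * H (- (\<omega> *\<^sub>R \<eta>)) \<partial>lborel) = of_real (sqrt (2 * pi) ^ DIM('a)) * H (- (\<omega> *\<^sub>R \<eta>))"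
        by (subst integral_mult_left_zero) (simp only: integral_complex_of_real integral_exp_norm_square)
      finally show "(\<lambda>i. complex_of_real (exp (- \<omega>\<^sup>2 / 2)) * cis (- (\<omega> * b)) * ?J i \<omega>)
       \<longlonglongrightarrow> complex_of_real (exp (- \<omega>\<^sup>2 / 2)) * cis (- (\<omega> * b)) * (of_real (sqrt (2 * pi) ^ DIM('a)) * H (- (\<omega> *\<^sub>R \<eta>)))"
        by (intro tendsto_intros)
    qed
  qed measurable
qed

lemma
  shows integrable_square_exp_square: "integrable lborel (\<lambda>s::real. s\<^sup>2 * exp (- s\<^sup>2 / 2))"
    and integral_square_exp_square: "(\<integral>s. (s::real)\<^sup>2 * exp (- s\<^sup>2 / 2) \<partial>lborel) = sqrt (2 * pi)"
    and integral_exp_square: "(\<integral>s. exp (- (s::real)\<^sup>2 / 2) \<partial>lborel) = sqrt (2 * pi)"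
proof -
  have "has_bochner_integral lborel (\<lambda>x. sqrt (2 * pi) * (std_normal_density x * x\<^sup>2)) (sqrt (2 * pi) * 1)"
    using std_normal_moment_even[of 1] by (intro has_bochner_integral_mult_right) (simp add: fact_numeral)
  also have "(\<lambda>x. sqrt (2 * pi) * (std_normal_density x * x\<^sup>2)) = (\<lambda>s::real. s\<^sup>2 * exp (- s\<^sup>2 / 2))"
    by (simp add: std_normal_density_def fun_eq_iff)
  finally show "integrable lborel (\<lambda>s::real. s\<^sup>2 * exp (- s\<^sup>2 / 2))"
    "(\<integral>s. (s::real)\<^sup>2 * exp (- s\<^sup>2 / 2) \<partial>lborel) = sqrt (2 * pi)"
    by (auto simp: has_bochner_integral_iff)
  have "has_bochner_integral lborel (\<lambda>x. sqrt (2 * pi) * (std_normal_density x)) (sqrt (2 * pi) * 1)"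
    using std_normal_moment_even[of 0] by (intro has_bochner_integral_mult_right) simp
  also have "(\<lambda>x. sqrt (2 * pi) * (std_normal_density x)) = (\<lambda>s::real. exp (- s\<^sup>2 / 2))"
    by (simp add: std_normal_density_def fun_eq_iff)
  finally show "(\<integral>s. exp (- (s::real)\<^sup>2 / 2) \<partial>lborel) = sqrt (2 * pi)"
    by (auto simp: has_bochner_integral_iff)
qed

lemma integral_dtt_mult_gaussian_le:
  fixes \<phi> :: "'a::euclidean_space \<times> real \<Rightarrow> real"
  assumes "test_fun \<phi>" and le: "\<And>t. \<bar>\<phi> (\<gamma>, t)\<bar> \<le> 1" and "N > 0"
  shows "\<bar>\<integral>t. dt 2 \<phi> (\<gamma>, t) * exp (- (b - N * t)\<^sup>2 / 2) \<partial>lborel\<bar> \<le> 2 * sqrt (2 * pi) * N"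
proof -
  obtain B where B: "\<And>n \<gamma> t. B < \<bar>t\<bar> \<Longrightarrow> dt n \<phi> (\<gamma>, t) = 0"
    using test_fun_support[OF assms(1)] by metis
  have sm: "smooth_fun \<phi>" using assms(1) by (simp add: test_fun_def)
  let ?G = "\<lambda>t. exp (- (b - N * t)\<^sup>2 / 2)"
  let ?G1 = "\<lambda>t. N * (b - N * t) * exp (- (b - N * t)\<^sup>2 / 2)"
  let ?G2 = "\<lambda>t. N\<^sup>2 * ((b - N * t)\<^sup>2 - 1) * exp (- (b - N * t)\<^sup>2 / 2)"
  let ?W = "\<lambda>t. N\<^sup>2 * ((b - N * t)\<^sup>2 * exp (- (b - N * t)\<^sup>2 / 2) + exp (- (b - N * t)\<^sup>2 / 2))"
  have "(\<integral>t. dt (Suc (Suc 0)) \<phi> (\<gamma>, t) *\<^sub>R ?G t \<partial>lborel) = - (\<integral>t. dt (Suc 0) \<phi> (\<gamma>, t) *\<^sub>R ?G1 t \<partial>lborel)"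
  proof (rule integral_by_parts_compact_support)
    show "(?G has_vector_derivative ?G1 t) (at t)" for t
      unfolding has_real_derivative_iff_has_vector_derivative[symmetric]
      by (auto intro!: derivative_eq_intros simp: field_simps power2_eq_square)
    show "continuous_on UNIV ?G1" by (intro continuous_intros) auto
  qed (fact B continuous_on_dt_slice[OF assms(1)] dt_has_real_derivative[OF sm])+
  also have "(\<integral>t. dt (Suc 0) \<phi> (\<gamma>, t) *\<^sub>R ?G1 t \<partial>lborel) = - (\<integral>t. dt 0 \<phi> (\<gamma>, t) *\<^sub>R ?G2 t \<partial>lborel)"
  proof (rule integral_by_parts_compact_support)
    show "(?G1 has_vector_derivative ?G2 t) (at t)" for t
      unfolding has_real_derivative_iff_has_vector_derivative[symmetric]
      by (auto intro!: derivative_eq_intros simp: field_simps power2_eq_square)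
    show "continuous_on UNIV ?G2" by (intro continuous_intros) auto
  qed (fact B continuous_on_dt_slice[OF assms(1)] dt_has_real_derivative[OF sm])+
  finally have eq: "(\<integral>t. dt 2 \<phi> (\<gamma>, t) * ?G t \<partial>lborel) = (\<integral>t. \<phi> (\<gamma>, t) * ?G2 t \<partial>lborel)"
    by (simp add: numeral_2_eq_2)
  have i0: "integrable lborel (\<lambda>s::real. s\<^sup>2 * exp (- s\<^sup>2 / 2) + exp (- s\<^sup>2 / 2))"
    by (intro Bochner_Integration.integrable_add integrable_square_exp_square integrable_exp_square)
  have "integrable lborel (\<lambda>t. (b + (-N) *\<^sub>R t)\<^sup>2 * exp (- (b + (-N) *\<^sub>R t)\<^sup>2 / 2) + exp (- (b + (-N) *\<^sub>R t)\<^sup>2 / 2))"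
    using \<open>N > 0\<close> by (intro integrable_lborel_affine[OF i0]) auto
  then have iW: "integrable lborel ?W"
    by (intro integrable_mult_right) simp
  have "(\<integral>s. s\<^sup>2 * exp (- s\<^sup>2 / 2) + exp (- s\<^sup>2 / 2) \<partial>lborel) = N * (\<integral>t. (b - N * t)\<^sup>2 * exp (- (b - N * t)\<^sup>2 / 2) + exp (- (b - N * t)\<^sup>2 / 2) \<partial>lborel)"
    using \<open>N > 0\<close> by (subst lborel_integral_real_affine[where c = "-N" and t = b]) auto
  also have "(\<integral>s. (s::real)\<^sup>2 * exp (- s\<^sup>2 / 2) + exp (- s\<^sup>2 / 2) \<partial>lborel) = 2 * sqrt (2 * pi)"
    by (subst Bochner_Integration.integral_add[OF integrable_square_exp_square integrable_exp_square])
       (simp only: integral_square_exp_square integral_exp_square)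
  finally have W: "(\<integral>t. ?W t \<partial>lborel) = 2 * sqrt (2 * pi) * N"
    by (subst integral_mult_right_zero) (simp add: power2_eq_square)
  have "\<bar>\<integral>t. \<phi> (\<gamma>, t) * ?G2 t \<partial>lborel\<bar> \<le> (\<integral>t. \<bar>\<phi> (\<gamma>, t) * ?G2 t\<bar> \<partial>lborel)"
    using integral_norm_bound[of lborel "\<lambda>t. \<phi> (\<gamma>, t) * ?G2 t"] by simp
  also have "\<dots> \<le> (\<integral>t. ?W t \<partial>lborel)"
  proof (rule integral_mono'[OF iW])
    fix t
    have "\<bar>\<phi> (\<gamma>, t) * ?G2 t\<bar> \<le> 1 * \<bar>?G2 t\<bar>"
      unfolding abs_mult[of "\<phi> (\<gamma>, t)"] by (intro mult_right_mono le) simp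
    also have "\<dots> = N\<^sup>2 * (\<bar>(b - N * t)\<^sup>2 - 1\<bar> * ?G t)"
      by (simp add: abs_mult)
    also have "\<dots> \<le> N\<^sup>2 * (((b - N * t)\<^sup>2 + 1) * ?G t)"
      using zero_le_power2[of "b - N * t"] by (intro mult_left_mono mult_right_mono) (linarith, auto)
    finally show "\<bar>\<phi> (\<gamma>, t) * ?G2 t\<bar> \<le> ?W t" by (simp add: algebra_simps)
  qed simp
  finally show ?thesis unfolding eq W .
qed

lemma integral_gaussian_Fdt_le:
  fixes \<phi> :: "'a::euclidean_space \<times> real \<Rightarrow> real"
  assumes "test_fun \<phi>" and le: "\<And>t. \<bar>\<phi> (\<gamma>, t)\<bar> \<le> 1" and "N > 0"
  shows "integrable lborel (\<lambda>\<omega>. complex_of_real (exp (- \<omega>\<^sup>2 / 2)) * cis (\<omega> * b) * Fdt 2 \<phi> \<gamma> (N * \<omega>))"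
    and "\<bar>Re (\<integral>\<omega>. complex_of_real (exp (- \<omega>\<^sup>2 / 2)) * cis (\<omega> * b) * Fdt 2 \<phi> \<gamma> (N * \<omega>) \<partial>lborel)\<bar> \<le> 4 * pi * N"
proof -
  let ?G = "\<lambda>\<omega>. complex_of_real (exp (- \<omega>\<^sup>2 / 2)) * cis (\<omega> * b)"
  obtain B where B: "\<And>n \<gamma> t. B < \<bar>t\<bar> \<Longrightarrow> dt n \<phi> (\<gamma>, t) = 0"
    using test_fun_support[OF assms(1)] by metis
  obtain K where K: "K \<ge> 0" "\<And>\<gamma> \<omega>. norm (Fdt 2 \<phi> \<gamma> \<omega>) \<le> K"
    using norm_Fdt_bounded[OF assms(1)] by metis
  have "continuous_on UNIV (\<lambda>\<omega>. Fdt 2 \<phi> \<gamma> (N * \<omega>))"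
    by (rule continuous_on_compose2[OF continuous_on_Fdt[OF assms(1), of 2], of UNIV "\<lambda>\<omega>. (\<gamma>, N * \<omega>)", simplified])
       (intro continuous_intros)
  then have [measurable]: "(\<lambda>\<omega>. Fdt 2 \<phi> \<gamma> (N * \<omega>)) \<in> borel_measurable borel"
    by (rule borel_measurable_continuous_onI)
  have iG: "integrable lborel ?G"
    by (rule Bochner_Integration.integrable_bound[OF integrable_exp_square]) (auto simp: norm_mult)
  show "integrable lborel (\<lambda>\<omega>. ?G \<omega> * Fdt 2 \<phi> \<gamma> (N * \<omega>))"
    by (rule Bochner_Integration.integrable_bound[OF integrable_mult_left[OF integrable_exp_square, of K]])
       (use K in \<open>auto simp: norm_mult intro!: AE_I2 mult_left_mono\<close>)
  have "integrable lborel (\<lambda>t. dt 2 \<phi> (\<gamma>, t) *\<^sub>R (1::real))"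
    by (rule integrable_compact_support_mult[OF _ continuous_on_dt_slice[OF assms(1)]]) (use B in auto)
  then have iu: "integrable lborel (\<lambda>t. complex_of_real (dt 2 \<phi> (\<gamma>, t)))" by simp
  have "(\<integral>\<omega>. ?G \<omega> * Fdt 2 \<phi> \<gamma> (N * \<omega>) \<partial>lborel)
    = (\<integral>t. complex_of_real (dt 2 \<phi> (\<gamma>, t)) * (\<integral>\<omega>. ?G \<omega> * cis (- (N * \<omega> * t)) \<partial>lborel) \<partial>lborel)"
    unfolding fourier1_def by (rule Fubini_bounded_kernel[OF iG iu]) simp_all
  also have "\<dots> = (\<integral>t. complex_of_real (sqrt (2 * pi) * (dt 2 \<phi> (\<gamma>, t) * exp (- (b - N * t)\<^sup>2 / 2))) \<partial>lborel)"
  proof (rule Bochner_Integration.integral_cong[OF refl])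
    fix t
    have "(\<integral>\<omega>. ?G \<omega> * cis (- (N * \<omega> * t)) \<partial>lborel) = (\<integral>\<omega>. of_real (exp (- \<omega>\<^sup>2 / 2)) * cis ((b - N * t) * \<omega>) \<partial>lborel)"
      unfolding mult.assoc[where 'a=complex] cis_mult by (simp add: algebra_simps)
    also have "\<dots> = complex_of_real (sqrt (2 * pi) * exp (- (b - N * t)\<^sup>2 / 2))" by (rule fourier_exp_square)
    finally show "complex_of_real (dt 2 \<phi> (\<gamma>, t)) * (\<integral>\<omega>. ?G \<omega> * cis (- (N * \<omega> * t)) \<partial>lborel) =
      complex_of_real (sqrt (2 * pi) * (dt 2 \<phi> (\<gamma>, t) * exp (- (b - N * t)\<^sup>2 / 2)))"
      by (simp add: mult_ac)
  qed
  also have "\<dots> = complex_of_real (\<integral>t. sqrt (2 * pi) * (dt 2 \<phi> (\<gamma>, t) * exp (- (b - N * t)\<^sup>2 / 2)) \<partial>lborel)"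
    by (rule integral_complex_of_real)
  finally have "\<bar>Re (\<integral>\<omega>. ?G \<omega> * Fdt 2 \<phi> \<gamma> (N * \<omega>) \<partial>lborel)\<bar> = sqrt (2 * pi) * \<bar>\<integral>t. dt 2 \<phi> (\<gamma>, t) * exp (- (b - N * t)\<^sup>2 / 2) \<partial>lborel\<bar>"
    by (simp add: abs_mult)
  also have "\<dots> \<le> sqrt (2 * pi) * (2 * sqrt (2 * pi) * N)"
    by (intro mult_left_mono integral_dtt_mult_gaussian_le assms) auto
  also have "\<dots> = 4 * pi * N"
    by (simp add: algebra_simps flip: real_sqrt_mult)
  finally show "\<bar>Re (\<integral>\<omega>. ?G \<omega> * Fdt 2 \<phi> \<gamma> (N * \<omega>) \<partial>lborel)\<bar> \<le> 4 * pi * N" .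
qed

lemma radon_pairing_gaussian_ridge_le:
  fixes \<phi> :: "'a::euclidean_space \<times> real \<Rightarrow> real"
  assumes \<phi>: "test_fun \<phi>" and le: "\<And>\<gamma> t. norm \<gamma> = 1 \<Longrightarrow> \<bar>\<phi> (\<gamma>, t)\<bar> \<le> 1" and "\<eta> \<noteq> 0"
  shows "\<bar>radon_pairing (\<lambda>x. exp (- (\<eta> \<bullet> x - b)\<^sup>2 / 2)) \<phi>\<bar>
    \<le> 2 * (2 * pi) ^ (DIM('a) - 1) * (2 * sqrt (2 * pi) * norm \<eta>)"
proof -
  let ?d = "DIM('a)"
  let ?g = "\<lambda>x. exp (- (\<eta> \<bullet> x - b)\<^sup>2 / 2)"
  let ?k = "backproj (ramp_filter \<phi>)"
  define N where "N = norm \<eta>"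
  define \<gamma> where "\<gamma> = \<eta> /\<^sub>R N"
  have N: "N > 0" and \<gamma>: "norm \<gamma> = 1" "norm (- \<gamma>) = 1" and \<eta>: "\<eta> = N *\<^sub>R \<gamma>"
    using \<open>\<eta> \<noteq> 0\<close> by (auto simp: N_def \<gamma>_def)
  obtain K where K: "K \<ge> 0" "\<And>\<gamma> \<omega>. norm (Fdt 2 \<phi> \<gamma> \<omega>) \<le> K"
    using norm_Fdt_bounded[OF \<phi>] by metis
  note [measurable] = borel_measurable_polar_symbol[OF \<phi>]
  note H = integrable_polar_symbol[OF \<phi>]
  let ?p = "\<lambda>\<omega>. complex_of_real (exp (- \<omega>\<^sup>2 / 2)) * cis (- (\<omega> * b)) * polar_symbol \<phi> (- (\<omega> *\<^sub>R \<eta>))"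
  have kx: "?k x = Re (\<integral>\<xi>. polar_symbol \<phi> \<xi> * cis (\<xi> \<bullet> x) \<partial>lborel) / pi" for x
    by (rule backproj_ramp_filter[OF \<phi>])
  have [measurable]: "(\<lambda>x. \<integral>\<xi>. polar_symbol \<phi> \<xi> * cis (\<xi> \<bullet> x) \<partial>lborel) \<in> borel_measurable borel"
    by (rule lborel.borel_measurable_lebesgue_integral) measurable
  have [measurable]: "?k \<in> borel_measurable borel"
    unfolding kx[abs_def] by measurable
  show ?thesis
  proof (cases "integrable lborel (\<lambda>x. ?g x * ?k x)")
    case False
    \<comment> \<open>the Bochner integral then has the junk value 0, so no decay of the backprojection is needed\<close>
    then show ?thesis
      unfolding radon_pairing_def by (simp add: not_integrable_integral_eq)
  next
    case True
    define \<epsilon> where "\<epsilon> i = 1 / real (Suc i)" for i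
    have \<epsilon>: "\<epsilon> i > 0" "\<epsilon> \<longlonglongrightarrow> 0" for i
      unfolding \<epsilon>_def using LIMSEQ_Suc[OF lim_1_over_n] by (auto simp: \<epsilon>_def[abs_def])
    let ?e = "\<lambda>i x::'a. exp (- (norm (\<epsilon> i *\<^sub>R x))\<^sup>2 / 2)"
    let ?Z = "\<lambda>i. \<integral>x. complex_of_real (?g x * ?e i x) * (\<integral>\<xi>. polar_symbol \<phi> \<xi> * cis (\<xi> \<bullet> x) \<partial>lborel) \<partial>lborel"
    have lim1: "(\<lambda>i. \<integral>x. ?g x * ?k x * ?e i x \<partial>lborel) \<longlonglongrightarrow> (\<integral>x. ?g x * ?k x \<partial>lborel)"
    proof (rule integral_dominated_convergence[where w = "\<lambda>x. \<bar>?g x * ?k x\<bar>"])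
      show "AE x in lborel. (\<lambda>i. ?g x * ?k x * ?e i x) \<longlonglongrightarrow> ?g x * ?k x"
      proof (rule AE_I2)
        fix x
        have "(\<lambda>i. ?g x * ?k x * ?e i x) \<longlonglongrightarrow> ?g x * ?k x * exp (- (norm (0 *\<^sub>R x))\<^sup>2 / 2)"
          by (intro tendsto_intros \<epsilon>) auto
        then show "(\<lambda>i. ?g x * ?k x * ?e i x) \<longlonglongrightarrow> ?g x * ?k x" by simp
      qed
      show "AE x in lborel. norm (?g x * ?k x * ?e i x) \<le> \<bar>?g x * ?k x\<bar>" for i
        by (intro AE_I2) (simp add: abs_mult mult_left_le)
    qed (use True in auto)
    have "(\<integral>x. ?g x * ?k x * ?e i x \<partial>lborel) = Re (?Z i) / pi" for i
    proof -
      have "integrable lborel (\<lambda>x. complex_of_real (?g x * ?e i x) * (\<integral>\<xi>. polar_symbol \<phi> \<xi> * cis (\<xi> \<bullet> x) \<partial>lborel))"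
      proof (rule Bochner_Integration.integrable_bound)
        show "integrable lborel (\<lambda>x. ?e i x * (\<integral>\<xi>. norm (polar_symbol \<phi> \<xi>) \<partial>lborel))"
          by (intro integrable_mult_left fourier_scaled_exp_norm_square(1) \<epsilon>)
        have "norm (\<integral>\<xi>. polar_symbol \<phi> \<xi> * cis (\<xi> \<bullet> x) \<partial>lborel) \<le> (\<integral>\<xi>. norm (polar_symbol \<phi> \<xi>) \<partial>lborel)" for x
          using integral_norm_bound[of lborel "\<lambda>\<xi>. polar_symbol \<phi> \<xi> * cis (\<xi> \<bullet> x)"] by (simp add: norm_mult)
        then have "?g x * ?e i x * norm (\<integral>\<xi>. polar_symbol \<phi> \<xi> * cis (\<xi> \<bullet> x) \<partial>lborel) \<le> 1 * ?e i x * (\<integral>\<xi>. norm (polar_symbol \<phi> \<xi>) \<partial>lborel)" for x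
          by (intro mult_mono) auto
        then show "AE x in lborel. norm (complex_of_real (?g x * ?e i x) * (\<integral>\<xi>. polar_symbol \<phi> \<xi> * cis (\<xi> \<bullet> x) \<partial>lborel)) \<le> norm (?e i x * (\<integral>\<xi>. norm (polar_symbol \<phi> \<xi>) \<partial>lborel))"
          by (intro AE_I2) (simp add: norm_mult)
      qed measurable
      then have "Re (?Z i) = (\<integral>x. Re (complex_of_real (?g x * ?e i x) * (\<integral>\<xi>. polar_symbol \<phi> \<xi> * cis (\<xi> \<bullet> x) \<partial>lborel)) \<partial>lborel)"
        by (simp only: integral_Re)
      also have "\<dots> = (\<integral>x. pi * (?g x * ?k x * ?e i x) \<partial>lborel)"
        unfolding kx by (intro Bochner_Integration.integral_cong) auto
      finally show ?thesis by simp
    qed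
    note Zi = this
    have lim2: "?Z \<longlonglongrightarrow> of_real (sqrt (2 * pi) ^ ?d / sqrt (2 * pi)) * (\<integral>\<omega>. complex_of_real (exp (- \<omega>\<^sup>2 / 2)) * cis (- (\<omega> * b)) *
         (of_real (sqrt (2 * pi) ^ ?d) * polar_symbol \<phi> (- (\<omega> *\<^sub>R \<eta>))) \<partial>lborel)"
      unfolding damped_ridge_pairing[OF \<epsilon>(1) H]
      by (intro tendsto_mult tendsto_const damped_ridge_pairing_limit[where K = K] \<epsilon>(2) \<open>\<eta> \<noteq> 0\<close> polar_symbol_tendsto[OF \<phi>])
         (auto simp: polar_symbol_def[abs_def] intro: K borel_measurable_polar_symbol[OF \<phi>, unfolded polar_symbol_def[abs_def]])
    also have "(\<integral>\<omega>. complex_of_real (exp (- \<omega>\<^sup>2 / 2)) * cis (- (\<omega> * b)) * (of_real (sqrt (2 * pi) ^ ?d) * polar_symbol \<phi> (- (\<omega> *\<^sub>R \<eta>))) \<partial>lborel)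
       = (\<integral>\<omega>. of_real (sqrt (2 * pi) ^ ?d) * ?p \<omega> \<partial>lborel)"
      by (simp only: mult_ac)
    also have "\<dots> = of_real (sqrt (2 * pi) ^ ?d) * (\<integral>\<omega>. ?p \<omega> \<partial>lborel)"
      by (rule integral_mult_right_zero)
    also have "of_real (sqrt (2 * pi) ^ ?d / sqrt (2 * pi)) * (of_real (sqrt (2 * pi) ^ ?d) * (\<integral>\<omega>. ?p \<omega> \<partial>lborel))
      = of_real ((2 * pi) ^ ?d / sqrt (2 * pi)) * (\<integral>\<omega>. ?p \<omega> \<partial>lborel)"
    proof -
      have "sqrt (2 * pi) ^ ?d * sqrt (2 * pi) ^ ?d = (sqrt (2 * pi) * sqrt (2 * pi)) ^ ?d"
        by (rule power_mult_distrib[symmetric])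
      also have "sqrt (2 * pi) * sqrt (2 * pi) = 2 * pi" by (rule real_sqrt_mult_self[THEN trans]) simp
      finally have c: "sqrt (2 * pi) ^ ?d / sqrt (2 * pi) * sqrt (2 * pi) ^ ?d = (2 * pi) ^ ?d / sqrt (2 * pi)"
        by (simp only: times_divide_eq_left)
      have "complex_of_real r * (of_real s * z) = of_real (r * s) * z" for r s z by simp
      then show ?thesis unfolding c[symmetric] .
    qed
    finally have "(\<lambda>i. Re (?Z i) / pi) \<longlonglongrightarrow> Re (of_real ((2 * pi) ^ ?d / sqrt (2 * pi)) * (\<integral>\<omega>. ?p \<omega> \<partial>lborel)) / pi"
      by (intro tendsto_intros) auto
    with lim1 have eq: "(\<integral>x. ?g x * ?k x \<partial>lborel) = (2 * pi) ^ ?d / sqrt (2 * pi) * Re (\<integral>\<omega>. ?p \<omega> \<partial>lborel) / pi"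
      unfolding Zi using LIMSEQ_unique by fastforce
    let ?q = "\<lambda>\<omega>. complex_of_real (exp (- \<omega>\<^sup>2 / 2)) * cis (\<omega> * b) * Fdt 2 \<phi> \<gamma> (N * \<omega>)"
    let ?r = "\<lambda>\<omega>. complex_of_real (exp (- \<omega>\<^sup>2 / 2)) * cis (\<omega> * (- b)) * Fdt 2 \<phi> (- \<gamma>) (N * \<omega>)"
    note q = integral_gaussian_Fdt_le[OF \<phi> le[OF \<gamma>(1)] N, of b]
    note r = integral_gaussian_Fdt_le[OF \<phi> le[OF \<gamma>(2)] N, of "- b"]
    have iq': "integrable lborel (\<lambda>\<omega>. cnj (?q \<omega>))" using q(1) by (rule integrable_cnj)
    have i1: "integrable lborel (\<lambda>\<omega>. indicator {..<0} \<omega> *\<^sub>R cnj (?q \<omega>))"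
      by (intro integrable_mult_indicator iq') simp
    have i2: "integrable lborel (\<lambda>\<omega>. indicator {0<..} \<omega> *\<^sub>R ?r \<omega>)"
      by (intro integrable_mult_indicator r(1)) simp
    have "(\<integral>\<omega>. ?p \<omega> \<partial>lborel) = (\<integral>\<omega>. indicator {..<0} \<omega> *\<^sub>R cnj (?q \<omega>) + indicator {0<..} \<omega> *\<^sub>R ?r \<omega> \<partial>lborel)"
    proof (rule integral_cong_AE)
      show "(\<lambda>\<omega>. indicator {..<0} \<omega> *\<^sub>R cnj (?q \<omega>) + indicator {0<..} \<omega> *\<^sub>R ?r \<omega>) \<in> borel_measurable lborel"
        using i1 i2 by (intro borel_measurable_add borel_measurable_integrable)
      show "AE \<omega> in lborel. ?p \<omega> = indicator {..<0} \<omega> *\<^sub>R cnj (?q \<omega>) + indicator {0<..} \<omega> *\<^sub>R ?r \<omega>"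
        using AE_lborel_singleton[of 0]
      proof eventually_elim
        fix \<omega> :: real assume "\<omega> \<noteq> 0"
        then consider "\<omega> < 0" | "\<omega> > 0" by linarith
        then show "?p \<omega> = indicator {..<0} \<omega> *\<^sub>R cnj (?q \<omega>) + indicator {0<..} \<omega> *\<^sub>R ?r \<omega>"
        proof cases
          case 1
          have "polar_symbol \<phi> (- (\<omega> *\<^sub>R \<eta>)) = polar_symbol \<phi> ((- (N * \<omega>)) *\<^sub>R \<gamma>)" by (simp add: \<eta> mult.commute)
          also have "\<dots> = Fdt 2 \<phi> \<gamma> (- (N * \<omega>))"
            using 1 N by (intro polar_symbol_scaleR \<gamma>) (auto simp: mult_pos_neg)
          finally show ?thesis using 1 by (simp add: Fdt_uminus cis_cnj)
        next
          case 2
          have "polar_symbol \<phi> (- (\<omega> *\<^sub>R \<eta>)) = polar_symbol \<phi> ((N * \<omega>) *\<^sub>R (- \<gamma>))" by (simp add: \<eta> mult.commute)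
          also have "\<dots> = Fdt 2 \<phi> (- \<gamma>) (N * \<omega>)"
            using 2 N by (intro polar_symbol_scaleR \<gamma>) auto
          finally show ?thesis using 2 by simp
        qed
      qed
    qed measurable
    also have "\<dots> = (\<integral>\<omega>. indicator {..<0} \<omega> *\<^sub>R cnj (?q \<omega>) \<partial>lborel) + (\<integral>\<omega>. indicator {0<..} \<omega> *\<^sub>R ?r \<omega> \<partial>lborel)"
      using i1 i2 by (rule Bochner_Integration.integral_add)
    finally have "2 * Re (\<integral>\<omega>. ?p \<omega> \<partial>lborel) = Re (\<integral>\<omega>. cnj (?q \<omega>) \<partial>lborel) + Re (\<integral>\<omega>. ?r \<omega> \<partial>lborel)"
      using Re_integral_hermitian_neg[OF iq'] Re_integral_hermitian_pos[OF r(1)]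
      by (simp add: Fdt_uminus cis_cnj del: Bochner_Integration.integral_cnj)
    also have "(\<integral>\<omega>. cnj (?q \<omega>) \<partial>lborel) = cnj (\<integral>\<omega>. ?q \<omega> \<partial>lborel)"
      by (rule Bochner_Integration.integral_cnj)
    finally have "\<bar>2 * Re (\<integral>\<omega>. ?p \<omega> \<partial>lborel)\<bar> \<le> 8 * pi * N"
      using q(2) r(2) by simp
    then have "\<bar>Re (\<integral>\<omega>. ?p \<omega> \<partial>lborel)\<bar> / pi \<le> 4 * N"
      by (simp add: field_simps)
    then have "(2 * pi) ^ ?d / sqrt (2 * pi) * (\<bar>Re (\<integral>\<omega>. ?p \<omega> \<partial>lborel)\<bar> / pi) \<le> (2 * pi) ^ ?d / sqrt (2 * pi) * (4 * N)"
      by (intro mult_left_mono) auto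
    also have "\<dots> = (2 * pi) ^ (?d - 1) * (2 * pi / sqrt (2 * pi)) * (4 * N)"
      using DIM_positive[where 'a='a] by (cases "DIM('a)") auto
    also have "2 * pi / sqrt (2 * pi) = sqrt (2 * pi)"
      by (rule real_div_sqrt) simp
    finally show ?thesis
      unfolding radon_pairing_def eq by (simp add: abs_mult N_def mult_ac)
  qed
qed

lemma RTV2_gaussian_ridge_le:
  fixes \<eta> :: "'a::euclidean_space"
  assumes "\<eta> \<noteq> 0" "A \<ge> 0"
  shows "RTV2 (\<lambda>x. A * exp (- (\<eta> \<bullet> x - b)\<^sup>2 / 2)) \<le> ereal (2 * sqrt (2 * pi) * A * norm \<eta>)"
proof -
  let ?c = "2 * (2 * pi) ^ (DIM('a) - 1) :: real"
  let ?T = "{\<phi>::'a \<times> real \<Rightarrow> real. test_fun \<phi> \<and> (\<forall>\<gamma> t. norm \<gamma> = 1 \<longrightarrow> \<bar>\<phi> (\<gamma>, t)\<bar> \<le> 1)}"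
  have "radon_pairing (\<lambda>x. A * exp (- (\<eta> \<bullet> x - b)\<^sup>2 / 2)) \<phi> \<le> A * (?c * (2 * sqrt (2 * pi) * norm \<eta>))"
    if "\<phi> \<in> ?T" for \<phi>
  proof -
    have "radon_pairing (\<lambda>x. A * exp (- (\<eta> \<bullet> x - b)\<^sup>2 / 2)) \<phi> = A * radon_pairing (\<lambda>x. exp (- (\<eta> \<bullet> x - b)\<^sup>2 / 2)) \<phi>"
      unfolding radon_pairing_def by (simp add: mult.assoc)
    also have "\<dots> \<le> A * (?c * (2 * sqrt (2 * pi) * norm \<eta>))"
      using radon_pairing_gaussian_ridge_le[of \<phi> \<eta> b] that assms by (intro mult_left_mono) auto
    finally show ?thesis .
  qed
  then have "(SUP \<phi>\<in>?T. ereal (radon_pairing (\<lambda>x. A * exp (- (\<eta> \<bullet> x - b)\<^sup>2 / 2)) \<phi>)) \<le> ereal (A * (?c * (2 * sqrt (2 * pi) * norm \<eta>)))"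
    by (intro SUP_least) auto
  then have "RTV2 (\<lambda>x. A * exp (- (\<eta> \<bullet> x - b)\<^sup>2 / 2)) \<le> ereal (1 / ?c) * ereal (A * (?c * (2 * sqrt (2 * pi) * norm \<eta>)))"
    unfolding RTV2_def by (intro ereal_mult_left_mono) auto
  also have "\<dots> = ereal (2 * sqrt (2 * pi) * A * norm \<eta>)"
    by simp
  finally show ?thesis .
qed

lemma gaussian_ridge_in_class:
  fixes \<eta> :: "'a::euclidean_space"
  assumes "\<eta> \<noteq> 0" "A \<ge> 0" "2 * sqrt (2 * pi) * A * norm \<eta> \<le> C"
  shows "(\<lambda>x. A * exp (- (\<eta> \<bullet> x - b)\<^sup>2 / 2)) \<in> RBV2_ball"
    and "RTV2_ball (\<lambda>x. A * exp (- (\<eta> \<bullet> x - b)\<^sup>2 / 2)) \<le> ereal C"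
proof -
  let ?g = "\<lambda>x. A * exp (- (\<eta> \<bullet> x - b)\<^sup>2 / 2)"
  have le: "RTV2 ?g \<le> ereal C"
    using RTV2_gaussian_ridge_le[OF assms(1,2), of b] assms(3) by (meson ereal_less_eq(3) order_trans)
  have "\<bar>?g x\<bar> \<le> A * (1 + norm x)" for x
  proof -
    have "\<bar>?g x\<bar> \<le> A * 1" using assms(2) by (simp add: abs_mult mult_left_le)
    also have "\<dots> \<le> A * (1 + norm x)" using assms(2) by (intro mult_left_mono) auto
    finally show ?thesis .
  qed
  with le have g: "?g \<in> RBV2"
    unfolding RBV2_def by (auto intro!: exI[of _ A] intro: le_less_trans)
  then show "?g \<in> RBV2_ball" unfolding RBV2_ball_def by auto
  have "RTV2_ball ?g \<le> RTV2 ?g"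
    unfolding RTV2_ball_def using g by (intro INF_lower) auto
  with le show "RTV2_ball ?g \<le> ereal C" by order
qed

section \<open>Synthesis of a bump from ridges\<close>

text \<open>The window stays away from frequency 0, which makes \<open>profile\<close> below decay fast in every dimension;
  it vanishes to second order at both ends, which gives the quadratic decay of \<open>window_cos\<close>.\<close>

definition window :: "real \<Rightarrow> real" where
  "window \<omega> = indicator {2 * pi..4 * pi} \<omega> * (1 - cos \<omega>)"

definition window_cos :: "real \<Rightarrow> real" where
  "window_cos \<beta> = (\<integral>\<omega>. window \<omega> * cos (\<omega> * \<beta>) \<partial>lborel)"

lemma window_measurable [measurable]: "window \<in> borel_measurable borel"
  unfolding window_def by measurable

lemma window_nonneg: "0 \<le> window \<omega>"
  by (simp add: window_def indicator_def)

lemma window_le: "window \<omega> \<le> 2 * indicator {2 * pi..4 * pi} \<omega>"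
  using cos_ge_minus_one[of \<omega>] by (auto simp: window_def indicator_def)

lemma integrable_indicator_Icc: "integrable lborel (indicator {a..b} :: real \<Rightarrow> real)"
  by (rule integrable_real_indicator) (auto simp: emeasure_lborel_Icc_eq)

lemma integrable_window: "integrable lborel window"
  by (rule Bochner_Integration.integrable_bound[OF integrable_mult_right[OF integrable_indicator_Icc, of 2 "2*pi" "4*pi"]])
     (use window_nonneg window_le in \<open>auto simp: abs_mult intro!: AE_I2\<close>)

lemma window_cos_measurable [measurable]: "window_cos \<in> borel_measurable borel"
  unfolding window_cos_def[abs_def]
  by (rule lborel.borel_measurable_lebesgue_integral) measurable

lemma square_mult_window_cos: "\<beta>\<^sup>2 * window_cos \<beta> = - (\<integral>\<omega>. cos \<omega> * cos (\<omega> * \<beta>) * indicator {2 * pi..4 * pi} \<omega> \<partial>lborel)"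
proof -
  let ?F = "\<lambda>\<omega>. (1 - cos \<omega>) * (\<beta> * sin (\<omega> * \<beta>)) + sin \<omega> * cos (\<omega> * \<beta>)"
  let ?f = "\<lambda>\<omega>. \<beta>\<^sup>2 * ((1 - cos \<omega>) * cos (\<omega> * \<beta>)) + cos \<omega> * cos (\<omega> * \<beta>)"
  have i1: "integrable lborel (\<lambda>\<omega>. window \<omega> * cos (\<omega> * \<beta>))"
    by (rule Bochner_Integration.integrable_bound[OF integrable_window]) (auto simp: abs_mult mult_left_le)
  have i2: "integrable lborel (\<lambda>\<omega>. cos \<omega> * cos (\<omega> * \<beta>) * indicator {2 * pi..4 * pi} \<omega>)"
    by (rule Bochner_Integration.integrable_bound[OF integrable_indicator_Icc[of "2*pi" "4*pi"]])
       (auto simp: abs_mult indicator_def mult_le_one)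
  have "(\<integral>\<omega>. ?f \<omega> * indicator {2 * pi..4 * pi} \<omega> \<partial>lborel) = ?F (4 * pi) - ?F (2 * pi)"
  proof (rule integral_FTC_Icc_real)
    show "(?F has_real_derivative ?f \<omega>) (at \<omega>)" for \<omega>
      by (auto intro!: derivative_eq_intros simp: algebra_simps power2_eq_square)
    show "isCont ?f \<omega>" for \<omega>
      by (intro continuous_intros)
  qed simp
  also have "\<dots> = 0"
    using sin_npi[of 4] cos_npi[of 4] sin_npi[of 2] cos_npi[of 2] by simp
  also have "(\<lambda>\<omega>. ?f \<omega> * indicator {2 * pi..4 * pi} \<omega>) = (\<lambda>\<omega>. \<beta>\<^sup>2 * (window \<omega> * cos (\<omega> * \<beta>)) + cos \<omega> * cos (\<omega> * \<beta>) * indicator {2 * pi..4 * pi} \<omega>)"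
    by (simp add: fun_eq_iff window_def algebra_simps)
  also have "(\<integral>\<omega>. \<beta>\<^sup>2 * (window \<omega> * cos (\<omega> * \<beta>)) + cos \<omega> * cos (\<omega> * \<beta>) * indicator {2 * pi..4 * pi} \<omega> \<partial>lborel)
    = \<beta>\<^sup>2 * window_cos \<beta> + (\<integral>\<omega>. cos \<omega> * cos (\<omega> * \<beta>) * indicator {2 * pi..4 * pi} \<omega> \<partial>lborel)"
    unfolding window_cos_def using i1 i2 by (subst Bochner_Integration.integral_add) auto
  finally show ?thesis by simp
qed

lemma window_cos_decay: "\<bar>window_cos \<beta>\<bar> \<le> 6 * pi / (1 + \<beta>\<^sup>2)"
proof -
  have "\<bar>window_cos \<beta>\<bar> \<le> (\<integral>\<omega>. \<bar>window \<omega> * cos (\<omega> * \<beta>)\<bar> \<partial>lborel)"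
    unfolding window_cos_def using integral_norm_bound[of lborel "\<lambda>\<omega>. window \<omega> * cos (\<omega> * \<beta>)"] by simp
  also have "\<dots> \<le> (\<integral>\<omega>. 2 * indicator {2 * pi..4 * pi} \<omega> \<partial>lborel)"
  proof (rule integral_mono'[OF integrable_mult_right[OF integrable_indicator_Icc]])
    fix \<omega>
    have "\<bar>window \<omega> * cos (\<omega> * \<beta>)\<bar> \<le> \<bar>window \<omega>\<bar> * 1" unfolding abs_mult by (intro mult_left_mono) auto
    then show "\<bar>window \<omega> * cos (\<omega> * \<beta>)\<bar> \<le> 2 * indicator {2 * pi..4 * pi} \<omega>"
      using window_le[of \<omega>] window_nonneg[of \<omega>] by simp
  qed (simp add: indicator_def)
  also have "\<dots> = 4 * pi" by simp
  finally have 1: "\<bar>window_cos \<beta>\<bar> \<le> 4 * pi" .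
  have "\<bar>\<integral>\<omega>. cos \<omega> * cos (\<omega> * \<beta>) * indicator {2 * pi..4 * pi} \<omega> \<partial>lborel\<bar> \<le> (\<integral>\<omega>. \<bar>cos \<omega> * cos (\<omega> * \<beta>) * indicator {2 * pi..4 * pi} \<omega>\<bar> \<partial>lborel)"
    using integral_norm_bound[of lborel "\<lambda>\<omega>. cos \<omega> * cos (\<omega> * \<beta>) * indicator {2 * pi..4 * pi} \<omega>"] by simp
  also have "\<dots> \<le> (\<integral>\<omega>. indicator {2 * pi..4 * pi} \<omega> \<partial>lborel)"
    by (rule integral_mono'[OF integrable_indicator_Icc]) (auto simp: abs_mult indicator_def mult_le_one)
  also have "\<dots> = 2 * pi" by simp
  finally have "\<bar>\<beta>\<^sup>2 * window_cos \<beta>\<bar> \<le> 2 * pi" unfolding square_mult_window_cos by simp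
  with 1 have "\<bar>window_cos \<beta>\<bar> * (1 + \<beta>\<^sup>2) \<le> 6 * pi" by (simp add: abs_mult algebra_simps)
  then show ?thesis by (subst pos_le_divide_eq) (auto simp: add_pos_nonneg)
qed

lemma integrable_window_cos: "integrable lborel window_cos"
proof (rule Bochner_Integration.integrable_bound)
  show "integrable lborel (\<lambda>\<beta>. 6 * pi * (1 / (1 + \<beta>\<^sup>2)))"
    by (intro integrable_mult_right integrable_inverse_1_plus_square_lborel)
  show "AE \<beta> in lborel. norm (window_cos \<beta>) \<le> norm (6 * pi * (1 / (1 + \<beta>\<^sup>2)))"
    using window_cos_decay by (intro AE_I2) (simp add: abs_of_pos add_pos_nonneg)
qed simp

lemma integrable_window_cos_square: "integrable lborel (\<lambda>\<beta>. (1 + \<beta>\<^sup>2) * (window_cos \<beta>)\<^sup>2)"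
proof (rule Bochner_Integration.integrable_bound)
  show "integrable lborel (\<lambda>\<beta>. (6 * pi)\<^sup>2 * (1 / (1 + \<beta>\<^sup>2)))"
    by (intro integrable_mult_right integrable_inverse_1_plus_square_lborel)
  show "AE \<beta> in lborel. norm ((1 + \<beta>\<^sup>2) * (window_cos \<beta>)\<^sup>2) \<le> norm ((6 * pi)\<^sup>2 * (1 / (1 + \<beta>\<^sup>2)))"
  proof (rule AE_I2)
    fix \<beta> :: real
    have p: "1 + \<beta>\<^sup>2 > 0" by (simp add: add_pos_nonneg)
    have "(window_cos \<beta>)\<^sup>2 \<le> (6 * pi / (1 + \<beta>\<^sup>2))\<^sup>2"
      using power_mono[OF window_cos_decay[of \<beta>], of 2] by simp
    then have "(1 + \<beta>\<^sup>2) * (window_cos \<beta>)\<^sup>2 \<le> (1 + \<beta>\<^sup>2) * (6 * pi / (1 + \<beta>\<^sup>2))\<^sup>2"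
      using p by (intro mult_left_mono) auto
    also have "\<dots> = (6 * pi)\<^sup>2 * (1 / (1 + \<beta>\<^sup>2))"
      using p by (simp add: power_divide power2_eq_square[of "1 + \<beta>\<^sup>2"])
    finally show "norm ((1 + \<beta>\<^sup>2) * (window_cos \<beta>)\<^sup>2) \<le> norm ((6 * pi)\<^sup>2 * (1 / (1 + \<beta>\<^sup>2)))"
      using p by simp
  qed
qed simp

lemma integral_gaussian_cos:
  "(\<integral>\<beta>. exp (- (\<tau> - \<beta>)\<^sup>2 / 2) * cos (\<omega> * \<beta>) \<partial>lborel) = sqrt (2 * pi) * exp (- \<omega>\<^sup>2 / 2) * cos (\<omega> * \<tau>)"
proof -
  have i: "integrable lborel (\<lambda>s. complex_of_real (exp (- s\<^sup>2 / 2)) * cis (\<omega> * \<tau> + \<omega> * s))"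
    by (intro integrable_mult_cis) (use integrable_exp_square in simp_all)
  have "(\<integral>\<beta>. exp (- (\<tau> - \<beta>)\<^sup>2 / 2) * cos (\<omega> * \<beta>) \<partial>lborel) = (\<integral>s. exp (- s\<^sup>2 / 2) * cos (\<omega> * \<tau> + \<omega> * s) \<partial>lborel)"
    by (subst lborel_integral_real_affine[where c = 1 and t = \<tau>]) (simp_all add: distrib_left)
  also have "\<dots> = (\<integral>s. Re (complex_of_real (exp (- s\<^sup>2 / 2)) * cis (\<omega> * \<tau> + \<omega> * s)) \<partial>lborel)"
    by simp
  also have "\<dots> = Re (\<integral>s. complex_of_real (exp (- s\<^sup>2 / 2)) * cis (\<omega> * \<tau> + \<omega> * s) \<partial>lborel)"
    by (rule integral_Re[OF i])
  also have "(\<integral>s. complex_of_real (exp (- s\<^sup>2 / 2)) * cis (\<omega> * \<tau> + \<omega> * s) \<partial>lborel)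
    = (\<integral>s. cis (\<omega> * \<tau>) * (complex_of_real (exp (- s\<^sup>2 / 2)) * cis (\<omega> * s)) \<partial>lborel)"
    by (simp only: cis_mult[symmetric] mult_ac)
  also have "\<dots> = cis (\<omega> * \<tau>) * (\<integral>s. complex_of_real (exp (- s\<^sup>2 / 2)) * cis (\<omega> * s) \<partial>lborel)"
    by (rule integral_mult_right_zero)
  also have "Re \<dots> = sqrt (2 * pi) * exp (- \<omega>\<^sup>2 / 2) * cos (\<omega> * \<tau>)"
    unfolding fourier_exp_square by (simp add: mult_ac)
  finally show ?thesis .
qed

lemma integral_gaussian_inner_cos:
  fixes z :: "'a::euclidean_space"
  shows "(\<integral>\<xi>. exp (- (norm \<xi>)\<^sup>2 / 2) * cos (\<omega> * (\<xi> \<bullet> z)) \<partial>lborel) = sqrt (2 * pi) ^ DIM('a) * exp (- (norm (\<omega> *\<^sub>R z))\<^sup>2 / 2)"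
proof -
  have i: "integrable lborel (\<lambda>\<xi>::'a. complex_of_real (exp (- (norm \<xi>)\<^sup>2 / 2)) * cis ((\<omega> *\<^sub>R z) \<bullet> \<xi>))"
    by (intro integrable_mult_cis) (use integrable_exp_norm_square[where 'a='a] in simp_all)
  have "(\<integral>\<xi>. exp (- (norm \<xi>)\<^sup>2 / 2) * cos (\<omega> * (\<xi> \<bullet> z)) \<partial>lborel) = (\<integral>\<xi>. Re (complex_of_real (exp (- (norm \<xi>)\<^sup>2 / 2)) * cis ((\<omega> *\<^sub>R z) \<bullet> \<xi>)) \<partial>lborel)"
    by (simp add: inner_commute)
  also have "\<dots> = Re (\<integral>\<xi>. complex_of_real (exp (- (norm \<xi>)\<^sup>2 / 2)) * cis ((\<omega> *\<^sub>R z) \<bullet> \<xi>) \<partial>lborel)"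
    by (rule integral_Re[OF i])
  also have "\<dots> = sqrt (2 * pi) ^ DIM('a) * exp (- (norm (\<omega> *\<^sub>R z))\<^sup>2 / 2)"
    unfolding fourier_exp_norm_square by (simp only: Re_complex_of_real)
  finally show ?thesis .
qed

definition profile :: "'a::euclidean_space \<Rightarrow> real" where
  "profile z = (\<integral>\<omega>. window \<omega> * exp (- \<omega>\<^sup>2 / 2) * exp (- (norm (\<omega> *\<^sub>R z))\<^sup>2 / 2) \<partial>lborel)"

lemma integrable_profile:
  fixes z :: "'a::euclidean_space"
  shows "integrable lborel (\<lambda>\<omega>. window \<omega> * exp (- \<omega>\<^sup>2 / 2) * exp (- (norm (\<omega> *\<^sub>R z))\<^sup>2 / 2))"
  by (rule Bochner_Integration.integrable_bound[OF integrable_window])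
     (auto simp: abs_mult mult.assoc intro!: AE_I2 mult_left_le mult_le_one)

lemma profile_measurable [measurable]: "profile \<in> borel_measurable borel"
  unfolding profile_def[abs_def]
  by (rule lborel.borel_measurable_lebesgue_integral) measurable

lemma profile_nonneg: "0 \<le> profile z"
  unfolding profile_def by (intro integral_nonneg_AE AE_I2 mult_nonneg_nonneg window_nonneg) auto

lemma profile_0_pos: "0 < profile (0 :: 'a::euclidean_space)"
proof (rule ccontr)
  assume "\<not> 0 < profile (0 :: 'a)"
  then have "profile (0 :: 'a) = 0" using profile_nonneg[of "0::'a"] by linarith
  then have "AE \<omega> in lborel. window \<omega> * exp (- \<omega>\<^sup>2 / 2) * exp (- (norm (\<omega> *\<^sub>R (0::'a)))\<^sup>2 / 2) = 0"
    unfolding profile_def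
    by (subst (asm) integral_nonneg_eq_0_iff_AE[OF integrable_profile]) (auto simp: window_nonneg)
  then have "AE \<omega> in lborel. \<omega> \<notin> {5/2 * pi..3 * pi}"
  proof eventually_elim
    fix \<omega> assume "window \<omega> * exp (- \<omega>\<^sup>2 / 2) * exp (- (norm (\<omega> *\<^sub>R (0::'a)))\<^sup>2 / 2) = 0"
    then have w: "window \<omega> = 0" by simp
    show "\<omega> \<notin> {5/2 * pi..3 * pi}"
    proof
      assume a: "\<omega> \<in> {5/2 * pi..3 * pi}"
      then have "cos (\<omega> - 2 * pi) \<le> cos (pi / 2)"
        by (intro cos_monotone_0_pi_le) auto
      then have "cos \<omega> \<le> 0" by (simp add: cos_diff)
      moreover from a have "\<omega> \<in> {2 * pi..4 * pi}" by (auto intro: order_trans[of _ "5/2*pi"] order_trans[of _ "3*pi"])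
      ultimately show False using w by (simp add: window_def)
    qed
  qed
  then have "{5/2 * pi..3 * pi} \<in> null_sets lborel"
    using AE_iff_null_sets[of "{5/2 * pi..3 * pi}" lborel] by simp
  then have "emeasure lborel {5/2 * pi..3 * pi} = 0" by auto
  then show False using pi_gt_zero by (simp add: emeasure_lborel_Icc_eq ennreal_eq_0_iff)
qed

lemma profile_le:
  fixes z :: "'a::euclidean_space"
  shows "profile z \<le> profile (0::'a) * exp (- (norm z)\<^sup>2 / 2)"
proof -
  have "profile z \<le> (\<integral>\<omega>. window \<omega> * exp (- \<omega>\<^sup>2 / 2) * exp (- (norm (\<omega> *\<^sub>R (0::'a)))\<^sup>2 / 2) * exp (- (norm z)\<^sup>2 / 2) \<partial>lborel)"
    unfolding profile_def
  proof (rule integral_mono'[OF integrable_mult_left[OF integrable_profile]])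
    fix \<omega> :: real
    show "window \<omega> * exp (- \<omega>\<^sup>2 / 2) * exp (- (norm (\<omega> *\<^sub>R z))\<^sup>2 / 2) \<le> window \<omega> * exp (- \<omega>\<^sup>2 / 2) * exp (- (norm (\<omega> *\<^sub>R (0::'a)))\<^sup>2 / 2) * exp (- (norm z)\<^sup>2 / 2)"
    proof (cases "\<omega> \<in> {2 * pi..4 * pi}")
      case True
      then have "1 \<le> \<omega>" using pi_gt3 by auto
      then have "1 * norm z \<le> norm (\<omega> *\<^sub>R z)" unfolding norm_scaleR by (intro mult_right_mono) auto
      then have "(norm z)\<^sup>2 \<le> (norm (\<omega> *\<^sub>R z))\<^sup>2" by (intro power_mono) auto
      then show ?thesis using window_nonneg[of \<omega>] by (simp add: mult.assoc mult_left_mono)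
    qed (simp add: window_def)
  qed (auto intro!: mult_nonneg_nonneg window_nonneg)
  also have "\<dots> = profile (0::'a) * exp (- (norm z)\<^sup>2 / 2)"
    unfolding profile_def by (rule integral_mult_left_zero)
  finally show ?thesis .
qed

lemma integral_gaussian_window_cos:
  "(\<integral>\<beta>. exp (- (\<tau> - \<beta>)\<^sup>2 / 2) * window_cos \<beta> \<partial>lborel)
    = (\<integral>\<omega>. sqrt (2 * pi) * (window \<omega> * exp (- \<omega>\<^sup>2 / 2)) * cos (\<omega> * \<tau>) \<partial>lborel)"
proof -
  have i: "integrable lborel (\<lambda>\<beta>. exp (- (\<tau> - \<beta>)\<^sup>2 / 2))"
    using integrable_lborel_affine[OF integrable_exp_square, of "-1" \<tau>] by simp
  have "(\<integral>\<beta>. exp (- (\<tau> - \<beta>)\<^sup>2 / 2) * window_cos \<beta> \<partial>lborel)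
    = (\<integral>\<omega>. window \<omega> * (\<integral>\<beta>. exp (- (\<tau> - \<beta>)\<^sup>2 / 2) * cos (\<omega> * \<beta>) \<partial>lborel) \<partial>lborel)"
    unfolding window_cos_def by (rule Fubini_bounded_kernel[OF i integrable_window]) simp_all
  then show ?thesis
    unfolding integral_gaussian_cos by (simp only: mult_ac)
qed

lemma integral_ridge_synthesis:
  fixes z :: "'a::euclidean_space"
  shows "(\<integral>\<xi>. exp (- (norm \<xi>)\<^sup>2 / 2) * (\<integral>\<beta>. exp (- (\<xi> \<bullet> z - \<beta>)\<^sup>2 / 2) * window_cos \<beta> \<partial>lborel) \<partial>lborel)
    = sqrt (2 * pi) ^ Suc DIM('a) * profile z"
proof -
  let ?h = "\<lambda>\<omega>. sqrt (2 * pi) * (window \<omega> * exp (- \<omega>\<^sup>2 / 2))"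
  have "integrable lborel (\<lambda>\<omega>. window \<omega> * exp (- \<omega>\<^sup>2 / 2))"
    using integrable_profile[of "0::'a"] by simp
  then have ih: "integrable lborel ?h" by (rule integrable_mult_right)
  have "(\<integral>\<xi>. exp (- (norm \<xi>)\<^sup>2 / 2) * (\<integral>\<beta>. exp (- (\<xi> \<bullet> z - \<beta>)\<^sup>2 / 2) * window_cos \<beta> \<partial>lborel) \<partial>lborel)
    = (\<integral>\<omega>. ?h \<omega> * (\<integral>\<xi>. exp (- (norm \<xi>)\<^sup>2 / 2) * cos (\<omega> * (\<xi> \<bullet> z)) \<partial>lborel) \<partial>lborel)"
    unfolding integral_gaussian_window_cos
    by (rule Fubini_bounded_kernel[OF integrable_exp_norm_square ih]) simp_all
  also have "\<dots> = (\<integral>\<omega>. sqrt (2 * pi) ^ Suc DIM('a) * (window \<omega> * exp (- \<omega>\<^sup>2 / 2) * exp (- (norm (\<omega> *\<^sub>R z))\<^sup>2 / 2)) \<partial>lborel)"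
    unfolding integral_gaussian_inner_cos by (simp only: mult_ac power_Suc)
  also have "\<dots> = sqrt (2 * pi) ^ Suc DIM('a) * profile z"
    unfolding profile_def by (rule integral_mult_right_zero)
  finally show ?thesis .
qed

lemma
  fixes x :: "'a::euclidean_space" and F :: "'a \<times> real \<Rightarrow> real"
  assumes "h > 0" and [measurable]: "F \<in> borel_measurable (borel \<Otimes>\<^sub>M borel)"
    and i: "integrable (lborel \<Otimes>\<^sub>M lborel) (\<lambda>(\<xi>, \<beta>). F (\<xi>, \<xi> \<bullet> x + h * \<beta>))"
  shows integrable_shear: "integrable (lborel \<Otimes>\<^sub>M lborel) F"
    and integral_shear: "(\<integral>z. F z \<partial>(lborel \<Otimes>\<^sub>M lborel)) = h * (\<integral>(\<xi>, \<beta>). F (\<xi>, \<xi> \<bullet> x + h * \<beta>) \<partial>(lborel \<Otimes>\<^sub>M lborel))"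
proof -
  let ?P = "lborel \<Otimes>\<^sub>M lborel :: ('a \<times> real) measure"
  let ?T = "\<lambda>(\<xi>::'a, \<beta>::real). (\<xi>, \<xi> \<bullet> x + h * \<beta>)"
  have [measurable]: "?T \<in> ?P \<rightarrow>\<^sub>M borel \<Otimes>\<^sub>M borel" by measurable
  have eq: "?P = density (distr ?P (borel \<Otimes>\<^sub>M borel) ?T) (\<lambda>_. ennreal h)"
  proof (rule measure_eqI)
    fix A assume "A \<in> sets ?P"
    then have A [measurable]: "A \<in> sets (borel \<Otimes>\<^sub>M borel)" by (simp cong: sets_pair_measure_cong)
    have "emeasure (density (distr ?P (borel \<Otimes>\<^sub>M borel) ?T) (\<lambda>_. ennreal h)) A
      = (\<integral>\<^sup>+z. ennreal h * indicator A z \<partial>distr ?P (borel \<Otimes>\<^sub>M borel) ?T)"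
      by (rule emeasure_density) auto
    also have "\<dots> = (\<integral>\<^sup>+z. ennreal h * indicator A (?T z) \<partial>?P)"
      by (rule nn_integral_distr) auto
    also have "\<dots> = ennreal h * (\<integral>\<^sup>+z. indicator A (?T z) \<partial>?P)"
      by (rule nn_integral_cmult) measurable
    also have "\<dots> = ennreal h * (\<integral>\<^sup>+\<xi>. \<integral>\<^sup>+\<beta>. indicator A (\<xi>, \<xi> \<bullet> x + h * \<beta>) \<partial>lborel \<partial>lborel)"
      by (subst lborel.nn_integral_fst[symmetric]) auto
    also have "\<dots> = (\<integral>\<^sup>+\<xi>. ennreal h * (\<integral>\<^sup>+\<beta>. indicator A (\<xi>, \<xi> \<bullet> x + h * \<beta>) \<partial>lborel) \<partial>lborel)"
      by (rule nn_integral_cmult[symmetric]) measurable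
    also have "\<dots> = (\<integral>\<^sup>+\<xi>. \<integral>\<^sup>+s. indicator A (\<xi>, s) \<partial>lborel \<partial>lborel)"
    proof (rule nn_integral_cong)
      fix \<xi> :: 'a
      show "ennreal h * (\<integral>\<^sup>+\<beta>. indicator A (\<xi>, \<xi> \<bullet> x + h * \<beta>) \<partial>lborel) = (\<integral>\<^sup>+s. indicator A (\<xi>, s) \<partial>lborel)"
        using nn_integral_real_affine[of "\<lambda>s. indicator A (\<xi>, s)" h "\<xi> \<bullet> x"] \<open>h > 0\<close> by simp
    qed
    also have "\<dots> = emeasure ?P A"
      by (subst lborel.nn_integral_fst) auto
    finally show "emeasure ?P A = emeasure (density (distr ?P (borel \<Otimes>\<^sub>M borel) ?T) (\<lambda>_. ennreal h)) A" ..
  qed (simp cong: sets_pair_measure_cong)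
  have i': "integrable ?P (\<lambda>z. F (?T z))" using i by (simp add: case_prod_beta')
  have "integrable (density (distr ?P (borel \<Otimes>\<^sub>M borel) ?T) (\<lambda>_. ennreal h)) F"
    using \<open>h > 0\<close> i' by (subst integrable_density) (auto simp: integrable_distr_eq)
  then show "integrable ?P F" using eq by simp
  have "(\<integral>z. F z \<partial>?P) = (\<integral>z. F z \<partial>density (distr ?P (borel \<Otimes>\<^sub>M borel) ?T) (\<lambda>_. ennreal h))"
    using eq by simp
  also have "\<dots> = h * (\<integral>z. F (?T z) \<partial>?P)"
    using \<open>h > 0\<close> by (subst integral_density) (auto simp: integral_distr)
  finally show "(\<integral>z. F z \<partial>?P) = h * (\<integral>(\<xi>, \<beta>). F (\<xi>, \<xi> \<bullet> x + h * \<beta>) \<partial>?P)"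
    by (simp add: case_prod_beta')
qed

definition prior_weight :: "'a::euclidean_space \<times> real \<Rightarrow> real" where
  "prior_weight = (\<lambda>(\<xi>, s). exp (- (norm \<xi>)\<^sup>2 / 2) * (1 / (1 + s\<^sup>2)))"

definition ridge_atom :: "real \<Rightarrow> real \<Rightarrow> 'a::euclidean_space \<times> real \<Rightarrow> 'a \<Rightarrow> real" where
  "ridge_atom C h = (\<lambda>(\<xi>, s) y. C / (2 * sqrt (2 * pi)) * (h / (1 + (norm \<xi>)\<^sup>2)) * exp (- ((\<xi> \<bullet> y - s) / h)\<^sup>2 / 2))"

definition dual_const :: "'a::euclidean_space itself \<Rightarrow> real \<Rightarrow> real" where
  "dual_const _ C = C / (2 * sqrt (2 * pi)) * (sqrt (2 * pi) ^ Suc DIM('a) * profile (0::'a))"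

text \<open>The coefficient function that synthesises the bump around \<open>x\<close>: the factors \<open>1 + s\<^sup>2\<close> and \<open>1 + |\<xi>|\<^sup>2\<close>
  undo the prior density of the offset and the height of the ridge.\<close>

definition dual_weight :: "real \<Rightarrow> real \<Rightarrow> 'a::euclidean_space \<Rightarrow> 'a \<times> real \<Rightarrow> real" where
  "dual_weight C h x = (\<lambda>(\<xi>, s). window_cos ((s - \<xi> \<bullet> x) / h) * (1 + s\<^sup>2) * (1 + (norm \<xi>)\<^sup>2) / (dual_const TYPE('a) C * h\<^sup>2))"

lemma one_plus_square_pos: "1 + (r::real)\<^sup>2 > 0"
  by (simp add: add_pos_nonneg)

lemma dual_const_pos: "C > 0 \<Longrightarrow> dual_const TYPE('a::euclidean_space) C > 0"
  unfolding dual_const_def using profile_0_pos[where 'a='a] by simp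

lemma prior_weight_nonneg: "0 \<le> prior_weight \<theta>"
  by (auto simp: prior_weight_def split: prod.split)

lemma prior_weight_measurable [measurable]:
  "prior_weight \<in> borel_measurable (borel \<Otimes>\<^sub>M borel)"
  unfolding prior_weight_def case_prod_beta by measurable

lemma ridge_atom_measurable [measurable]:
  "(\<lambda>z. ridge_atom C h (fst z) (snd z)) \<in> borel_measurable ((borel \<Otimes>\<^sub>M borel) \<Otimes>\<^sub>M borel)"
  unfolding ridge_atom_def case_prod_beta by measurable

lemma dual_weight_measurable [measurable]:
  "dual_weight C h x \<in> borel_measurable (borel \<Otimes>\<^sub>M borel)"
  unfolding dual_weight_def case_prod_beta by measurable

lemma integrable_prior_weight: "integrable (lborel \<Otimes>\<^sub>M lborel) prior_weight"
  using integrable_times_bounded_kernel[OF integrable_exp_norm_square integrable_inverse_1_plus_square_lborel, of "\<lambda>_ _. 1"]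
  by (simp add: prior_weight_def)

lemma prior_mass_pos: "0 < (\<integral>\<theta>. prior_weight \<theta> \<partial>(lborel \<Otimes>\<^sub>M lborel :: ('a::euclidean_space \<times> real) measure))"
proof -
  let ?P = "lborel \<Otimes>\<^sub>M lborel :: ('a \<times> real) measure"
  have "(\<integral>\<theta>. prior_weight \<theta> \<partial>?P) \<noteq> 0"
  proof
    assume "(\<integral>\<theta>. prior_weight \<theta> \<partial>?P) = 0"
    then have "AE \<theta> in ?P. prior_weight \<theta> = 0"
      by (subst (asm) integral_nonneg_eq_0_iff_AE[OF integrable_prior_weight]) (auto simp: prior_weight_nonneg)
    then have "AE \<theta> in ?P. False"
      by eventually_elim (use one_plus_square_pos in \<open>auto simp: prior_weight_def less_imp_neq[THEN not_sym] split: prod.splits\<close>)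
    then have "AE \<theta> in (lborel :: ('a \<times> real) measure). \<theta> \<notin> UNIV"
      unfolding lborel_prod by eventually_elim simp
    then have "UNIV \<in> null_sets (lborel :: ('a \<times> real) measure)"
      by (rule AE_iff_null_sets[THEN iffD2, rotated]) simp
    then show False by (auto dest: null_setsD1)
  qed
  moreover have "(\<integral>\<theta>. prior_weight \<theta> \<partial>?P) \<ge> 0"
    by (intro integral_nonneg_AE AE_I2 prior_weight_nonneg)
  ultimately show ?thesis by linarith
qed

lemma ridge_atom_in_class:
  fixes \<xi> :: "'a::euclidean_space"
  assumes "C > 0" "h > 0" "\<xi> \<noteq> 0"
  shows "ridge_atom C h (\<xi>, s) \<in> RBV2_ball" "RTV2_ball (ridge_atom C h (\<xi>, s)) \<le> ereal C"
proof -
  let ?A = "C / (2 * sqrt (2 * pi)) * (h / (1 + (norm \<xi>)\<^sup>2))"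
  have eq: "ridge_atom C h (\<xi>, s) = (\<lambda>y. ?A * exp (- ((\<xi> /\<^sub>R h) \<bullet> y - s / h)\<^sup>2 / 2))"
  proof -
    have "(\<xi> /\<^sub>R h) \<bullet> y - s / h = (\<xi> \<bullet> y - s) / h" for y
      using assms by (simp add: field_simps)
    then show ?thesis unfolding ridge_atom_def case_prod_conv by simp
  qed
  have A: "0 \<le> ?A" using assms by (intro mult_nonneg_nonneg divide_nonneg_nonneg) auto
  have p: "0 < 1 + (norm \<xi>)\<^sup>2" by (rule one_plus_square_pos)
  have "0 \<le> (norm \<xi> - 1)\<^sup>2" by simp
  then have "norm \<xi> \<le> 1 + (norm \<xi>)\<^sup>2"
    by (simp add: power2_eq_square algebra_simps) (use norm_ge_zero[of \<xi>] in linarith)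
  then have "norm \<xi> / (1 + (norm \<xi>)\<^sup>2) \<le> 1" using p by simp
  then have "C * (norm \<xi> / (1 + (norm \<xi>)\<^sup>2)) \<le> C * 1" using assms by (intro mult_left_mono) auto
  moreover have "2 * sqrt (2 * pi) * ?A * norm (\<xi> /\<^sub>R h) = C * (norm \<xi> / (1 + (norm \<xi>)\<^sup>2))"
  proof -
    have alg: "2 * q * (C / (2 * q) * (h / a)) * (n / h) = C * (n / a)" if "q \<noteq> 0" "a \<noteq> 0" for q a n
      using that assms by (simp add: field_simps)
    have "norm (\<xi> /\<^sub>R h) = norm \<xi> / h" using assms by (simp add: divide_inverse_commute)
    then show ?thesis using alg[of "sqrt (2 * pi)" "1 + (norm \<xi>)\<^sup>2" "norm \<xi>"] p by (simp only:) simp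
  qed
  ultimately have le: "2 * sqrt (2 * pi) * ?A * norm (\<xi> /\<^sub>R h) \<le> C" by (simp only: mult_1_right)
  have ne: "\<xi> /\<^sub>R h \<noteq> 0" using assms by simp
  show "ridge_atom C h (\<xi>, s) \<in> RBV2_ball" "RTV2_ball (ridge_atom C h (\<xi>, s)) \<le> ereal C"
    unfolding eq using gaussian_ridge_in_class[OF ne A le] by auto
qed

lemma
  fixes x y :: "'a::euclidean_space"
  assumes "C > 0" "h > 0"
  shows integrable_dual_ridge_atom: "integrable (lborel \<Otimes>\<^sub>M lborel) (\<lambda>\<theta>. prior_weight \<theta> * (dual_weight C h x \<theta> * ridge_atom C h \<theta> y))"
    and integral_dual_ridge_atom: "(\<integral>\<theta>. prior_weight \<theta> * (dual_weight C h x \<theta> * ridge_atom C h \<theta> y) \<partial>(lborel \<Otimes>\<^sub>M lborel)) = profile ((y - x) /\<^sub>R h) / profile (0::'a)"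
proof -
  let ?P = "lborel \<Otimes>\<^sub>M lborel :: ('a \<times> real) measure"
  let ?z = "(y - x) /\<^sub>R h"
  let ?k = "sqrt (2 * pi) ^ Suc DIM('a) * profile (0::'a)"
  let ?F = "\<lambda>\<theta>. prior_weight \<theta> * (dual_weight C h x \<theta> * ridge_atom C h \<theta> y)"
  let ?S = "\<lambda>\<xi> \<beta>. exp (- (norm \<xi>)\<^sup>2 / 2) * (window_cos \<beta> * exp (- (\<xi> \<bullet> ?z - \<beta>)\<^sup>2 / 2))"
  have k: "?k > 0" using profile_0_pos[where 'a='a] by simp
  have F [measurable]: "?F \<in> borel_measurable (borel \<Otimes>\<^sub>M borel)"
    unfolding prior_weight_def dual_weight_def ridge_atom_def case_prod_beta by measurable
  have eq: "?F (\<xi>, \<xi> \<bullet> x + h * \<beta>) = 1 / (?k * h) * ?S \<xi> \<beta>" for \<xi> \<beta>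
  proof -
    let ?s = "\<xi> \<bullet> x + h * \<beta>"
    have e: "(\<xi> \<bullet> y - ?s) / h = \<xi> \<bullet> ?z - \<beta>" "(?s - \<xi> \<bullet> x) / h = \<beta>"
      using \<open>h > 0\<close> by (auto simp: field_simps inner_diff_right)
    have s: "1 + ?s\<^sup>2 \<noteq> 0" "1 + (norm \<xi>)\<^sup>2 \<noteq> 0" using one_plus_square_pos less_imp_neq by (metis)+
    have alg: "E * (1 / a) * (w * a * b / (c0 * k0 * h\<^sup>2) * (c0 * (h / b) * G)) = 1 / (k0 * h) * (E * (w * G))"
      if "a \<noteq> 0" "b \<noteq> 0" "c0 \<noteq> 0" "k0 \<noteq> 0" for E a w b c0 k0 G :: real
      using that \<open>h > 0\<close> by (simp add: field_simps power2_eq_square)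
    show ?thesis
      unfolding prior_weight_def dual_weight_def ridge_atom_def dual_const_def case_prod_conv e
      by (rule alg) (use s k assms in auto)
  qed
  have iS: "integrable ?P (\<lambda>(\<xi>, \<beta>). ?S \<xi> \<beta>)"
    by (rule integrable_times_bounded_kernel[OF integrable_exp_norm_square integrable_window_cos]) simp_all
  then have i: "integrable ?P (\<lambda>(\<xi>, \<beta>). ?F (\<xi>, \<xi> \<bullet> x + h * \<beta>))"
    unfolding eq case_prod_beta' by (rule integrable_mult_right)
  from integrable_shear[OF \<open>h > 0\<close> F i] show "integrable ?P ?F" .
  have "(\<integral>\<theta>. ?F \<theta> \<partial>?P) = h * (\<integral>(\<xi>, \<beta>). ?F (\<xi>, \<xi> \<bullet> x + h * \<beta>) \<partial>?P)"
    by (rule integral_shear[OF \<open>h > 0\<close> F i])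
  also have "(\<integral>(\<xi>, \<beta>). ?F (\<xi>, \<xi> \<bullet> x + h * \<beta>) \<partial>?P) = 1 / (?k * h) * (\<integral>(\<xi>, \<beta>). ?S \<xi> \<beta> \<partial>?P)"
    unfolding eq case_prod_beta' by (rule integral_mult_right_zero)
  also have "(\<integral>(\<xi>, \<beta>). ?S \<xi> \<beta> \<partial>?P) = (\<integral>\<xi>. \<integral>\<beta>. ?S \<xi> \<beta> \<partial>lborel \<partial>lborel)"
    by (rule lborel_pair.integral_fst[OF iS, symmetric])
  also have "\<dots> = sqrt (2 * pi) ^ Suc DIM('a) * profile ?z"
    unfolding integral_ridge_synthesis[symmetric] by (simp add: mult.commute[of "window_cos _"])
  also have "h * (1 / (?k * h) * (sqrt (2 * pi) ^ Suc DIM('a) * profile ?z)) = profile ?z / profile (0::'a)"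
    using k \<open>h > 0\<close> by (simp add: field_simps)
  finally show "(\<integral>\<theta>. ?F \<theta> \<partial>?P) = profile ?z / profile (0::'a)" .
qed

lemma integrable_gaussian_moment:
  "integrable lborel (\<lambda>\<xi>::'a::euclidean_space. exp (- (norm \<xi>)\<^sup>2 / 2) * (1 + (norm \<xi>)\<^sup>2) ^ 3)"
proof (rule Bochner_Integration.integrable_bound)
  show "integrable lborel (\<lambda>\<xi>::'a. 1728 * exp (- (norm ((1/2) *\<^sub>R \<xi>))\<^sup>2 / 2))"
    by (intro integrable_mult_right fourier_scaled_exp_norm_square(1)) simp
  show "AE \<xi>::'a in lborel. norm (exp (- (norm \<xi>)\<^sup>2 / 2) * (1 + (norm \<xi>)\<^sup>2) ^ 3) \<le> norm (1728 * exp (- (norm ((1/2) *\<^sub>R \<xi>))\<^sup>2 / 2))"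
  proof (rule AE_I2)
    fix \<xi> :: 'a
    define r where "r = (norm \<xi>)\<^sup>2"
    have r: "r \<ge> 0" by (simp add: r_def)
    have "1 + r \<le> 12 * (1 + r / 12)" using r by simp
    also have "\<dots> \<le> 12 * exp (r / 12)" by (intro mult_left_mono exp_ge_add_one_self) simp
    finally have "(1 + r) ^ 3 \<le> (12 * exp (r / 12)) ^ 3" using r by (intro power_mono) auto
    also have "\<dots> = 1728 * exp (r / 4)" by (simp add: power_mult_distrib flip: exp_of_nat_mult)
    finally have "exp (- r / 2) * (1 + r) ^ 3 \<le> exp (- r / 2) * (1728 * exp (r / 4))" by (intro mult_left_mono) auto
    also have "\<dots> = 1728 * exp (- r / 4)" by (simp add: exp_add[symmetric])
    also have "\<dots> \<le> 1728 * exp (- (r / 8))" using r by simp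
    also have "r / 8 = (norm ((1/2) *\<^sub>R \<xi>))\<^sup>2 / 2" by (simp add: r_def power_divide)
    finally show "norm (exp (- (norm \<xi>)\<^sup>2 / 2) * (1 + (norm \<xi>)\<^sup>2) ^ 3) \<le> norm (1728 * exp (- (norm ((1/2) *\<^sub>R \<xi>))\<^sup>2 / 2))"
      unfolding r_def[symmetric] using r by (simp add: abs_mult)
  qed
qed simp

definition dual_energy :: "'a::euclidean_space itself \<Rightarrow> real \<Rightarrow> real" where
  "dual_energy _ C = 2 / (dual_const TYPE('a) C)\<^sup>2 *
     ((\<integral>\<xi>. exp (- (norm (\<xi>::'a))\<^sup>2 / 2) * (1 + (norm \<xi>)\<^sup>2) ^ 3 \<partial>lborel) * (\<integral>\<beta>. (1 + \<beta>\<^sup>2) * (window_cos \<beta>)\<^sup>2 \<partial>lborel))"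

lemma
  fixes x :: "'a::euclidean_space"
  assumes "C > 0" "0 < h" "h \<le> 1" "norm x \<le> 1"
  shows integrable_dual_weight_square: "integrable (lborel \<Otimes>\<^sub>M lborel) (\<lambda>\<theta>. prior_weight \<theta> * (dual_weight C h x \<theta>)\<^sup>2)"
    and integral_dual_weight_square: "(\<integral>\<theta>. prior_weight \<theta> * (dual_weight C h x \<theta>)\<^sup>2 \<partial>(lborel \<Otimes>\<^sub>M lborel)) \<le> dual_energy TYPE('a) C / h ^ 3"
proof -
  let ?P = "lborel \<Otimes>\<^sub>M lborel :: ('a \<times> real) measure"
  let ?c = "dual_const TYPE('a) C"
  let ?F = "\<lambda>\<theta>. prior_weight \<theta> * (dual_weight C h x \<theta>)\<^sup>2"
  let ?f = "\<lambda>\<xi>::'a. exp (- (norm \<xi>)\<^sup>2 / 2) * (1 + (norm \<xi>)\<^sup>2) ^ 3"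
  let ?g = "\<lambda>\<beta>. (1 + \<beta>\<^sup>2) * (window_cos \<beta>)\<^sup>2"
  let ?k = "\<lambda>\<xi> \<beta>. (1 + (\<xi> \<bullet> x + h * \<beta>)\<^sup>2) / (2 * (1 + (norm \<xi>)\<^sup>2) * (1 + \<beta>\<^sup>2))"
  let ?S = "\<lambda>\<xi> \<beta>. ?f \<xi> * (?g \<beta> * ?k \<xi> \<beta>)"
  have c: "?c > 0" by (rule dual_const_pos[OF \<open>C > 0\<close>])
  have F [measurable]: "?F \<in> borel_measurable (borel \<Otimes>\<^sub>M borel)" by measurable
  have p: "1 + (r::real)\<^sup>2 \<noteq> 0" for r using one_plus_square_pos[of r] by simp
  have k0: "0 \<le> ?k \<xi> \<beta>" for \<xi> \<beta>
    by (intro divide_nonneg_nonneg mult_nonneg_nonneg add_nonneg_nonneg) auto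
  have k1: "?k \<xi> \<beta> \<le> 1" for \<xi> \<beta>
  proof -
    have "\<bar>\<xi> \<bullet> x\<bar> \<le> norm \<xi> * norm x" by (rule Cauchy_Schwarz_ineq2)
    also have "\<dots> \<le> norm \<xi>" using assms(4) by (simp add: mult_left_le)
    finally have 1: "(\<xi> \<bullet> x)\<^sup>2 \<le> (norm \<xi>)\<^sup>2" by (simp add: abs_le_square_iff[symmetric])
    have "\<bar>h * \<beta>\<bar> \<le> \<bar>\<beta>\<bar>" using assms by (simp add: abs_mult mult_left_le_one_le)
    then have 2: "(h * \<beta>)\<^sup>2 \<le> \<beta>\<^sup>2" by (simp add: abs_le_square_iff)
    have "0 \<le> (\<xi> \<bullet> x - h * \<beta>)\<^sup>2" by simp
    then have "(\<xi> \<bullet> x + h * \<beta>)\<^sup>2 \<le> 2 * (\<xi> \<bullet> x)\<^sup>2 + 2 * (h * \<beta>)\<^sup>2" by (simp add: power2_eq_square algebra_simps)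
    also have "\<dots> \<le> 2 * (norm \<xi>)\<^sup>2 + 2 * \<beta>\<^sup>2" using 1 2 by linarith
    finally have "1 + (\<xi> \<bullet> x + h * \<beta>)\<^sup>2 \<le> 2 + 2 * (norm \<xi>)\<^sup>2 + 2 * \<beta>\<^sup>2 + 2 * ((norm \<xi>)\<^sup>2 * \<beta>\<^sup>2)"
      using mult_nonneg_nonneg[OF zero_le_power2[of "norm \<xi>"] zero_le_power2[of \<beta>]] by linarith
    also have "\<dots> = 2 * (1 + (norm \<xi>)\<^sup>2) * (1 + \<beta>\<^sup>2)" by (simp add: algebra_simps)
    finally show ?thesis
      using one_plus_square_pos[of "norm \<xi>"] one_plus_square_pos[of \<beta>] by (subst divide_le_eq_1_pos) auto
  qed
  have eq: "?F (\<xi>, \<xi> \<bullet> x + h * \<beta>) = 2 / (?c * h\<^sup>2)\<^sup>2 * ?S \<xi> \<beta>" for \<xi> \<beta>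
  proof -
    have e: "(\<xi> \<bullet> x + h * \<beta> - \<xi> \<bullet> x) / h = \<beta>" using \<open>h > 0\<close> by simp
    have alg: "E * (1 / a) * (w * a * b / c)\<^sup>2 = 2 / c\<^sup>2 * (E * b ^ 3 * (q * w\<^sup>2 * (a / (2 * b * q))))"
      if "a \<noteq> 0" "b \<noteq> 0" "q \<noteq> 0" "c \<noteq> 0" for E a w b c q :: real
      using that by (simp add: field_simps power2_eq_square power3_eq_cube)
    show ?thesis
      unfolding prior_weight_def dual_weight_def case_prod_conv e
      by (rule alg) (use p c \<open>h > 0\<close> in auto)
  qed
  have iS: "integrable ?P (\<lambda>(\<xi>, \<beta>). ?S \<xi> \<beta>)"
    by (rule integrable_times_bounded_kernel[OF integrable_gaussian_moment integrable_window_cos_square])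
       (use k0 k1 in simp_all)
  then have i: "integrable ?P (\<lambda>(\<xi>, \<beta>). ?F (\<xi>, \<xi> \<bullet> x + h * \<beta>))"
    unfolding eq case_prod_beta' by (rule integrable_mult_right)
  from integrable_shear[OF \<open>h > 0\<close> F i] show "integrable ?P ?F" .
  have iS1: "integrable ?P (\<lambda>(\<xi>, \<beta>). ?f \<xi> * (?g \<beta> * 1))"
    by (rule integrable_times_bounded_kernel[OF integrable_gaussian_moment integrable_window_cos_square]) simp_all
  have "(\<integral>(\<xi>, \<beta>). ?S \<xi> \<beta> \<partial>?P) \<le> (\<integral>(\<xi>, \<beta>). ?f \<xi> * (?g \<beta> * 1) \<partial>?P)"
  proof (rule integral_mono[OF iS iS1])
    fix \<theta> :: "'a \<times> real"
    obtain \<xi> \<beta> where \<theta>: "\<theta> = (\<xi>, \<beta>)" by (cases \<theta>)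
    have "?S \<xi> \<beta> \<le> ?f \<xi> * (?g \<beta> * 1)"
      using k1[of \<xi> \<beta>] by (intro mult_left_mono) (auto intro!: mult_nonneg_nonneg add_nonneg_nonneg)
    then show "(case \<theta> of (\<xi>, \<beta>) \<Rightarrow> ?S \<xi> \<beta>) \<le> (case \<theta> of (\<xi>, \<beta>) \<Rightarrow> ?f \<xi> * (?g \<beta> * 1))"
      unfolding \<theta> case_prod_conv .
  qed
  also have "\<dots> = (\<integral>\<xi>. \<integral>\<beta>. ?f \<xi> * (?g \<beta> * 1) \<partial>lborel \<partial>lborel)"
    by (rule lborel_pair.integral_fst[OF iS1, symmetric])
  also have "\<dots> = (\<integral>\<xi>. ?f \<xi> \<partial>lborel) * (\<integral>\<beta>. ?g \<beta> \<partial>lborel)"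
    by simp
  finally have S: "(\<integral>(\<xi>, \<beta>). ?S \<xi> \<beta> \<partial>?P) \<le> (\<integral>\<xi>. ?f \<xi> \<partial>lborel) * (\<integral>\<beta>. ?g \<beta> \<partial>lborel)" .
  have "(\<integral>\<theta>. ?F \<theta> \<partial>?P) = h * (\<integral>(\<xi>, \<beta>). ?F (\<xi>, \<xi> \<bullet> x + h * \<beta>) \<partial>?P)"
    by (rule integral_shear[OF \<open>h > 0\<close> F i])
  also have "(\<integral>(\<xi>, \<beta>). ?F (\<xi>, \<xi> \<bullet> x + h * \<beta>) \<partial>?P) = 2 / (?c * h\<^sup>2)\<^sup>2 * (\<integral>(\<xi>, \<beta>). ?S \<xi> \<beta> \<partial>?P)"
    unfolding eq case_prod_beta' by (rule integral_mult_right_zero)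
  also have "h * (2 / (?c * h\<^sup>2)\<^sup>2 * (\<integral>(\<xi>, \<beta>). ?S \<xi> \<beta> \<partial>?P)) \<le> h * (2 / (?c * h\<^sup>2)\<^sup>2 * ((\<integral>\<xi>. ?f \<xi> \<partial>lborel) * (\<integral>\<beta>. ?g \<beta> \<partial>lborel)))"
    using \<open>h > 0\<close> by (intro mult_left_mono S) auto
  also have "\<dots> = dual_energy TYPE('a) C / h ^ 3"
  proof -
    have alg: "h * (2 / (c * h\<^sup>2)\<^sup>2 * I) = 2 / c\<^sup>2 * I / h ^ 3" if "c \<noteq> 0" for c I :: real
      using that \<open>h > 0\<close> by (simp add: field_simps power2_eq_square power3_eq_cube)
    show ?thesis unfolding dual_energy_def by (rule alg) (use c in simp)
  qed
  finally show "(\<integral>\<theta>. ?F \<theta> \<partial>?P) \<le> dual_energy TYPE('a) C / h ^ 3" .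
qed

section \<open>Bayes lower bound for linear estimators\<close>

lemma sets_gauss [measurable_cong, simp]: "sets (gauss \<sigma>) = sets borel"
  by (simp add: gauss_def)

lemma space_gauss [simp]: "space (gauss \<sigma>) = UNIV"
  by (simp add: gauss_def)

lemma prob_space_gauss: "\<sigma> > 0 \<Longrightarrow> prob_space (gauss \<sigma>)"
  unfolding gauss_def by (rule prob_space_normal_density)

lemma nn_integral_gauss_square:
  assumes "\<sigma> > 0"
  shows "(\<integral>\<^sup>+y. ennreal ((c - y * w)\<^sup>2) \<partial>gauss \<sigma>) = ennreal (c\<^sup>2 + \<sigma>\<^sup>2 * w\<^sup>2)"
proof -
  let ?d = "normal_density 0 \<sigma>"
  have h0: "has_bochner_integral lborel (\<lambda>y. c\<^sup>2 * ?d y) (c\<^sup>2 * 1)"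
    using normal_moment_even[OF assms, of 0 0] by (intro has_bochner_integral_mult_right) simp
  have h1: "has_bochner_integral lborel (\<lambda>y. 2 * c * w * (?d y * y)) (2 * c * w * 0)"
    using normal_moment_odd[OF assms, of 0 0] by (intro has_bochner_integral_mult_right) simp
  have h2: "has_bochner_integral lborel (\<lambda>y. w\<^sup>2 * (?d y * y\<^sup>2)) (w\<^sup>2 * \<sigma>\<^sup>2)"
    using normal_moment_even[OF assms, of 0 1] by (intro has_bochner_integral_mult_right) (simp add: fact_numeral)
  have "has_bochner_integral lborel (\<lambda>y. c\<^sup>2 * ?d y - 2 * c * w * (?d y * y) + w\<^sup>2 * (?d y * y\<^sup>2)) (c\<^sup>2 * 1 - 2 * c * w * 0 + w\<^sup>2 * \<sigma>\<^sup>2)"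
    by (intro has_bochner_integral_add has_bochner_integral_diff h0 h1 h2)
  then have h: "has_bochner_integral lborel (\<lambda>y. ?d y * (c - y * w)\<^sup>2) (c\<^sup>2 + \<sigma>\<^sup>2 * w\<^sup>2)"
    by (simp add: power2_eq_square algebra_simps)
  have "(\<integral>\<^sup>+y. ennreal ((c - y * w)\<^sup>2) \<partial>gauss \<sigma>) = (\<integral>\<^sup>+y. ennreal (?d y) * ennreal ((c - y * w)\<^sup>2) \<partial>lborel)"
    unfolding gauss_def by (rule nn_integral_density) measurable
  also have "\<dots> = (\<integral>\<^sup>+y. ennreal (?d y * (c - y * w)\<^sup>2) \<partial>lborel)"
    by (simp add: ennreal_mult')
  also have "\<dots> = ennreal (c\<^sup>2 + \<sigma>\<^sup>2 * w\<^sup>2)"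
    using h by (subst nn_integral_eq_integral) (auto simp: has_bochner_integral_iff)
  finally show ?thesis .
qed

lemma nn_integral_PiM_gauss_square:
  fixes N :: nat
  assumes "\<sigma> > 0"
  shows "(\<integral>\<^sup>+e. ennreal ((c - (\<Sum>n<N. e n * w n))\<^sup>2) \<partial>PiM {..<N} (\<lambda>_. gauss \<sigma>)) = ennreal (c\<^sup>2 + \<sigma>\<^sup>2 * (\<Sum>n<N. (w n)\<^sup>2))"
proof (induction N)
  case 0
  show ?case by (simp add: space_PiM nn_integral_empty)
next
  case (Suc N)
  interpret g: prob_space "gauss \<sigma>" by (rule prob_space_gauss[OF assms])
  interpret product_sigma_finite "\<lambda>_::nat. gauss \<sigma>" by standard
  interpret P: prob_space "PiM {..<N} (\<lambda>_. gauss \<sigma>)" by (rule prob_space_PiM) (rule prob_space_gauss[OF assms])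
  have "(\<integral>\<^sup>+e. ennreal ((c - (\<Sum>n<Suc N. e n * w n))\<^sup>2) \<partial>PiM {..<Suc N} (\<lambda>_. gauss \<sigma>))
    = (\<integral>\<^sup>+e. \<integral>\<^sup>+y. ennreal ((c - (\<Sum>n<Suc N. (e(N := y)) n * w n))\<^sup>2) \<partial>gauss \<sigma> \<partial>PiM {..<N} (\<lambda>_. gauss \<sigma>))"
    unfolding lessThan_Suc
    by (rule product_nn_integral_insert) (simp, simp, measurable)
  also have "\<dots> = (\<integral>\<^sup>+e. \<integral>\<^sup>+y. ennreal (((c - (\<Sum>n<N. e n * w n)) - y * w N)\<^sup>2) \<partial>gauss \<sigma> \<partial>PiM {..<N} (\<lambda>_. gauss \<sigma>))"
    by (simp add: algebra_simps)
  also have "\<dots> = (\<integral>\<^sup>+e. ennreal ((c - (\<Sum>n<N. e n * w n))\<^sup>2) + ennreal (\<sigma>\<^sup>2 * (w N)\<^sup>2) \<partial>PiM {..<N} (\<lambda>_. gauss \<sigma>))"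
    unfolding nn_integral_gauss_square[OF assms] by (simp add: ennreal_plus)
  also have "\<dots> = ennreal (c\<^sup>2 + \<sigma>\<^sup>2 * (\<Sum>n<N. (w n)\<^sup>2)) + ennreal (\<sigma>\<^sup>2 * (w N)\<^sup>2)"
    by (subst nn_integral_add) (auto simp: Suc.IH P.emeasure_space_1)
  also have "\<dots> = ennreal (c\<^sup>2 + \<sigma>\<^sup>2 * (\<Sum>n<Suc N. (w n)\<^sup>2))"
    by (subst ennreal_plus[symmetric]) (auto simp: algebra_simps intro!: add_nonneg_nonneg mult_nonneg_nonneg sum_nonneg)
  finally show ?case .
qed

lemma ennreal_integral_le_nn_integral:
  fixes g :: "'b \<Rightarrow> real"
  assumes "integrable M g"
  shows "ennreal (\<integral>x. g x \<partial>M) \<le> (\<integral>\<^sup>+x. ennreal (g x) \<partial>M)"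
proof -
  have i: "integrable M (\<lambda>x. max 0 (g x))" using assms by (intro integrable_max) auto
  have "ennreal (\<integral>x. g x \<partial>M) \<le> ennreal (\<integral>x. max 0 (g x) \<partial>M)"
    using assms i by (intro ennreal_leI integral_mono) auto
  also have "\<dots> = (\<integral>\<^sup>+x. ennreal (max 0 (g x)) \<partial>M)"
    by (rule nn_integral_eq_integral[OF i, symmetric]) simp
  also have "\<dots> = (\<integral>\<^sup>+x. ennreal (g x) \<partial>M)"
    by (intro nn_integral_cong) (auto simp: max_def ennreal_neg)
  finally show ?thesis .
qed

lemma sets_unif_ball [measurable_cong, simp]: "sets unif_ball = sets borel"
  by (simp add: unif_ball_def)

lemma space_unif_ball [simp]: "space unif_ball = UNIV"
  by (simp add: unif_ball_def)

lemma emeasure_cball_1: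
  "emeasure lborel (cball (0::'a::euclidean_space) 1) = ennreal (measure lborel (cball (0::'a) 1))"
  "measure lborel (cball (0::'a) 1) > 0"
proof -
  show "emeasure lborel (cball (0::'a) 1) = ennreal (measure lborel (cball (0::'a) 1))"
    using emeasure_lborel_cball_finite[of "0::'a" 1] by (intro emeasure_eq_ennreal_measure) auto
  show "measure lborel (cball (0::'a) 1) > 0"
    using content_cball_pos[of 1 "0::'a"] by simp
qed

lemma prob_space_unif_ball: "prob_space (unif_ball :: 'a::euclidean_space measure)"
  unfolding unif_ball_def
  using emeasure_cball_1[where 'a='a] by (intro prob_space_uniform_measure) auto

lemma AE_unif_ball: "AE x in (unif_ball :: 'a::euclidean_space measure). norm x \<le> 1"
  unfolding unif_ball_def by (rule AE_uniform_measureI) (auto simp: dist_norm)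

text \<open>Both the bias and the noise term are bounded below by tangents, \<open>l\<^sup>2 \<ge> 2 \<mu> a l - \<mu>\<^sup>2 a\<^sup>2\<close> with \<open>a\<close> the
  dual weight; the terms linear in \<open>w\<close> are absorbed by the noise variance.\<close>

lemma bayes_dual_lower_bound:
  fixes x :: "'a::euclidean_space" and X :: "nat \<Rightarrow> 'a" and w :: "nat \<Rightarrow> real"
  assumes "C > 0" "0 < h" "h \<le> 1" "\<sigma> > 0" "norm x \<le> 1"
  defines "M \<equiv> (\<integral>\<theta>. prior_weight \<theta> \<partial>(lborel \<Otimes>\<^sub>M lborel :: ('a \<times> real) measure))"
  shows "ennreal (2 * \<mu> - \<mu>\<^sup>2 * (dual_energy TYPE('a) C / h ^ 3 + (\<Sum>n<N. (profile ((X n - x) /\<^sub>R h) / profile (0::'a))\<^sup>2) / (M * \<sigma>\<^sup>2)))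
    \<le> (\<integral>\<^sup>+\<theta>. ennreal (prior_weight \<theta> * ((ridge_atom C h \<theta> x - (\<Sum>n<N. ridge_atom C h \<theta> (X n) * w n))\<^sup>2 + \<sigma>\<^sup>2 * (\<Sum>n<N. (w n)\<^sup>2))) \<partial>(lborel \<Otimes>\<^sub>M lborel))"
proof -
  let ?P = "lborel \<Otimes>\<^sub>M lborel :: ('a \<times> real) measure"
  let ?v = "prior_weight :: 'a \<times> real \<Rightarrow> real"
  let ?a = "dual_weight C h x"
  let ?f = "ridge_atom C h"
  let ?l = "\<lambda>\<theta>. ?f \<theta> x - (\<Sum>n<N. ?f \<theta> (X n) * w n)"
  let ?u = "\<lambda>n. profile ((X n - x) /\<^sub>R h) / profile (0::'a)"
  let ?V = "\<sigma>\<^sup>2 * (\<Sum>n<N. (w n)\<^sup>2)"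
  let ?g = "\<lambda>\<theta>. 2 * \<mu> * (?v \<theta> * (?a \<theta> * ?f \<theta> x)) - (\<Sum>n<N. 2 * \<mu> * w n * (?v \<theta> * (?a \<theta> * ?f \<theta> (X n)))) - \<mu>\<^sup>2 * (?v \<theta> * (?a \<theta>)\<^sup>2) + ?V * ?v \<theta>"
  have M: "M > 0" unfolding M_def by (rule prior_mass_pos)
  note i1 = integrable_dual_ridge_atom[OF assms(1,2)] and e1 = integral_dual_ridge_atom[OF assms(1,2)]
  note i2 = integrable_dual_weight_square[OF assms(1,2,3,5)] and e2 = integral_dual_weight_square[OF assms(1,2,3,5)]
  have ig: "integrable ?P ?g"
    by (intro Bochner_Integration.integrable_add Bochner_Integration.integrable_diff Bochner_Integration.integrable_sum integrable_mult_right i1 i2 integrable_prior_weight)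
  have "(\<integral>\<theta>. ?g \<theta> \<partial>?P) = 2 * \<mu> * (\<integral>\<theta>. ?v \<theta> * (?a \<theta> * ?f \<theta> x) \<partial>?P) - (\<Sum>n<N. 2 * \<mu> * w n * (\<integral>\<theta>. ?v \<theta> * (?a \<theta> * ?f \<theta> (X n)) \<partial>?P)) - \<mu>\<^sup>2 * (\<integral>\<theta>. ?v \<theta> * (?a \<theta>)\<^sup>2 \<partial>?P) + ?V * M"
    unfolding M_def
    by (subst Bochner_Integration.integral_add Bochner_Integration.integral_diff Bochner_Integration.integral_sum integral_mult_right_zero
      | intro Bochner_Integration.integrable_add Bochner_Integration.integrable_diff Bochner_Integration.integrable_sum integrable_mult_right i1 i2 integrable_prior_weight
      | rule refl)+
  also have "\<dots> = 2 * \<mu> - (\<Sum>n<N. 2 * \<mu> * w n * ?u n) - \<mu>\<^sup>2 * (\<integral>\<theta>. ?v \<theta> * (?a \<theta>)\<^sup>2 \<partial>?P) + ?V * M"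
    unfolding e1 using profile_0_pos[where 'a='a] by simp
  finally have eg: "(\<integral>\<theta>. ?g \<theta> \<partial>?P) = 2 * \<mu> - (\<Sum>n<N. 2 * \<mu> * w n * ?u n) - \<mu>\<^sup>2 * (\<integral>\<theta>. ?v \<theta> * (?a \<theta>)\<^sup>2 \<partial>?P) + ?V * M" .
  have "\<mu>\<^sup>2 * (\<integral>\<theta>. ?v \<theta> * (?a \<theta>)\<^sup>2 \<partial>?P) \<le> \<mu>\<^sup>2 * (dual_energy TYPE('a) C / h ^ 3)"
    by (intro mult_left_mono e2) simp
  moreover have "(\<Sum>n<N. 2 * \<mu> * w n * ?u n) - ?V * M \<le> \<mu>\<^sup>2 * ((\<Sum>n<N. (?u n)\<^sup>2) / (M * \<sigma>\<^sup>2))"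
  proof -
    have q: "M * \<sigma>\<^sup>2 > 0" using M assms(4) by simp
    have "2 * \<mu> * p * r - (M * \<sigma>\<^sup>2) * p\<^sup>2 \<le> \<mu>\<^sup>2 * r\<^sup>2 / (M * \<sigma>\<^sup>2)" for p r :: real
    proof -
      have "0 \<le> (\<mu> * r - (M * \<sigma>\<^sup>2) * p)\<^sup>2" by simp
      then have "(2 * \<mu> * p * r - (M * \<sigma>\<^sup>2) * p\<^sup>2) * (M * \<sigma>\<^sup>2) \<le> \<mu>\<^sup>2 * r\<^sup>2"
        by (simp add: power2_eq_square algebra_simps)
      then show ?thesis using q by (simp add: pos_le_divide_eq)
    qed
    then have "(\<Sum>n<N. 2 * \<mu> * w n * ?u n - (M * \<sigma>\<^sup>2) * (w n)\<^sup>2) \<le> (\<Sum>n<N. \<mu>\<^sup>2 * (?u n)\<^sup>2 / (M * \<sigma>\<^sup>2))"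
      by (intro sum_mono)
    then show ?thesis
      by (simp add: sum_subtractf sum_distrib_left sum_divide_distrib mult_ac)
  qed
  ultimately have "2 * \<mu> - \<mu>\<^sup>2 * (dual_energy TYPE('a) C / h ^ 3 + (\<Sum>n<N. (?u n)\<^sup>2) / (M * \<sigma>\<^sup>2)) \<le> (\<integral>\<theta>. ?g \<theta> \<partial>?P)"
    unfolding eg distrib_left by linarith
  then have "ennreal (2 * \<mu> - \<mu>\<^sup>2 * (dual_energy TYPE('a) C / h ^ 3 + (\<Sum>n<N. (?u n)\<^sup>2) / (M * \<sigma>\<^sup>2))) \<le> ennreal (\<integral>\<theta>. ?g \<theta> \<partial>?P)"
    by (rule ennreal_leI)
  also have "\<dots> \<le> (\<integral>\<^sup>+\<theta>. ennreal (?g \<theta>) \<partial>?P)"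
    by (rule ennreal_integral_le_nn_integral[OF ig])
  also have "\<dots> \<le> (\<integral>\<^sup>+\<theta>. ennreal (?v \<theta> * ((?l \<theta>)\<^sup>2 + ?V)) \<partial>?P)"
  proof (intro nn_integral_mono ennreal_leI)
    fix \<theta>
    have "?g \<theta> = ?v \<theta> * (2 * \<mu> * ?a \<theta> * ?l \<theta> - \<mu>\<^sup>2 * (?a \<theta>)\<^sup>2 + ?V)"
      by (simp add: right_diff_distrib distrib_left sum_distrib_left mult_ac)
    also have "\<dots> \<le> ?v \<theta> * ((?l \<theta>)\<^sup>2 + ?V)"
    proof (rule mult_left_mono[OF _ prior_weight_nonneg])
      have "0 \<le> (?l \<theta> - \<mu> * ?a \<theta>)\<^sup>2" by simp
      also have "\<dots> = (?l \<theta>)\<^sup>2 - (2 * \<mu> * ?a \<theta> * ?l \<theta> - \<mu>\<^sup>2 * (?a \<theta>)\<^sup>2)"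
        unfolding power2_diff power_mult_distrib by (simp only: mult_ac)
      finally show "2 * \<mu> * ?a \<theta> * ?l \<theta> - \<mu>\<^sup>2 * (?a \<theta>)\<^sup>2 + ?V \<le> (?l \<theta>)\<^sup>2 + ?V" by simp
    qed
    finally show "?g \<theta> \<le> ?v \<theta> * ((?l \<theta>)\<^sup>2 + ?V)" .
  qed
  finally show ?thesis .
qed

lemma lin_risk_eq:
  fixes f :: "'a::euclidean_space \<Rightarrow> real"
  assumes "\<sigma> > 0" and w: "w \<in> linear_estimators N" and [measurable]: "f \<in> borel_measurable borel"
  shows "lin_risk N \<sigma> f w = (\<integral>\<^sup>+X. \<integral>\<^sup>+x. ennreal ((f x - (\<Sum>n<N. f (X n) * w X n x))\<^sup>2 + \<sigma>\<^sup>2 * (\<Sum>n<N. (w X n x)\<^sup>2)) \<partial>unif_ball \<partial>PiM {..<N} (\<lambda>_. unif_ball))"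
  unfolding lin_risk_def
proof (rule nn_integral_cong)
  fix X assume X: "X \<in> space (PiM {..<N} (\<lambda>_. unif_ball :: 'a measure))"
  let ?G = "PiM {..<N} (\<lambda>_. gauss \<sigma>)"
  interpret U: prob_space "unif_ball :: 'a measure" by (rule prob_space_unif_ball)
  interpret G: prob_space ?G by (rule prob_space_PiM) (rule prob_space_gauss[OF assms(1)])
  interpret pair_sigma_finite ?G "unif_ball :: 'a measure" ..
  have wm [measurable]: "w X n \<in> borel_measurable borel" if "n < N" for n
  proof -
    have "(\<lambda>(X, x). w X n x) \<in> borel_measurable (PiM {..<N} (\<lambda>_. unif_ball) \<Otimes>\<^sub>M unif_ball)"
      using w that by (simp add: linear_estimators_def)
    from measurable_Pair2[OF this X] show ?thesis by simp
  qed
  have [measurable]: "(\<lambda>(e, x). ennreal ((f x - (\<Sum>n<N. (f (X n) + e n) * w X n x))\<^sup>2)) \<in> borel_measurable (?G \<Otimes>\<^sub>M unif_ball)"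
    unfolding case_prod_beta by measurable
  have "(\<integral>\<^sup>+e. \<integral>\<^sup>+x. ennreal ((f x - (\<Sum>n<N. (f (X n) + e n) * w X n x))\<^sup>2) \<partial>unif_ball \<partial>?G)
    = (\<integral>\<^sup>+x. \<integral>\<^sup>+e. ennreal ((f x - (\<Sum>n<N. (f (X n) + e n) * w X n x))\<^sup>2) \<partial>?G \<partial>unif_ball)"
    by (rule Fubini'[symmetric]) measurable
  also have "\<dots> = (\<integral>\<^sup>+x. \<integral>\<^sup>+e. ennreal (((f x - (\<Sum>n<N. f (X n) * w X n x)) - (\<Sum>n<N. e n * w X n x))\<^sup>2) \<partial>?G \<partial>unif_ball)"
    by (simp add: distrib_right sum.distrib diff_diff_eq)
  finally show "(\<integral>\<^sup>+e. \<integral>\<^sup>+x. ennreal ((f x - (\<Sum>n<N. (f (X n) + e n) * w X n x))\<^sup>2) \<partial>unif_ball \<partial>?G)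
    = (\<integral>\<^sup>+x. ennreal ((f x - (\<Sum>n<N. f (X n) * w X n x))\<^sup>2 + \<sigma>\<^sup>2 * (\<Sum>n<N. (w X n x)\<^sup>2)) \<partial>unif_ball)"
    unfolding nn_integral_PiM_gauss_square[OF assms(1)] .
qed

lemma profile_ratio_bounds:
  fixes z :: "'a::euclidean_space"
  shows "0 \<le> profile z / profile (0::'a)" "profile z / profile (0::'a) \<le> exp (- (norm z)\<^sup>2 / 2)"
  using profile_nonneg[of z] profile_le[of z] profile_0_pos[where 'a='a] by (auto simp: pos_divide_le_eq mult.commute)

lemma
  fixes y :: "'a::euclidean_space"
  assumes "h > 0"
  shows integrable_profile_square: "integrable unif_ball (\<lambda>x. (profile ((y - x) /\<^sub>R h) / profile (0::'a))\<^sup>2)"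
    and integral_profile_square: "(\<integral>x. (profile ((y - x) /\<^sub>R h) / profile (0::'a))\<^sup>2 \<partial>unif_ball) \<le> sqrt (2 * pi) ^ DIM('a) / measure lborel (cball (0::'a) 1) * h ^ DIM('a)"
proof -
  interpret U: prob_space "unif_ball :: 'a measure" by (rule prob_space_unif_ball)
  let ?u = "\<lambda>x. (profile ((y - x) /\<^sub>R h) / profile (0::'a))\<^sup>2"
  let ?e = "\<lambda>x. exp (- (norm ((y - x) /\<^sub>R h))\<^sup>2 / 2)"
  let ?m = "measure lborel (cball (0::'a) 1)"
  have le: "?u x \<le> ?e x" for x
  proof -
    have "?u x \<le> (?e x)\<^sup>2" using profile_ratio_bounds[of "(y - x) /\<^sub>R h"] by (intro power_mono) auto
    also have "\<dots> \<le> ?e x" by (simp add: power2_eq_square mult_left_le)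
    finally show ?thesis .
  qed
  have le1: "?u x \<le> 1" for x using le[of x] by (rule order_trans) simp
  show "integrable unif_ball ?u"
    by (rule U.integrable_const_bound[of _ 1]) (use le1 in auto)
  have ie: "integrable lborel ?e"
  proof -
    have c: "- inverse h \<noteq> 0" using assms by simp
    have e: "y /\<^sub>R h + (- inverse h) *\<^sub>R x = (y - x) /\<^sub>R h" for x by (simp add: scaleR_diff_right)
    show ?thesis
      using integrable_lborel_affine[OF integrable_exp_norm_square c, of "y /\<^sub>R h"] unfolding e .
  qed
  have "(\<integral>x. ?e x \<partial>lborel) = \<bar>- h\<bar> ^ DIM('a) *\<^sub>R (\<integral>z. ?e (y + (- h) *\<^sub>R z) \<partial>lborel)"
    using assms by (intro lborel_integral_affine) auto
  also have "\<dots> = h ^ DIM('a) * sqrt (2 * pi) ^ DIM('a)"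
    using assms by (simp add: integral_exp_norm_square[simplified])
  finally have ev: "(\<integral>x. ?e x \<partial>lborel) = h ^ DIM('a) * sqrt (2 * pi) ^ DIM('a)" .
  have "(\<integral>\<^sup>+x. ennreal (?u x) \<partial>unif_ball) = (\<integral>\<^sup>+x. ennreal (?u x) * indicator (cball 0 1) x \<partial>lborel) / ennreal ?m"
    unfolding unif_ball_def emeasure_cball_1(1)[symmetric]
    by (subst nn_integral_uniform_measure) (use emeasure_cball_1[where 'a='a] in auto)
  also have "\<dots> \<le> (\<integral>\<^sup>+x. ennreal (?e x) \<partial>lborel) / ennreal ?m"
    using le by (intro divide_right_mono_ennreal nn_integral_mono) (auto simp: indicator_def intro!: ennreal_leI)
  also have "\<dots> = ennreal (h ^ DIM('a) * sqrt (2 * pi) ^ DIM('a)) / ennreal ?m"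
    by (subst nn_integral_eq_integral[OF ie]) (simp_all add: ev[simplified])
  also have "\<dots> = ennreal (sqrt (2 * pi) ^ DIM('a) / ?m * h ^ DIM('a))"
    using assms emeasure_cball_1(2)[where 'a='a] by (subst divide_ennreal) (auto simp: mult.commute)
  finally have "(\<integral>\<^sup>+x. ennreal (?u x) \<partial>unif_ball) \<le> ennreal (sqrt (2 * pi) ^ DIM('a) / ?m * h ^ DIM('a))" .
  then show "(\<integral>x. ?u x \<partial>unif_ball) \<le> sqrt (2 * pi) ^ DIM('a) / ?m * h ^ DIM('a)"
    using assms emeasure_cball_1(2)[where 'a='a]
    by (subst integral_eq_nn_integral) (auto intro!: enn2real_leI)
qed

lemma lin_risk_sup_lower_bound:
  fixes w :: "(nat \<Rightarrow> 'a::euclidean_space) \<Rightarrow> nat \<Rightarrow> 'a \<Rightarrow> real"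
  assumes "C > 0" "0 < h" "h \<le> 1" "\<sigma> > 0" and w: "w \<in> linear_estimators N"
  defines "M \<equiv> (\<integral>\<theta>. prior_weight \<theta> \<partial>(lborel \<Otimes>\<^sub>M lborel :: ('a \<times> real) measure))"
    and "S \<equiv> (SUP f \<in> {f :: 'a \<Rightarrow> real. f \<in> RBV2_ball \<and> RTV2_ball f \<le> ereal C}. lin_risk N \<sigma> f w)"
  shows "ennreal (2 * \<mu> - \<mu>\<^sup>2 * (dual_energy TYPE('a) C / h ^ 3 +
      real N * (sqrt (2 * pi) ^ DIM('a) / measure lborel (cball (0::'a) 1) * h ^ DIM('a)) / (M * \<sigma>\<^sup>2))) \<le> ennreal M * S"
proof -
  let ?P = "lborel \<Otimes>\<^sub>M lborel :: ('a \<times> real) measure"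
  let ?v = "prior_weight :: 'a \<times> real \<Rightarrow> real"
  let ?f = "ridge_atom C h :: 'a \<times> real \<Rightarrow> 'a \<Rightarrow> real"
  let ?D = "PiM {..<N} (\<lambda>_. unif_ball :: 'a measure)"
  let ?R = "\<lambda>\<theta> X x. (?f \<theta> x - (\<Sum>n<N. ?f \<theta> (X n) * w X n x))\<^sup>2 + \<sigma>\<^sup>2 * (\<Sum>n<N. (w X n x)\<^sup>2)"
  let ?K = "sqrt (2 * pi) ^ DIM('a) / measure lborel (cball (0::'a) 1) * h ^ DIM('a)"
  let ?E = "dual_energy TYPE('a) C / h ^ 3"
  let ?u = "\<lambda>y x. (profile ((y - x) /\<^sub>R h) / profile (0::'a))\<^sup>2"
  interpret U: prob_space "unif_ball :: 'a measure" by (rule prob_space_unif_ball)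
  interpret D: prob_space ?D by (rule prob_space_PiM) (rule prob_space_unif_ball)
  interpret DU: pair_sigma_finite ?D "unif_ball :: 'a measure" ..
  interpret PDU: pair_sigma_finite ?P "?D \<Otimes>\<^sub>M (unif_ball :: 'a measure)"
    by (intro pair_sigma_finite.intro lborel_pair.sigma_finite_measure_axioms DU.sigma_finite_measure_axioms)
  have M: "M > 0" unfolding M_def by (rule prior_mass_pos)
  have wm [measurable]: "(\<lambda>z. w (fst z) n (snd z)) \<in> borel_measurable (?D \<Otimes>\<^sub>M unif_ball)" if "n < N" for n
    using w that by (simp add: linear_estimators_def case_prod_beta')
  have fm [measurable]: "(\<lambda>z. ?f (a z) (b z)) \<in> borel_measurable Q"
    if "a \<in> Q \<rightarrow>\<^sub>M borel \<Otimes>\<^sub>M borel" "b \<in> Q \<rightarrow>\<^sub>M borel" for a b and Q :: "'q measure"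
    using measurable_compose[OF measurable_Pair[OF that] ridge_atom_measurable] by simp
  have Rm: "(\<lambda>q. ennreal (?v (a q) * ?R (a q) (fst (b q)) (snd (b q)))) \<in> borel_measurable Q"
    "(\<lambda>q. ennreal (?R (a q) (fst (b q)) (snd (b q)))) \<in> borel_measurable Q"
    if a [measurable]: "a \<in> Q \<rightarrow>\<^sub>M borel \<Otimes>\<^sub>M borel" and b [measurable]: "b \<in> Q \<rightarrow>\<^sub>M ?D \<Otimes>\<^sub>M unif_ball" for a b and Q :: "'q measure"
  proof -
    have 1: "(\<lambda>q. w (fst (b q)) n (snd (b q))) \<in> borel_measurable Q" if "n < N" for n
      using measurable_compose[OF b wm[OF that]] .
    have 2: "(\<lambda>q. fst (b q) n) \<in> Q \<rightarrow>\<^sub>M borel" if "n < N" for n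
    proof -
      have "(\<lambda>\<omega>. \<omega> n) \<in> ?D \<rightarrow>\<^sub>M (unif_ball :: 'a measure)"
        using that by (intro measurable_component_singleton) simp
      from measurable_compose[OF measurable_compose[OF b measurable_fst] this]
      show ?thesis by (simp cong: measurable_cong_sets)
    qed
    have 3: "(\<lambda>q. snd (b q)) \<in> Q \<rightarrow>\<^sub>M borel"
      using measurable_compose[OF b measurable_snd] by (simp cong: measurable_cong_sets)
    have R: "(\<lambda>q. ?R (a q) (fst (b q)) (snd (b q))) \<in> borel_measurable Q"
      by (intro borel_measurable_add borel_measurable_times borel_measurable_power borel_measurable_diff borel_measurable_sum borel_measurable_const fm a 1 2 3) auto
    then show "(\<lambda>q. ennreal (?R (a q) (fst (b q)) (snd (b q)))) \<in> borel_measurable Q" by measurable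
    from R measurable_compose[OF a prior_weight_measurable]
    show "(\<lambda>q. ennreal (?v (a q) * ?R (a q) (fst (b q)) (snd (b q)))) \<in> borel_measurable Q" by measurable
  qed
  have "ennreal (2 * \<mu> - \<mu>\<^sup>2 * (?E + real N * ?K / (M * \<sigma>\<^sup>2))) = (\<integral>\<^sup>+X. ennreal (2 * \<mu> - \<mu>\<^sup>2 * (?E + real N * ?K / (M * \<sigma>\<^sup>2))) \<partial>?D)"
    by (simp add: D.emeasure_space_1)
  also have "\<dots> \<le> (\<integral>\<^sup>+X. \<integral>\<^sup>+x. ennreal (2 * \<mu> - \<mu>\<^sup>2 * (?E + (\<Sum>n<N. ?u (X n) x) / (M * \<sigma>\<^sup>2))) \<partial>unif_ball \<partial>?D)"
  proof (rule nn_integral_mono)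
    fix X :: "nat \<Rightarrow> 'a"
    let ?g = "\<lambda>x. 2 * \<mu> - \<mu>\<^sup>2 * (?E + (\<Sum>n<N. ?u (X n) x) / (M * \<sigma>\<^sup>2))"
    note i = integrable_profile_square[OF assms(2)] and e = integral_profile_square[OF assms(2)]
    have ig: "integrable unif_ball ?g"
      by (intro Bochner_Integration.integrable_diff integrable_mult_right Bochner_Integration.integrable_add
          integrable_divide Bochner_Integration.integrable_sum i U.integrable_const)
    have "(\<integral>x. ?g x \<partial>unif_ball) = 2 * \<mu> - \<mu>\<^sup>2 * (?E + (\<Sum>n<N. (\<integral>x. ?u (X n) x \<partial>unif_ball)) / (M * \<sigma>\<^sup>2))"
    proof -
      have affine: "(\<integral>x. a - b * (c + q x / k) \<partial>unif_ball) = a - b * (c + (\<integral>x. q x \<partial>unif_ball) / k)"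
        if "integrable unif_ball q" for a b c k and q :: "'a \<Rightarrow> real"
        using that U.prob_space by (simp add: measure_def)
      have "(\<integral>x. ?g x \<partial>unif_ball) = 2 * \<mu> - \<mu>\<^sup>2 * (?E + (\<integral>x. (\<Sum>n<N. ?u (X n) x) \<partial>unif_ball) / (M * \<sigma>\<^sup>2))"
        by (rule affine) (intro Bochner_Integration.integrable_sum i)
      also have "(\<integral>x. (\<Sum>n<N. ?u (X n) x) \<partial>unif_ball) = (\<Sum>n<N. (\<integral>x. ?u (X n) x \<partial>unif_ball))"
        by (rule Bochner_Integration.integral_sum) (rule i)
      finally show ?thesis .
    qed
    moreover have "(\<Sum>n<N. (\<integral>x. ?u (X n) x \<partial>unif_ball)) \<le> real (card {..<N}) * ?K"
      by (rule sum_bounded_above) (rule e)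
    then have "(\<Sum>n<N. (\<integral>x. ?u (X n) x \<partial>unif_ball)) \<le> real N * ?K"
      by (simp only: card_lessThan)
    then have "\<mu>\<^sup>2 * (?E + (\<Sum>n<N. (\<integral>x. ?u (X n) x \<partial>unif_ball)) / (M * \<sigma>\<^sup>2)) \<le> \<mu>\<^sup>2 * (?E + real N * ?K / (M * \<sigma>\<^sup>2))"
      using M by (intro mult_left_mono add_left_mono divide_right_mono) auto
    ultimately have "2 * \<mu> - \<mu>\<^sup>2 * (?E + real N * ?K / (M * \<sigma>\<^sup>2)) \<le> (\<integral>x. ?g x \<partial>unif_ball)" by linarith
    then have "ennreal (2 * \<mu> - \<mu>\<^sup>2 * (?E + real N * ?K / (M * \<sigma>\<^sup>2))) \<le> ennreal (\<integral>x. ?g x \<partial>unif_ball)" by (rule ennreal_leI)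
    also have "\<dots> \<le> (\<integral>\<^sup>+x. ennreal (?g x) \<partial>unif_ball)" by (rule ennreal_integral_le_nn_integral[OF ig])
    finally show "ennreal (2 * \<mu> - \<mu>\<^sup>2 * (?E + real N * ?K / (M * \<sigma>\<^sup>2))) \<le> (\<integral>\<^sup>+x. ennreal (?g x) \<partial>unif_ball)" .
  qed
  also have "\<dots> \<le> (\<integral>\<^sup>+X. \<integral>\<^sup>+x. \<integral>\<^sup>+\<theta>. ennreal (?v \<theta> * ?R \<theta> X x) \<partial>?P \<partial>unif_ball \<partial>?D)"
  proof (rule nn_integral_mono, rule nn_integral_mono_AE)
    fix X :: "nat \<Rightarrow> 'a"
    show "AE x in unif_ball. ennreal (2 * \<mu> - \<mu>\<^sup>2 * (?E + (\<Sum>n<N. ?u (X n) x) / (M * \<sigma>\<^sup>2))) \<le> (\<integral>\<^sup>+\<theta>. ennreal (?v \<theta> * ?R \<theta> X x) \<partial>?P)"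
      unfolding M_def using AE_unif_ball by eventually_elim (rule bayes_dual_lower_bound[OF assms(1-4)])
  qed
  also have "\<dots> = (\<integral>\<^sup>+z. \<integral>\<^sup>+\<theta>. ennreal (?v \<theta> * ?R \<theta> (fst z) (snd z)) \<partial>?P \<partial>(?D \<Otimes>\<^sub>M unif_ball))"
  proof (subst U.nn_integral_fst[symmetric])
    have "(\<lambda>(z, \<theta>). ennreal (?v \<theta> * ?R \<theta> (fst z) (snd z))) \<in> borel_measurable ((?D \<Otimes>\<^sub>M unif_ball) \<Otimes>\<^sub>M ?P)"
      unfolding case_prod_beta by (rule Rm) measurable
    then show "(\<lambda>z. \<integral>\<^sup>+\<theta>. ennreal (?v \<theta> * ?R \<theta> (fst z) (snd z)) \<partial>?P) \<in> borel_measurable (?D \<Otimes>\<^sub>M unif_ball)"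
      by (rule sigma_finite_measure.borel_measurable_nn_integral[OF lborel_pair.sigma_finite_measure_axioms])
  qed simp
  also have "\<dots> = (\<integral>\<^sup>+\<theta>. \<integral>\<^sup>+z. ennreal (?v \<theta> * ?R \<theta> (fst z) (snd z)) \<partial>(?D \<Otimes>\<^sub>M unif_ball) \<partial>?P)"
    by (rule PDU.Fubini') (unfold case_prod_beta, rule Rm, measurable)
  also have "\<dots> \<le> (\<integral>\<^sup>+\<theta>. ennreal (?v \<theta>) * S \<partial>?P)"
  proof (rule nn_integral_mono_AE)
    have "AE \<theta> in ?P. fst \<theta> \<noteq> 0"
    proof (rule lborel_pair.AE_pair_measure)
      show "{\<theta> \<in> space ?P. fst \<theta> \<noteq> 0} \<in> sets ?P" by measurable
    qed (use AE_lborel_singleton[of "0::'a"] in auto)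
    then show "AE \<theta> in ?P. (\<integral>\<^sup>+z. ennreal (?v \<theta> * ?R \<theta> (fst z) (snd z)) \<partial>(?D \<Otimes>\<^sub>M unif_ball)) \<le> ennreal (?v \<theta>) * S"
    proof eventually_elim
      fix \<theta> :: "'a \<times> real" assume "fst \<theta> \<noteq> 0"
      then have c: "?f \<theta> \<in> {f. f \<in> RBV2_ball \<and> RTV2_ball f \<le> ereal C}"
        using ridge_atom_in_class[OF assms(1,2), of "fst \<theta>" "snd \<theta>"] by simp
      have f [measurable]: "?f \<theta> \<in> borel_measurable borel"
        unfolding ridge_atom_def case_prod_beta by measurable
      have "(\<integral>\<^sup>+z. ennreal (?v \<theta> * ?R \<theta> (fst z) (snd z)) \<partial>(?D \<Otimes>\<^sub>M unif_ball))
        = (\<integral>\<^sup>+z. ennreal (?v \<theta>) * ennreal (?R \<theta> (fst z) (snd z)) \<partial>(?D \<Otimes>\<^sub>M unif_ball))"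
        by (simp add: ennreal_mult' prior_weight_nonneg)
      also have "\<dots> = ennreal (?v \<theta>) * (\<integral>\<^sup>+z. ennreal (?R \<theta> (fst z) (snd z)) \<partial>(?D \<Otimes>\<^sub>M unif_ball))"
        by (rule nn_integral_cmult, rule Rm) (auto simp: space_pair_measure)
      also have "(\<integral>\<^sup>+z. ennreal (?R \<theta> (fst z) (snd z)) \<partial>(?D \<Otimes>\<^sub>M unif_ball)) = lin_risk N \<sigma> (?f \<theta>) w"
        unfolding lin_risk_eq[OF assms(4) w f]
        by (subst U.nn_integral_fst[symmetric], rule Rm) (auto simp: space_pair_measure)
      also have "\<dots> \<le> S" unfolding S_def using c by (rule SUP_upper)
      finally show "(\<integral>\<^sup>+z. ennreal (?v \<theta> * ?R \<theta> (fst z) (snd z)) \<partial>(?D \<Otimes>\<^sub>M unif_ball)) \<le> ennreal (?v \<theta>) * S"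
        by (simp add: mult_left_mono)
    qed
  qed
  also have "\<dots> = (\<integral>\<^sup>+\<theta>. ennreal (?v \<theta>) \<partial>?P) * S"
    by (rule nn_integral_multc) measurable
  also have "(\<integral>\<^sup>+\<theta>. ennreal (?v \<theta>) \<partial>?P) = ennreal M"
    unfolding M_def by (rule nn_integral_eq_integral[OF integrable_prior_weight]) (simp add: prior_weight_nonneg)
  finally show ?thesis .
qed

theorem theorem7:
  fixes C :: real
  assumes "C > 0"
  shows "\<exists>c > 0. \<forall>\<sigma> > 0. \<exists>N0. \<forall>N \<ge> N0.
           lin_minimax TYPE('a::euclidean_space) C \<sigma> N
             \<ge> ennreal (c * (real N / \<sigma>\<^sup>2) powr (- 3 / (real DIM('a) + 3)))"
proof -
  let ?d = "DIM('a)"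
  define M where "M = (\<integral>\<theta>. prior_weight \<theta> \<partial>(lborel \<Otimes>\<^sub>M lborel :: ('a \<times> real) measure))"
  define E where "E = dual_energy TYPE('a) C"
  define K where "K = sqrt (2 * pi) ^ ?d / measure lborel (cball (0::'a) 1)"
  have M: "M > 0" unfolding M_def by (rule prior_mass_pos)
  have E: "E \<ge> 0"
    unfolding E_def dual_energy_def
    by (intro mult_nonneg_nonneg divide_nonneg_nonneg integral_nonneg_AE AE_I2) auto
  have K: "K > 0" unfolding K_def using emeasure_cball_1(2)[where 'a='a] by simp
  define c where "c = 1 / (M * E + K)"
  have c: "c > 0" unfolding c_def using M E K by (simp add: add_nonneg_pos)
  have "ennreal (c * (real N / \<sigma>\<^sup>2) powr (- 3 / (real ?d + 3))) \<le> lin_minimax TYPE('a) C \<sigma> N"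
    if \<sigma>: "\<sigma> > 0" and N: "N \<ge> nat \<lceil>\<sigma>\<^sup>2\<rceil>" for \<sigma> :: real and N
  proof -
    define r where "r = real N / \<sigma>\<^sup>2"
    define h where "h = r powr (- 1 / (real ?d + 3))"
    have "\<sigma>\<^sup>2 \<le> real N" using N by linarith
    then have r: "r \<ge> 1" unfolding r_def using \<sigma> by simp
    have h: "h > 0" unfolding h_def using r by simp
    have h1: "h \<le> 1" unfolding h_def using r powr_mono[of "- 1 / (real ?d + 3)" 0 r] by simp
    have h3: "h ^ 3 = r powr (- 3 / (real ?d + 3))"
      unfolding h_def using r by (simp add: powr_power)
    have "h ^ (?d + 3) = r powr (- 1)"
      unfolding h_def using r by (subst powr_power) (auto simp: field_simps)
    then have hd: "h ^ ?d * h ^ 3 = 1 / r"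
      using r by (simp add: power_add powr_minus_divide)
    then have rh: "r * h ^ ?d = 1 / h ^ 3" using h r by (simp add: field_simps)
    define \<mu> where "\<mu> = h ^ 3 / (E + K / M)"
    have EK: "E + K / M > 0" using E K M by (simp add: add_nonneg_pos)
    have "E / h ^ 3 + real N * (K * h ^ ?d) / (M * \<sigma>\<^sup>2) = E / h ^ 3 + K / M * (r * h ^ ?d)"
      unfolding r_def by simp
    also have "\<dots> = (E + K / M) / h ^ 3"
      unfolding rh by (simp add: add_divide_distrib)
    finally have eq: "E / h ^ 3 + real N * (K * h ^ ?d) / (M * \<sigma>\<^sup>2) = (E + K / M) / h ^ 3" .
    have "2 * \<mu> - \<mu>\<^sup>2 * ((E + K / M) / h ^ 3) = h ^ 3 / (E + K / M)"
    proof -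
      have "2 * (t / k) - (t / k)\<^sup>2 * (k / t) = t / k" if "t > 0" "k > 0" for t k :: real
        using that by (simp add: field_simps power2_eq_square)
      then show ?thesis unfolding \<mu>_def using h EK by simp
    qed
    also have "\<dots> = M * (c * h ^ 3)"
      unfolding c_def using M EK by (simp add: field_simps)
    finally have val: "2 * \<mu> - \<mu>\<^sup>2 * ((E + K / M) / h ^ 3) = M * (c * h ^ 3)" .
    have "ennreal (c * h ^ 3) \<le> (SUP f \<in> {f :: 'a \<Rightarrow> real. f \<in> RBV2_ball \<and> RTV2_ball f \<le> ereal C}. lin_risk N \<sigma> f w)"
      (is "_ \<le> ?S") if w: "w \<in> linear_estimators N" for w :: "(nat \<Rightarrow> 'a) \<Rightarrow> nat \<Rightarrow> 'a \<Rightarrow> real"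
    proof -
      have "ennreal (M * (c * h ^ 3)) \<le> ennreal M * ?S"
        using lin_risk_sup_lower_bound[OF assms h h1 \<sigma> w, of \<mu>]
        unfolding M_def[symmetric] E_def[symmetric] K_def[symmetric] eq val .
      then have "ennreal M * ennreal (c * h ^ 3) \<le> ennreal M * ?S"
        using M by (simp add: ennreal_mult')
      then show ?thesis
        using M by (simp add: ennreal_mult_le_mult_iff)
    qed
    then show ?thesis
      unfolding lin_minimax_def r_def[symmetric] h3[symmetric] by (rule INF_greatest)
  qed
  with c show ?thesis by blast
qed

end
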